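(* Let $\gamma\in(0,\infty)$ and $\alpha\in(0,\tfrac14]$, and set $s(\gamma)=\min\{(\tfrac12-\tfrac\alpha\gamma)^+,\tfrac12-\alpha\}$. For every admissible curve $\Gamma$ with Hölder exponent $\alpha$ and every $s>s(\gamma)$, $\lim_{t\to0^+}P_\gamma f(\Gamma(x,t),t)=f(x)$ for a.e. $x\in\mathbb{R}$, for all $f\in H^s(\mathbb{R})$. Conversely, there exists an admissible curve $\Gamma$ with Hölder exponent $\alpha$ such that for every $s<s(\gamma)$ there is $f\in H^s(\mathbb{R})$ for which this a.e. convergence fails.
   Context: For $\gamma>0$, $f\in H^s(\mathbb{R})$, $\Gamma:\mathbb{R}\times[-1,1]\to\mathbb{R}$ and $t\in[0,1]$, define $$P_\gamma f(\Gamma(x,t),t)=\frac1{2\pi}\int_{\mathbb{R}}e^{i(\Gamma(x,t)\xi+t|\xi|^2)}e^{-t^\gamma|\xi|^2}\hat f(\xi)\,d\xi,$$ where $\hat f(\xi)=\int e^{-ix\xi}f(x)\,dx$. An admissible curve with Hölder exponent $\alpha\in(0,1]$ is a continuous $\Gamma:\mathbb{R}\times[-1,1]\to\mathbb{R}$ with $\Gamma(x,0)=x$, bilipschitz in $x$: $C_1|x-x'|\le|\Gamma(x,t)-\Gamma(x',t)|\le C_2|x-x'|$ for all $t\in[-1,1]$, $x,x'\in\mathbb{R}$, and $\alpha$-Hölder in $t$: $|\Gamma(x,t)-\Gamma(x,t')|\le C_3|t-t'|^\alpha$ for all $x\in\mathbb{R}$, $t,t'\in[-1,1]$, with constants $C_1,C_2,C_3>0$.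 $a^+=\max\{a,0\}$.
   Formalization: The converse is stated for 0 ≤ s < s(γ): for s < 0 elements of H^s need not be functions, so f(x) is undefined, and if s(γ) = 0 all L² data converge; if s(γ) > 0 the case s < 0 follows from s = 0. *)

theory Defs
  imports "HOL-Analysis.Analysis"
begin

definition square_integrable :: "(real \<Rightarrow> complex) \<Rightarrow> bool" where
  "square_integrable f \<longleftrightarrow> f \<in> borel_measurable lborel \<and>
     integrable lborel (\<lambda>x. (cmod (f x))\<^sup>2)"

text \<open>Plancherel (L^2) Fourier transform with convention
  hat f (xi) = int e^{-i x xi} f(x) dx: g is the L^2-limit of the Fourier
  transforms of the truncations f restricted to [-R,R].\<close>
definition fourier_L2 :: "(real \<Rightarrow> complex) \<Rightarrow> (real \<Rightarrow> complex) \<Rightarrow> bool" where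
  "fourier_L2 f g \<longleftrightarrow> square_integrable f \<and> square_integrable g \<and>
     ((\<lambda>R. \<integral>\<^sup>+ \<xi>. ennreal ((cmod (g \<xi> -
         (LINT x:{-R..R}|lborel. cis (- (x * \<xi>)) * f x)))\<^sup>2) \<partial>lborel) \<longlongrightarrow> 0) at_top"

definition sobolev :: "real \<Rightarrow> (real \<Rightarrow> complex) \<Rightarrow> (real \<Rightarrow> complex) \<Rightarrow> bool" where
  "sobolev s f g \<longleftrightarrow> fourier_L2 f g \<and>
     integrable lborel (\<lambda>\<xi>. (1 + \<xi>\<^sup>2) powr s * (cmod (g \<xi>))\<^sup>2)"

text \<open>P_gamma f (y,t), expressed through the Fourier transform g of f.\<close>
definition Pgamma :: "real \<Rightarrow> (real \<Rightarrow> complex) \<Rightarrow> real \<Rightarrow> real \<Rightarrow> complex" where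
  "Pgamma \<gamma> g y t = complex_of_real (1 / (2 * pi)) *
     (LINT \<xi>|lborel. cis (y * \<xi> + t * \<xi>\<^sup>2) *
        complex_of_real (exp (- (t powr \<gamma>) * \<xi>\<^sup>2)) * g \<xi>)"

definition admissible_curve :: "real \<Rightarrow> (real \<Rightarrow> real \<Rightarrow> real) \<Rightarrow> bool" where
  "admissible_curve \<alpha> \<Gamma> \<longleftrightarrow>
     continuous_on (UNIV \<times> {-1..1}) (\<lambda>(x, t). \<Gamma> x t) \<and>
     (\<forall>x. \<Gamma> x 0 = x) \<and>
     (\<exists>C1 C2 C3. C1 > 0 \<and> C2 > 0 \<and> C3 > 0 \<and>
        (\<forall>t\<in>{-1..1}. \<forall>x x'. C1 * \<bar>x - x'\<bar> \<le> \<bar>\<Gamma> x t - \<Gamma> x' t\<bar> \<and>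
                              \<bar>\<Gamma> x t - \<Gamma> x' t\<bar> \<le> C2 * \<bar>x - x'\<bar>) \<and>
        (\<forall>x. \<forall>t\<in>{-1..1}. \<forall>t'\<in>{-1..1}. \<bar>\<Gamma> x t - \<Gamma> x t'\<bar> \<le> C3 * \<bar>t - t'\<bar> powr \<alpha>))"

definition s_crit :: "real \<Rightarrow> real \<Rightarrow> real" where
  "s_crit \<gamma> \<alpha> = min (max (1/2 - \<alpha> / \<gamma>) 0) (1/2 - \<alpha>)"

definition converges_ae :: "real \<Rightarrow> (real \<Rightarrow> real \<Rightarrow> real) \<Rightarrow> (real \<Rightarrow> complex) \<Rightarrow> (real \<Rightarrow> complex) \<Rightarrow> bool" where
  "converges_ae \<gamma> \<Gamma> f g \<longleftrightarrow>
     (AE x in lborel. ((\<lambda>t. Pgamma \<gamma> g (\<Gamma> x t) t) \<longlongrightarrow> f x) (at_right 0))"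

end

theory Submission
  imports Defs "HOL-Probability.Characteristic_Functions" "HOL-Complex_Analysis.Conformal_Mappings"
    "HOL-Real_Asymp.Real_Asymp"
begin

text \<open>Convergence for \<open>s > s_crit \<gamma> \<alpha>\<close> follows from a maximal estimate. Linearising the supremum by a
  measurable choice of times and applying the \<open>T T\<^sup>*\<close> argument reduces it to a bound, by an integrable function
  of \<open>x - x'\<close>, for an oscillatory kernel with phase \<open>(\<Gamma> x t - \<Gamma> x' t') * \<xi> + (t - t') * \<xi>\<^sup>2\<close> and weight
  \<open>(1 + \<xi>\<^sup>2) powr (- s)\<close>. If \<open>\<bar>t - t'\<bar> powr \<alpha>\<close> is small compared with \<open>\<bar>x - x'\<bar>\<close> the linear part of the phase
  wins; otherwise \<open>\<bar>t - t'\<bar>\<close> is bounded below, and either dispersion or the damping gives the decay. The limit is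
  identified with \<open>f\<close> by treating the heat flow in the same way.

  For \<open>s < s_crit \<gamma> \<alpha>\<close> the curve \<open>x + \<bar>t\<bar> powr \<alpha>\<close> moves all of \<open>[0, 1]\<close> over a grid of narrow bumps before the flow has
  changed the bumps, while their \<open>H\<^sup>s\<close> norm is small. A gliding hump sum of such functions at rapidly
  decreasing scales is the counterexample.\<close>

section \<open>Gaussian integrals\<close>

text \<open>Both halves meet at one inequality. Put \<sigma> = min 1 \<gamma>. For times far apart
  relative to \<open>\<bar>x - x'\<bar>\<close> the kernel is at most a constant times \<rho> powr
  (s - 1/2) with \<rho> = \<open>\<bar>t - t'\<bar> powr \<sigma>\<close>, and \<rho> is at least of
  order \<open>\<bar>x - x'\<bar> powr (\<sigma> / \<alpha>)\<close>; the resulting power is locally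
  integrable iff s > 1/2 - \<alpha> / \<sigma>. For bumps of width 1 / R and spacing \<delta>, with
  R of order \<delta> powr (- \<sigma> / (2 \<alpha>)), the squared Sobolev norm is at most of order
  R powr (2 s - 1) / \<delta>, which vanishes with \<delta> iff s < 1/2 - \<alpha> / \<sigma>. The
  bound \<alpha> \<le> 1/4 matters for \<gamma> > 1: dispersion leaves a factor
  \<open>\<bar>t - t'\<bar> powr (2 * s - 1/2)\<close>, bounded because s > 1/2 - \<alpha> \<ge>
  1/4. For \<gamma> \<le> 1 the damping dominates \<open>\<bar>t - t'\<bar>\<close> and this term is
  absent. Since \<open>f\<close> and \<open>g\<close> are linked only by an \<open>L\<^sup>2\<close>
  limit, no pointwise inversion formula is at hand. The heat flow, a Gaussian average of
  \<open>f\<close>, is the bridge, and comparing integrals over intervals suffices to find its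
  limit.\<close>

lemma eventually_in_Icc_nat: "\<forall>\<^sub>F n in sequentially. x \<in> {- real n..real n}"
proof -
  obtain N :: nat where N: "\<bar>x\<bar> \<le> real N" using real_arch_simple by blast
  have "- real n \<le> x \<and> x \<le> real n" if "N \<le> n" for n
  proof -
    have "real N \<le> real n" using that by simp
    then show ?thesis using N by linarith
  qed
  then show ?thesis by (auto intro: eventually_sequentiallyI)
qed

lemma gaussian_integrable:
  fixes c :: real
  assumes "c > 0"
  shows "integrable lborel (\<lambda>x. exp (- c * x\<^sup>2))"
proof -
  have "integrable lborel (\<lambda>x. sqrt (pi / c) * normal_density 0 (sqrt (1 / (2 * c))) x)"
    using assms by (intro integrable_mult_right integrable_normal_density) auto
  moreover have "sqrt (pi / c) * normal_density 0 (sqrt (1 / (2 * c))) x = exp (- c * x\<^sup>2)" for x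
    using assms by (simp add: normal_density_def real_sqrt_divide real_sqrt_mult field_simps)
  ultimately show ?thesis by simp
qed

lemma gaussian_cis_integrable:
  fixes c :: real
  assumes "c > 0"
  shows "integrable lborel (\<lambda>x. cis (A * x) * complex_of_real (exp (- c * x\<^sup>2)))"
  by (rule Bochner_Integration.integrable_bound[OF gaussian_integrable[OF assms]])
     (auto simp: norm_mult cis_conv_exp)

text \<open>The characteristic function of the standard normal distribution, rescaled by
  \<open>k = sqrt (2 * c)\<close>.\<close>

lemma gaussian_fourier_real:
  fixes c A :: real
  assumes c: "c > 0"
  shows "(LINT x|lborel. cis (A * x) * complex_of_real (exp (- c * x\<^sup>2))) =
         complex_of_real (sqrt (pi / c) * exp (- A\<^sup>2 / (4 * c)))"
proof -
  define k where "k = sqrt (2 * c)"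
  have k: "k > 0" "k\<^sup>2 = 2 * c" using c by (auto simp: k_def)
  have "complex_of_real (exp (- (A / k)\<^sup>2 / 2)) = char std_normal_distribution (A / k)"
    by (simp add: char_std_normal_distribution)
  also have "\<dots> = (LINT x|lborel. std_normal_density x *\<^sub>R iexp ((A / k) * x))"
    unfolding char_def by (subst integral_density) auto
  also have "\<dots> = k *\<^sub>R (LINT x|lborel. std_normal_density (0 + k * x) *\<^sub>R iexp ((A / k) * (0 + k * x)))"
    using k by (subst lborel_integral_real_affine[where c=k and t=0]) auto
  also have "(\<lambda>x. std_normal_density (0 + k * x) *\<^sub>R iexp ((A / k) * (0 + k * x))) =
     (\<lambda>x. complex_of_real (1 / sqrt (2 * pi)) * (cis (A * x) * complex_of_real (exp (- c * x\<^sup>2))))"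
    using k by (intro ext) (simp add: std_normal_density_def cis_conv_exp power_mult_distrib scaleR_conv_of_real mult_ac)
  also have "(LINT x|lborel. complex_of_real (1 / sqrt (2 * pi)) * (cis (A * x) * complex_of_real (exp (- c * x\<^sup>2)))) =
     complex_of_real (1 / sqrt (2 * pi)) * (LINT x|lborel. cis (A * x) * complex_of_real (exp (- c * x\<^sup>2)))"
    by (rule integral_mult_right_zero)
  finally have "complex_of_real (exp (- (A / k)\<^sup>2 / 2)) =
     complex_of_real (k / sqrt (2 * pi)) * (LINT x|lborel. cis (A * x) * complex_of_real (exp (- c * x\<^sup>2)))"
    by (simp add: scaleR_conv_of_real)
  moreover have "(A / k)\<^sup>2 / 2 = A\<^sup>2 / (4 * c)" using k by (simp add: power_divide)
  moreover have "k / sqrt (2 * pi) = sqrt (c / pi)" by (simp add: k_def real_sqrt_mult real_sqrt_divide)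
  ultimately have "(LINT x|lborel. cis (A * x) * complex_of_real (exp (- c * x\<^sup>2))) =
     complex_of_real (exp (- (A\<^sup>2 / (4 * c)))) / complex_of_real (sqrt (c / pi))"
    using c by (simp add: field_simps)
  also have "\<dots> = complex_of_real (sqrt (pi / c) * exp (- A\<^sup>2 / (4 * c)))"
    using c by (simp add: real_sqrt_divide)
  finally show ?thesis .
qed

lemma gaussian_integral:
  fixes c :: real
  assumes "c > 0"
  shows "(LINT x|lborel. exp (- c * x\<^sup>2)) = sqrt (pi / c)"
proof -
  have "complex_of_real (LINT x|lborel. exp (- c * x\<^sup>2)) = complex_of_real (sqrt (pi / c))"
    using gaussian_fourier_real[OF assms, of 0] unfolding integral_complex_of_real[symmetric] by simp
  then show ?thesis using of_real_eq_iff by blast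
qed

lemma complex_gaussian_integrable:
  fixes A :: real and z :: complex
  assumes z: "Re z > 0"
  shows "integrable lborel (\<lambda>x. cis (A * x) * exp (- z * (complex_of_real x)\<^sup>2))"
proof (rule Bochner_Integration.integrable_bound[OF gaussian_integrable[OF z]])
  have "(\<lambda>x. cis (A * x) * exp (- z * (complex_of_real x)\<^sup>2)) \<in> borel_measurable borel"
    by (intro borel_measurable_continuous_onI continuous_intros)
  then show "(\<lambda>x. cis (A * x) * exp (- z * (complex_of_real x)\<^sup>2)) \<in> borel_measurable lborel"
    by simp
  show "AE x in lborel. norm (cis (A * x) * exp (- z * (complex_of_real x)\<^sup>2)) \<le> norm (exp (- Re z * x\<^sup>2))"
    by (simp add: norm_mult flip: of_real_power)
qed

text \<open>The Leibniz rule is applied on the compact intervals \<open>[-n, n]\<close>. On a closed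
  ball of radius \<open>Re z0 / 2\<close> the real part stays above \<open>d\<close>, so the tails
  are bounded by those of \<open>exp (- d * x\<^sup>2)\<close> uniformly in \<open>z\<close>, and
  holomorphy survives the uniform limit.\<close>

lemma gaussian_fourier_holomorphic:
  fixes A :: real
  shows "(\<lambda>z. LINT x|lborel. cis (A * x) * exp (- z * (complex_of_real x)\<^sup>2)) holomorphic_on {z. 0 < Re z}"
proof (rule holomorphic_uniform_sequence)
  let ?F = "\<lambda>z x. cis (A * x) * exp (- z * (complex_of_real x)\<^sup>2)"
  show op: "open {z. 0 < Re z}" by (rule open_halfspace_Re_gt)
  show "(\<lambda>z. integral (cbox (- real n) (real n)) (?F z)) holomorphic_on {z. 0 < Re z}" for n
  proof (rule leibniz_rule_holomorphic)
    show "((\<lambda>z. ?F z x) has_field_derivative (- (complex_of_real x)\<^sup>2 * ?F z x)) (at z within {z. 0 < Re z})" for z x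
      by (auto intro!: derivative_eq_intros)
    show "?F z integrable_on cbox (- real n) (real n)" for z
      by (intro integrable_continuous continuous_intros)
    show "continuous_on ({z. 0 < Re z} \<times> cbox (- real n) (real n)) (\<lambda>(z, x). - (complex_of_real x)\<^sup>2 * ?F z x)"
      by (auto simp: case_prod_beta intro!: continuous_intros)
    show "convex {z. 0 < Re z}" by (rule convex_halfspace_Re_gt)
  qed
  fix z0 assume "z0 \<in> {z. 0 < Re z}"
  then have z0: "Re z0 > 0" by simp
  define d where "d = Re z0 / 2"
  have d: "d > 0" using z0 by (simp add: d_def)
  have Re: "Re z \<ge> d" if "z \<in> cball z0 d" for z
  proof -
    have "\<bar>Re (z0 - z)\<bar> \<le> d" using that abs_Re_le_cmod[of "z0 - z"] by (simp add: dist_norm)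
    then show ?thesis unfolding d_def minus_complex.sel by linarith
  qed
  let ?G = "\<lambda>n::nat. LINT x|lborel. indicator (- {- real n..real n}) x * exp (- d * x\<^sup>2)"
  have "?G \<longlonglongrightarrow> (LINT (x::real)|lborel. 0)"
  proof (rule integral_dominated_convergence[where w="\<lambda>x. exp (- d * x\<^sup>2)"])
    show "integrable lborel (\<lambda>x. exp (- d * x\<^sup>2))" using gaussian_integrable[OF d] .
    show "AE x in lborel. (\<lambda>n::nat. indicator (- {- real n..real n}) x * exp (- d * x\<^sup>2)) \<longlonglongrightarrow> 0"
    proof (rule AE_I2)
      fix x :: real
      have "eventually (\<lambda>n. indicator (- {- real n..real n}) x * exp (- d * x\<^sup>2) = 0) sequentially"
        using eventually_in_Icc_nat[of x] by eventually_elim (simp add: indicator_def)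
      then show "(\<lambda>n::nat. indicator (- {- real n..real n}) x * exp (- d * x\<^sup>2)) \<longlonglongrightarrow> 0"
        by (rule tendsto_eventually)
    qed
  qed (auto simp: indicator_def intro!: AE_I2)
  then have G0: "?G \<longlonglongrightarrow> 0" by simp
  have bound: "norm (integral (cbox (- real n) (real n)) (?F z) - (LINT x|lborel. ?F z x)) \<le> ?G n"
    if z: "z \<in> cball z0 d" for z n
  proof -
    have Rz: "Re z > 0" using Re[OF z] d by linarith
    have I: "integrable lborel (?F z)" by (rule complex_gaussian_integrable[OF Rz])
    have I1: "integrable lborel (\<lambda>x. indicator {- real n..real n} x *\<^sub>R ?F z x)"
      by (rule integrable_mult_indicator[OF _ I]) simp
    have "integral (cbox (- real n) (real n)) (?F z) = (LINT x:{- real n..real n}|lborel. ?F z x)"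
      using I1 by (subst set_borel_integral_eq_integral) (auto simp: set_integrable_def)
    also have "\<dots> - (LINT x|lborel. ?F z x) = (LINT x|lborel. indicator {- real n..real n} x *\<^sub>R ?F z x - ?F z x)"
      unfolding set_lebesgue_integral_def using I I1 by simp
    also have "norm \<dots> \<le> ?G n"
    proof (rule Bochner_Integration.integral_norm_bound_integral)
      show "integrable lborel (\<lambda>x. indicator {- real n..real n} x *\<^sub>R ?F z x - ?F z x)" using I I1 by simp
      show "integrable lborel (\<lambda>x. indicator (- {- real n..real n}) x * exp (- d * x\<^sup>2))"
        using integrable_mult_indicator[OF _ gaussian_integrable[OF d], of "- {- real n..real n}"] by simp
      fix x :: real
      have "Re z * x\<^sup>2 \<ge> d * x\<^sup>2" using Re[OF z] by (intro mult_right_mono) auto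
      then have "norm (?F z x) \<le> exp (- d * x\<^sup>2)" by (simp add: norm_mult flip: of_real_power)
      then show "norm (indicator {- real n..real n} x *\<^sub>R ?F z x - ?F z x) \<le> indicator (- {- real n..real n}) x * exp (- d * x\<^sup>2)"
        by (auto simp: indicator_def)
    qed
    finally show ?thesis .
  qed
  have "uniform_limit (cball z0 d) (\<lambda>n z. integral (cbox (- real n) (real n)) (?F z)) (\<lambda>z. LINT x|lborel. ?F z x) sequentially"
  proof (rule uniform_limitI)
    fix e :: real assume "e > 0"
    then have "eventually (\<lambda>n. ?G n < e) sequentially" using G0 by (rule order_tendstoD(2)[rotated])
    then show "\<forall>\<^sub>F n in sequentially. \<forall>z\<in>cball z0 d. dist (integral (cbox (- real n) (real n)) (?F z)) (LINT x|lborel. ?F z x) < e"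
    proof eventually_elim
      case (elim n)
      show ?case using order.strict_trans1[OF bound elim] unfolding dist_norm by blast
    qed
  qed
  moreover have "cball z0 d \<subseteq> {z. 0 < Re z}" using Re d by force
  ultimately show "\<exists>d>0. cball z0 d \<subseteq> {z. 0 < Re z} \<and>
      uniform_limit (cball z0 d) (\<lambda>n z. integral (cbox (- real n) (real n)) (?F z)) (\<lambda>z. LINT x|lborel. ?F z x) sequentially"
    using d by blast
qed

text \<open>Both sides are holomorphic in the right half plane and agree on the positive reals,
  which accumulate at 1; the identity theorem does the rest. The principal branch
  \<open>exp (- Ln z / 2)\<close> is the branch of \<open>z powr (- 1/2)\<close> that is positive
  there.\<close>

lemma gaussian_fourier_complex:
  fixes A :: real and z :: complex
  assumes z: "Re z > 0"
  shows "(LINT x|lborel. cis (A * x) * exp (- z * (complex_of_real x)\<^sup>2)) =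
         complex_of_real (sqrt pi) * exp (- Ln z / 2) * exp (- (complex_of_real A)\<^sup>2 / (4 * z))"
    (is "?F z = ?G z")
proof -
  let ?S = "{z. 0 < Re z}" and ?U = "complex_of_real ` {0<..}"
  have "?F z - ?G z = 0"
  proof (rule analytic_continuation[of "\<lambda>z. ?F z - ?G z" ?S ?U 1])
    have "?G holomorphic_on ?S"
      by (intro holomorphic_intros) (auto simp: complex_nonpos_Reals_iff)
    then show "(\<lambda>z. ?F z - ?G z) holomorphic_on ?S"
      by (intro holomorphic_on_diff gaussian_fourier_holomorphic)
    show "open ?S" by (rule open_halfspace_Re_gt)
    show "connected ?S" by (intro convex_connected convex_halfspace_Re_gt)
    show "1 islimpt ?U"
      unfolding islimpt_approachable
    proof safe
      fix e :: real assume "e > 0"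
      then show "\<exists>x'\<in>?U. x' \<noteq> 1 \<and> dist x' 1 < e"
        by (intro bexI[of _ "complex_of_real (1 + e / 2)"] imageI) (auto simp: dist_norm)
    qed
    fix w assume "w \<in> ?U"
    then obtain c where c: "c > 0" "w = complex_of_real c" by auto
    have "?F w = (LINT x|lborel. cis (A * x) * complex_of_real (exp (- c * x\<^sup>2)))"
      by (simp add: c(2) flip: exp_of_real)
    also have "\<dots> = complex_of_real (sqrt (pi / c) * exp (- A\<^sup>2 / (4 * c)))"
      by (rule gaussian_fourier_real[OF c(1)])
    also have "sqrt (pi / c) = sqrt pi * exp (- ln c / 2)"
      using c by (simp add: real_sqrt_divide exp_minus ln_sqrt[symmetric] field_simps)
    also have "complex_of_real (sqrt pi * exp (- ln c / 2) * exp (- A\<^sup>2 / (4 * c))) = ?G w"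
      using c by (simp add: Ln_of_real flip: exp_of_real)
    finally show "?F w - ?G w = 0" by simp
  qed (use z in auto)
  then show ?thesis by simp
qed

text \<open>Apply the complex formula at \<open>z = w - i B\<close> and keep moduli only: the power
  comes from the modulus of \<open>z\<close>, the exponent from the real part of
  \<open>1 / z\<close>. The power carries dispersion and damping, the exponential the decay in
  \<open>A\<close>.\<close>

lemma gaussian_fourier_norm:
  fixes A B w :: real
  assumes w: "w > 0"
  shows "norm (LINT x|lborel. cis (A * x + B * x\<^sup>2) * complex_of_real (exp (- w * x\<^sup>2))) =
         sqrt pi * (w\<^sup>2 + B\<^sup>2) powr (- 1 / 4) * exp (- (A\<^sup>2 * w) / (4 * (w\<^sup>2 + B\<^sup>2)))"
proof -
  define z where "z = Complex w (- B)"
  have Rz: "Re z > 0" "z \<noteq> 0" using w by (auto simp: z_def complex_eq_iff)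
  have w0: "w \<noteq> 0" using w by simp
  have nz: "norm z = sqrt (w\<^sup>2 + B\<^sup>2)" by (simp add: z_def complex_norm)
  have pos: "w\<^sup>2 + B\<^sup>2 > 0" using w by (simp add: add_pos_nonneg)
  have "cis (A * x + B * x\<^sup>2) * complex_of_real (exp (- w * x\<^sup>2)) = cis (A * x) * exp (- z * (complex_of_real x)\<^sup>2)" for x
  proof -
    have "- z * (complex_of_real x)\<^sup>2 = \<i> * complex_of_real (B * x\<^sup>2) + complex_of_real (- w * x\<^sup>2)"
      by (simp add: z_def complex_eq_iff flip: of_real_power)
    then have "exp (- z * (complex_of_real x)\<^sup>2) = cis (B * x\<^sup>2) * complex_of_real (exp (- w * x\<^sup>2))"
      by (simp only: exp_add cis_conv_exp exp_of_real)
    then show ?thesis by (simp add: cis_mult flip: mult.assoc)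
  qed
  then have "norm (LINT x|lborel. cis (A * x + B * x\<^sup>2) * complex_of_real (exp (- w * x\<^sup>2))) =
     norm (complex_of_real (sqrt pi) * exp (- Ln z / 2) * exp (- (complex_of_real A)\<^sup>2 / (4 * z)))"
    by (simp only: gaussian_fourier_complex[OF Rz(1)])
  also have "\<dots> = sqrt pi * exp (- ln (norm z) / 2) * exp (Re (- (complex_of_real A)\<^sup>2 / (4 * z)))"
    using Rz by (simp add: norm_mult)
  also have "exp (- ln (norm z) / 2) = (w\<^sup>2 + B\<^sup>2) powr (- 1 / 4)"
    using pos by (simp add: nz powr_def ln_sqrt w0)
  also have "Re (- (complex_of_real A)\<^sup>2 / (4 * z)) = - (A\<^sup>2 * w) / (4 * (w\<^sup>2 + B\<^sup>2))"
    using pos by (simp add: z_def Re_divide field_simps power2_eq_square flip: of_real_power)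
  finally show ?thesis .
qed

section \<open>The dispersive kernel\<close>

lemma integrable_pair_mult:
  fixes f g :: "real \<Rightarrow> real"
  assumes f: "integrable lborel f" and g: "integrable lborel g"
  shows "integrable (lborel \<Otimes>\<^sub>M lborel) (\<lambda>(x, y). f x * g y)"
proof (rule lborel_pair.Fubini_integrable)
  have [measurable]: "f \<in> borel_measurable borel" "g \<in> borel_measurable borel"
    using borel_measurable_integrable[OF f] borel_measurable_integrable[OF g] by simp_all
  show "(\<lambda>(x, y). f x * g y) \<in> borel_measurable (lborel \<Otimes>\<^sub>M lborel)" by measurable
  show "integrable lborel (\<lambda>x. LINT y|lborel. norm (case (x, y) of (x, y) \<Rightarrow> f x * g y))"
    using f by (simp add: abs_mult)
  show "AE x in lborel. integrable lborel (\<lambda>y. case (x, y) of (x, y) \<Rightarrow> f x * g y)"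
    using g by simp
qed

text \<open>Euler's integral after the substitution \<open>v \<mapsto> b * v\<close>. With
  \<open>b = 1 + x\<^sup>2\<close> it writes the Sobolev weight as a superposition of Gaussians in
  \<open>x\<close>.\<close>

lemma nn_integral_powr_exp:
  fixes s b :: real
  assumes s: "s > 0" and b: "b > 0"
  shows "(\<integral>\<^sup>+v. ennreal (indicator {0<..} v * (v powr (s - 1) * exp (- b * v))) \<partial>lborel) = ennreal (Gamma s * b powr (- s))"
proof -
  have "(\<integral>\<^sup>+v. ennreal (indicator {0..} v * (v powr (s - 1) / exp v)) \<partial>lborel) = ennreal (Gamma s)"
    by (rule nn_integral_has_integral_lebesgue[OF _ Gamma_integral_real[OF s]]) auto
  also have "(\<integral>\<^sup>+v. ennreal (indicator {0..} v * (v powr (s - 1) / exp v)) \<partial>lborel) =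
      ennreal \<bar>b\<bar> * (\<integral>\<^sup>+v. ennreal (indicator {0..} (0 + b * v) * ((0 + b * v) powr (s - 1) / exp (0 + b * v))) \<partial>lborel)"
    using b by (intro nn_integral_real_affine) auto
  also have "(\<integral>\<^sup>+v. ennreal (indicator {0..} (0 + b * v) * ((0 + b * v) powr (s - 1) / exp (0 + b * v))) \<partial>lborel) =
      (\<integral>\<^sup>+v. ennreal (b powr (s - 1)) * ennreal (indicator {0<..} v * (v powr (s - 1) * exp (- b * v))) \<partial>lborel)"
    using b by (intro nn_integral_cong)
      (auto simp: indicator_def powr_mult exp_minus field_simps zero_le_mult_iff ennreal_mult[symmetric] dest: order_less_le_trans)
  also have "\<dots> = ennreal (b powr (s - 1)) * (\<integral>\<^sup>+v. ennreal (indicator {0<..} v * (v powr (s - 1) * exp (- b * v))) \<partial>lborel)"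
    by (intro nn_integral_cmult) auto
  finally have *: "ennreal \<bar>b\<bar> * (ennreal (b powr (s - 1)) * (\<integral>\<^sup>+v. ennreal (indicator {0<..} v * (v powr (s - 1) * exp (- b * v))) \<partial>lborel)) = ennreal (Gamma s)" by simp
  have "ennreal \<bar>b\<bar> * ennreal (b powr (s - 1)) = ennreal (b powr s)"
    using b by (simp add: ennreal_mult[symmetric] powr_diff)
  then have "ennreal (b powr s) * (\<integral>\<^sup>+v. ennreal (indicator {0<..} v * (v powr (s - 1) * exp (- b * v))) \<partial>lborel) = ennreal (Gamma s)"
    using * by (simp add: mult.assoc[symmetric])
  then have "ennreal (b powr (- s)) * (ennreal (b powr s) * (\<integral>\<^sup>+v. ennreal (indicator {0<..} v * (v powr (s - 1) * exp (- b * v))) \<partial>lborel)) = ennreal (b powr (- s)) * ennreal (Gamma s)"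
    by simp
  moreover have "ennreal (b powr (- s)) * ennreal (b powr s) = 1"
    using b by (simp add: ennreal_mult[symmetric] powr_add[symmetric])
  ultimately show ?thesis
    using s by (simp add: mult.assoc[symmetric] ennreal_mult[symmetric] mult.commute[of "Gamma s"] less_imp_le[OF Gamma_real_pos])
qed

lemma powr_exp_integral:
  fixes s b :: real
  assumes s: "s > 0" and b: "b > 0"
  shows "integrable lborel (\<lambda>v. indicator {0<..} v * (v powr (s - 1) * exp (- b * v)))"
    and "(LINT v|lborel. indicator {0<..} v * (v powr (s - 1) * exp (- b * v))) = Gamma s * b powr (- s)"
proof -
  have 0: "0 \<le> Gamma s * b powr (- s)" using s by (simp add: less_imp_le[OF Gamma_real_pos])
  have "has_bochner_integral lborel (\<lambda>v. indicator {0<..} v * (v powr (s - 1) * exp (- b * v))) (Gamma s * b powr (- s))"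
    using nn_integral_powr_exp[OF s b] by (intro has_bochner_integral_nn_integral 0) auto
  then show "integrable lborel (\<lambda>v. indicator {0<..} v * (v powr (s - 1) * exp (- b * v)))"
    and "(LINT v|lborel. indicator {0<..} v * (v powr (s - 1) * exp (- b * v))) = Gamma s * b powr (- s)"
    by (auto simp: has_bochner_integral_iff)
qed

text \<open>Split at \<open>v = \<rho>\<close>. Below, the shifted factor is at most \<rho> powr (-
  1/2) and s > 0 gives integrability at 0; above, it is at most v powr (- 1/2) and s < 1/2 gives
  integrability at infinity. Both parts scale like \<rho> powr (s - 1/2).\<close>

lemma nn_integral_powr_shift_le:
  fixes s \<rho> :: real
  assumes s: "0 < s" "s < 1/2" and r: "\<rho> > 0"
  shows "(\<integral>\<^sup>+v. ennreal (indicator {0<..} v * (v powr (s - 1) * (v + \<rho>) powr (- 1/2))) \<partial>lborel)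
     \<le> ennreal ((1 / s + 1 / (1/2 - s)) * \<rho> powr (s - 1/2))"
proof -
  have "(\<integral>\<^sup>+v. ennreal (indicator {0<..} v * (v powr (s - 1) * (v + \<rho>) powr (- 1/2))) \<partial>lborel)
    \<le> (\<integral>\<^sup>+v. ennreal (\<rho> powr (- 1/2)) * ennreal (indicator {0..\<rho>} v * v powr (s - 1)) + ennreal (indicator {\<rho>..} v * v powr (s - 3/2)) \<partial>lborel)"
  proof (intro nn_integral_mono)
    fix v :: real
    consider "v \<le> 0" | "0 < v" "v \<le> \<rho>" | "\<rho> < v" by linarith
    then show "ennreal (indicator {0<..} v * (v powr (s - 1) * (v + \<rho>) powr (- 1/2))) \<le>
      ennreal (\<rho> powr (- 1/2)) * ennreal (indicator {0..\<rho>} v * v powr (s - 1)) + ennreal (indicator {\<rho>..} v * v powr (s - 3/2))"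
    proof cases
      case 2
      have "(v + \<rho>) powr (- 1/2) \<le> \<rho> powr (- 1/2)"
        using 2 r by (intro powr_mono2') auto
      then have "v powr (s - 1) * (v + \<rho>) powr (- 1/2) \<le> \<rho> powr (- 1/2) * v powr (s - 1)"
        by (simp add: mult.commute mult_left_mono)
      then have "ennreal (indicator {0<..} v * (v powr (s - 1) * (v + \<rho>) powr (- 1/2))) \<le>
        ennreal (\<rho> powr (- 1/2)) * ennreal (indicator {0..\<rho>} v * v powr (s - 1))"
        using 2 by (simp add: ennreal_mult[symmetric] ennreal_leI)
      then show ?thesis by (rule order_trans) simp
    next
      case 3
      have "(v + \<rho>) powr (- 1/2) \<le> v powr (- 1/2)"
        using 3 r by (intro powr_mono2') auto
      then have "v powr (s - 1) * (v + \<rho>) powr (- 1/2) \<le> v powr (s - 1) * v powr (- 1/2)"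
        by (simp add: mult_left_mono)
      also have "\<dots> = v powr (s - 3/2)" by (simp add: powr_add[symmetric])
      finally show ?thesis using 3 r by (simp add: ennreal_leI)
    qed simp
  qed
  also have "\<dots> = ennreal (\<rho> powr (- 1/2)) * (\<integral>\<^sup>+v. ennreal (indicator {0..\<rho>} v * v powr (s - 1)) \<partial>lborel) + (\<integral>\<^sup>+v. ennreal (indicator {\<rho>..} v * v powr (s - 3/2)) \<partial>lborel)"
    by (subst nn_integral_add) (auto simp: nn_integral_cmult)
  also have "(\<integral>\<^sup>+v. ennreal (indicator {0..\<rho>} v * v powr (s - 1)) \<partial>lborel) = ennreal (\<rho> powr s / s)"
    using has_integral_powr_from_0[of "s - 1" \<rho>] s r by (intro nn_integral_has_integral_lebesgue) auto
  also have "(\<integral>\<^sup>+v. ennreal (indicator {\<rho>..} v * v powr (s - 3/2)) \<partial>lborel) = ennreal (\<rho> powr (s - 1/2) / (1/2 - s))"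
  proof (intro nn_integral_has_integral_lebesgue)
    have "- (\<rho> powr (s - 3/2 + 1)) / (s - 3/2 + 1) = \<rho> powr (s - 1/2) / (1/2 - s)"
      using s by (simp add: field_simps)
    then show "((\<lambda>v. v powr (s - 3/2)) has_integral \<rho> powr (s - 1/2) / (1/2 - s)) {\<rho>..}"
      using has_integral_powr_to_inf[of "s - 3/2" \<rho>] s r by simp
  qed auto
  also have "ennreal (\<rho> powr (- 1/2)) * ennreal (\<rho> powr s / s) + ennreal (\<rho> powr (s - 1/2) / (1/2 - s))
      = ennreal (\<rho> powr (- 1/2) * (\<rho> powr s / s) + \<rho> powr (s - 1/2) / (1/2 - s))"
    using s by (simp add: ennreal_mult[symmetric] ennreal_plus)
  also have "\<rho> powr (- 1/2) * (\<rho> powr s / s) + \<rho> powr (s - 1/2) / (1/2 - s) = (1 / s + 1 / (1/2 - s)) * \<rho> powr (s - 1/2)"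
  proof -
    have "\<rho> powr (- 1/2) * \<rho> powr s = \<rho> powr (s - 1/2)" by (simp add: powr_add[symmetric])
    then show ?thesis by (simp add: distrib_right)
  qed
  finally show ?thesis .
qed

text \<open>The kernel of \<open>T T\<^sup>*\<close> for the weight
  \<open>(1 + x\<^sup>2) powr (- s)\<close>: \<open>A\<close> stands for the difference of the two
  positions, \<open>B\<close> for the difference of the two times, and \<tau> for the sum of the two
  dampings.\<close>

definition dispersive_kernel :: "real \<Rightarrow> real \<Rightarrow> real \<Rightarrow> real \<Rightarrow> complex" where
  "dispersive_kernel s A B \<tau> = (LINT x|lborel. cis (A * x + B * x\<^sup>2) *
     complex_of_real (exp (- \<tau> * x\<^sup>2) * (1 + x\<^sup>2) powr (- s)))"

text \<open>Writing the weight as a superposition of Gaussians turns the oscillatory kernel into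
  an average of explicit complex Gaussians, so that no stationary phase estimate is needed.\<close>

lemma dispersive_kernel_le:
  fixes s A B \<tau> :: real
  assumes s: "s > 0" and \<tau>: "\<tau> > 0"
  shows "ennreal (Gamma s * norm (dispersive_kernel s A B \<tau>)) \<le>
    (\<integral>\<^sup>+v. ennreal (indicator {0<..} v * (v powr (s - 1) * (sqrt pi * ((v + \<tau>)\<^sup>2 + B\<^sup>2) powr (- 1 / 4) *
        exp (- (A\<^sup>2 * (v + \<tau>)) / (4 * ((v + \<tau>)\<^sup>2 + B\<^sup>2)))))) \<partial>lborel)"
proof -
  \<comment> \<open>The factor \<open>exp (- 1 * v)\<close> supplies the 1 in
    \<open>1 + x\<^sup>2\<close>: multiplied by \<open>exp (- v * x\<^sup>2)\<close> it integrates
    to \<open>Gamma s * (1 + x\<^sup>2) powr (- s)\<close>.\<close>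
  define w where "w = (\<lambda>v. indicator {0<..} v * (v powr (s - 1) * exp (- 1 * v)) :: real)"
  define E where "E = (\<lambda>x. cis (A * x + B * x\<^sup>2) * complex_of_real (exp (- \<tau> * x\<^sup>2)))"
  define f where "f = (\<lambda>x v. complex_of_real (w v * exp (- v * x\<^sup>2)) * E x)"
  have w: "integrable lborel w" unfolding w_def by (rule powr_exp_integral(1)) (use s in auto)
  have [measurable]: "w \<in> borel_measurable borel" unfolding w_def by measurable
  have [measurable]: "E \<in> borel_measurable borel"
    unfolding E_def by (intro borel_measurable_continuous_onI continuous_intros)
  have w0: "w v \<ge> 0" for v by (simp add: w_def)
  have wn: "w v * exp (- v * x\<^sup>2) \<le> w v" for v x
    by (cases "v > 0") (auto simp: w_def)
  have fi: "integrable (lborel \<Otimes>\<^sub>M lborel) (case_prod f)"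
  proof (rule Bochner_Integration.integrable_bound)
    \<comment> \<open>Positive damping makes the double integral absolutely convergent, with a
      product as majorant.\<close>
    show "integrable (lborel \<Otimes>\<^sub>M lborel) (\<lambda>(x, v). exp (- \<tau> * x\<^sup>2) * w v)"
      by (rule integrable_pair_mult[OF gaussian_integrable[OF \<tau>] w])
    show "case_prod f \<in> borel_measurable (lborel \<Otimes>\<^sub>M lborel)" unfolding f_def by measurable
    show "AE p in lborel \<Otimes>\<^sub>M lborel. norm (case_prod f p) \<le> norm (case p of (x, v) \<Rightarrow> exp (- \<tau> * x\<^sup>2) * w v)"
    proof (rule AE_I2)
      fix p :: "real \<times> real"
      obtain x v where p: "p = (x, v)" by (cases p)
      have "w v * exp (- v * x\<^sup>2) * exp (- \<tau> * x\<^sup>2) \<le> w v * exp (- \<tau> * x\<^sup>2)"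
        using wn[of v x] by (intro mult_right_mono) auto
      then show "norm (case_prod f p) \<le> norm (case p of (x, v) \<Rightarrow> exp (- \<tau> * x\<^sup>2) * w v)"
        using w0[of v] by (simp add: p f_def E_def norm_mult abs_mult mult_ac)
    qed
  qed
  have "complex_of_real (Gamma s) * dispersive_kernel s A B \<tau> = (LINT x|lborel. (LINT v|lborel. f x v))"
  proof -
    have "(LINT v|lborel. f x v) = complex_of_real (Gamma s) * (cis (A * x + B * x\<^sup>2) * complex_of_real (exp (- \<tau> * x\<^sup>2) * (1 + x\<^sup>2) powr (- s)))" for x
    proof -
      have "(LINT v|lborel. f x v) = complex_of_real (LINT v|lborel. w v * exp (- v * x\<^sup>2)) * E x"
        unfolding f_def by (simp only: integral_mult_left_zero integral_complex_of_real)
      also have "(LINT v|lborel. w v * exp (- v * x\<^sup>2)) = (LINT v|lborel. indicator {0<..} v * (v powr (s - 1) * exp (- (1 + x\<^sup>2) * v)))"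
        by (intro Bochner_Integration.integral_cong) (auto simp: w_def mult.assoc mult_exp_exp algebra_simps)
      also have "\<dots> = Gamma s * (1 + x\<^sup>2) powr (- s)"
        using s by (intro powr_exp_integral) (auto simp: add_pos_nonneg)
      finally show ?thesis by (simp add: E_def)
    qed
    then show ?thesis by (simp add: dispersive_kernel_def)
  qed
  also have "\<dots> = (LINT v|lborel. (LINT x|lborel. f x v))"
    by (rule lborel_pair.Fubini_integral[OF fi, symmetric])
  finally have eq: "complex_of_real (Gamma s) * dispersive_kernel s A B \<tau> = (LINT v|lborel. (LINT x|lborel. f x v))" .
  have "ennreal (Gamma s * norm (dispersive_kernel s A B \<tau>)) = ennreal (norm (LINT v|lborel. (LINT x|lborel. f x v)))"
    using s by (simp add: eq[symmetric] norm_mult abs_of_pos[OF Gamma_real_pos])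
  also have "\<dots> \<le> (\<integral>\<^sup>+v. ennreal (norm (LINT x|lborel. f x v)) \<partial>lborel)"
    by (intro integral_norm_bound_ennreal lborel_pair.integrable_snd[OF fi])
  also have "\<dots> \<le> (\<integral>\<^sup>+v. ennreal (indicator {0<..} v * (v powr (s - 1) * (sqrt pi * ((v + \<tau>)\<^sup>2 + B\<^sup>2) powr (- 1 / 4) *
        exp (- (A\<^sup>2 * (v + \<tau>)) / (4 * ((v + \<tau>)\<^sup>2 + B\<^sup>2)))))) \<partial>lborel)"
  proof (intro nn_integral_mono ennreal_leI)
    fix v :: real
    show "norm (LINT x|lborel. f x v) \<le> indicator {0<..} v * (v powr (s - 1) * (sqrt pi * ((v + \<tau>)\<^sup>2 + B\<^sup>2) powr (- 1 / 4) *
        exp (- (A\<^sup>2 * (v + \<tau>)) / (4 * ((v + \<tau>)\<^sup>2 + B\<^sup>2)))))"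
    proof (cases "v > 0")
      case True
      have "f x v = complex_of_real (w v) * (cis (A * x + B * x\<^sup>2) * complex_of_real (exp (- (v + \<tau>) * x\<^sup>2)))" for x
        by (simp add: f_def E_def ring_distribs exp_diff exp_minus exp_add field_simps)
      then have "norm (LINT x|lborel. f x v) = w v * (sqrt pi * ((v + \<tau>)\<^sup>2 + B\<^sup>2) powr (- 1 / 4) *
        exp (- (A\<^sup>2 * (v + \<tau>)) / (4 * ((v + \<tau>)\<^sup>2 + B\<^sup>2))))"
        using True \<tau> w0[of v] by (simp only: integral_mult_right_zero norm_mult) (subst gaussian_fourier_norm, auto)
      \<comment> \<open>With Fubini done, dropping \<open>exp (- v)\<close> leaves pure powers of
        \<open>v\<close>, whose integrals scale.\<close>
      moreover have "w v \<le> v powr (s - 1)" using True by (simp add: w_def mult_left_le)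
      ultimately show ?thesis using True by (simp add: mult_right_mono)
    qed (simp add: f_def w_def)
  qed
  finally show ?thesis .
qed

text \<open>The two summands belong to the ranges \<open>v \<le> \<rho>\<close> and
  \<open>v > \<rho>\<close> of \<open>nn_integral_powr_shift_le\<close>.\<close>

definition kernel_const :: "real \<Rightarrow> real" where
  "kernel_const s = 1 / s + 1 / (1/2 - s)"

text \<open>The estimate for times that are far apart: the exponential in \<open>A\<close> is
  bounded by 1, and either the damping or the dispersion makes the modulus
  \<open>((v + \<tau>)\<^sup>2 + B\<^sup>2) powr (- 1/4)\<close> at most a constant times (v +
  \<rho>) powr (- 1/2).\<close>

lemma dispersive_kernel_le_damped:
  fixes s A B \<tau> \<rho> :: real
  assumes s: "0 < s" "s < 1/2" and \<tau>: "\<tau> > 0" and \<rho>: "\<rho> > 0" "\<rho> \<le> \<tau> \<or> \<rho> \<le> \<bar>B\<bar>"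
  shows "Gamma s * norm (dispersive_kernel s A B \<tau>) \<le> sqrt (2 * pi) * kernel_const s * \<rho> powr (s - 1/2)"
proof -
  have "ennreal (Gamma s * norm (dispersive_kernel s A B \<tau>)) \<le>
    (\<integral>\<^sup>+v. ennreal (sqrt (2 * pi)) * ennreal (indicator {0<..} v * (v powr (s - 1) * (v + \<rho>) powr (- 1/2))) \<partial>lborel)"
  proof (rule order_trans[OF dispersive_kernel_le[OF s(1) \<tau>]], intro nn_integral_mono)
    fix v :: real
    show "ennreal (indicator {0<..} v * (v powr (s - 1) * (sqrt pi * ((v + \<tau>)\<^sup>2 + B\<^sup>2) powr (- 1 / 4) *
        exp (- (A\<^sup>2 * (v + \<tau>)) / (4 * ((v + \<tau>)\<^sup>2 + B\<^sup>2)))))) \<le>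
       ennreal (sqrt (2 * pi)) * ennreal (indicator {0<..} v * (v powr (s - 1) * (v + \<rho>) powr (- 1/2)))"
    proof (cases "v > 0")
      case True
      \<comment> \<open>The factor 1/2 serves both alternatives: it is slack if \<rho> \<le> \<tau>,
        and it absorbs the cross term of \<open>(v + \<rho>)\<^sup>2\<close> if \<rho> comes from
        \<open>B\<close>.\<close>
      have "((v + \<rho>) / 2)\<^sup>2 \<le> (v + \<tau>)\<^sup>2 + B\<^sup>2"
      proof (cases "\<rho> \<le> \<tau>")
        case True
        have "((v + \<rho>) / 2)\<^sup>2 \<le> (v + \<tau>)\<^sup>2"
          using \<open>v > 0\<close> True \<rho> by (intro power_mono) auto
        then show ?thesis by (simp add: add_increasing2)
      next
        case False
        then have "\<rho> \<le> \<bar>B\<bar>" using \<rho> by simp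
        then have "\<rho>\<^sup>2 \<le> B\<^sup>2" using \<rho> by (metis abs_le_square_iff abs_of_pos)
        moreover have "v\<^sup>2 \<le> (v + \<tau>)\<^sup>2" using \<open>v > 0\<close> \<tau> by (intro power_mono) auto
        moreover have "((v + \<rho>) / 2)\<^sup>2 \<le> v\<^sup>2 + \<rho>\<^sup>2"
        proof -
          have "0 \<le> (v - \<rho>)\<^sup>2 + 2 * v\<^sup>2 + 2 * \<rho>\<^sup>2" by simp
          then show ?thesis by (simp add: power2_eq_square algebra_simps)
        qed
        ultimately show ?thesis by linarith
      qed
      then have "((v + \<tau>)\<^sup>2 + B\<^sup>2) powr (- 1 / 4) \<le> (((v + \<rho>) / 2)\<^sup>2) powr (- 1 / 4)"
        using True \<rho> by (intro powr_mono2') auto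
      also have "\<dots> = ((v + \<rho>) / 2) powr (- 1/2)"
        using True \<rho> powr_powr[of "(v + \<rho>) / 2" 2 "- 1 / 4"] by simp
      also have "\<dots> = sqrt 2 * (v + \<rho>) powr (- 1/2)"
      proof -
        have "(2::real) powr (- 1/2) = 1 / sqrt 2" using powr_minus_divide[of 2 "1/2::real"] by (simp add: powr_half_sqrt)
        then show ?thesis using True \<rho> by (simp add: powr_divide)
      qed
      finally have 1: "((v + \<tau>)\<^sup>2 + B\<^sup>2) powr (- 1 / 4) \<le> sqrt 2 * (v + \<rho>) powr (- 1/2)" .
      have "(sqrt pi * ((v + \<tau>)\<^sup>2 + B\<^sup>2) powr (- 1 / 4)) * exp (- (A\<^sup>2 * (v + \<tau>)) / (4 * ((v + \<tau>)\<^sup>2 + B\<^sup>2)))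
          \<le> (sqrt pi * (sqrt 2 * (v + \<rho>) powr (- 1/2))) * 1"
        using 1 True \<tau> by (intro mult_mono mult_nonneg_nonneg) (auto simp: divide_nonpos_nonneg)
      then have "v powr (s - 1) * (sqrt pi * ((v + \<tau>)\<^sup>2 + B\<^sup>2) powr (- 1 / 4) * exp (- (A\<^sup>2 * (v + \<tau>)) / (4 * ((v + \<tau>)\<^sup>2 + B\<^sup>2))))
          \<le> v powr (s - 1) * ((sqrt pi * (sqrt 2 * (v + \<rho>) powr (- 1/2))) * 1)"
        by (rule mult_left_mono) simp
      then show ?thesis using True
        by (simp add: ennreal_mult[symmetric] ennreal_leI real_sqrt_mult mult_ac)
    qed simp
  qed
  also have "\<dots> \<le> ennreal (sqrt (2 * pi)) * ennreal (kernel_const s * \<rho> powr (s - 1/2))"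
    unfolding kernel_const_def using nn_integral_powr_shift_le[OF s \<rho>(1)]
    by (subst nn_integral_cmult) (auto intro: mult_left_mono)
  also have "\<dots> = ennreal (sqrt (2 * pi) * kernel_const s * \<rho> powr (s - 1/2))"
    using s by (simp add: ennreal_mult[symmetric] kernel_const_def mult.assoc)
  finally show ?thesis
    by (rule ennreal_le_iff[THEN iffD1, rotated]) (use s in \<open>auto simp: kernel_const_def\<close>)
qed

text \<open>By \<open>exp y \<ge> 1 + y \<ge> (1 + y) powr (1/2)\<close> with
  \<open>y = b / w\<close>. Exponential decay is traded for a shift of \<open>w\<close> by
  \<open>b\<close>, the form that \<open>nn_integral_powr_shift_le\<close> integrates.\<close>

lemma gaussian_decay_bound:
  fixes w b :: real
  assumes "w > 0" "b \<ge> 0"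
  shows "w powr (- 1/2) * exp (- (b / w)) \<le> (w + b) powr (- 1/2)"
proof -
  have 1: "1 + b / w \<le> exp (b / w)" by (rule exp_ge_add_one_self)
  have p: "1 + b / w \<ge> 1" using assms by simp
  have "exp (- (b / w)) \<le> (1 + b / w) powr (- 1)"
    using 1 p by (simp add: exp_minus powr_minus le_imp_inverse_le)
  also have "\<dots> \<le> (1 + b / w) powr (- 1/2)" using p by (intro powr_mono) auto
  finally have "w powr (- 1/2) * exp (- (b / w)) \<le> w powr (- 1/2) * (1 + b / w) powr (- 1/2)"
    by (intro mult_left_mono) auto
  also have "\<dots> = (w * (1 + b / w)) powr (- 1/2)" using assms p by (subst powr_mult) auto
  also have "w * (1 + b / w) = w + b" using assms by (simp add: field_simps)
  finally show ?thesis .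
qed

text \<open>If \<open>\<bar>B\<bar> \<le> w\<close>, then
  \<open>w\<^sup>2 + B\<^sup>2 \<le> 2 * w\<^sup>2\<close>, so the exponent is at least
  \<open>A\<^sup>2 / (8 * w)\<close> in size and the Gaussian behaves as if \<open>B\<close> were
  0.\<close>

lemma dispersive_kernel_le_nonstationary_pointwise:
  fixes A B w :: real
  assumes w: "w > 0" "\<bar>B\<bar> \<le> w"
  shows "(w\<^sup>2 + B\<^sup>2) powr (- 1 / 4) * exp (- (A\<^sup>2 * w) / (4 * (w\<^sup>2 + B\<^sup>2))) \<le> (w + A\<^sup>2 / 8) powr (- 1/2)"
proof -
  have B2: "B\<^sup>2 \<le> w\<^sup>2" using w by (metis abs_le_square_iff abs_of_pos)
  have "(w\<^sup>2 + B\<^sup>2) powr (- 1 / 4) \<le> (w\<^sup>2) powr (- 1 / 4)"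
    using w by (intro powr_mono2') auto
  also have "\<dots> = w powr (- 1/2)" using w powr_powr[of w 2 "- 1 / 4"] by simp
  finally have 1: "(w\<^sup>2 + B\<^sup>2) powr (- 1 / 4) \<le> w powr (- 1/2)" .
  have "A\<^sup>2 * w / (8 * w\<^sup>2) \<le> A\<^sup>2 * w / (4 * (w\<^sup>2 + B\<^sup>2))"
    using w B2 by (intro divide_left_mono) (auto simp: add_pos_nonneg)
  also have "A\<^sup>2 * w / (8 * w\<^sup>2) = A\<^sup>2 / 8 / w" using w by (simp add: power2_eq_square)
  finally have "exp (- (A\<^sup>2 * w) / (4 * (w\<^sup>2 + B\<^sup>2))) \<le> exp (- (A\<^sup>2 / 8 / w))" by simp
  then have "(w\<^sup>2 + B\<^sup>2) powr (- 1 / 4) * exp (- (A\<^sup>2 * w) / (4 * (w\<^sup>2 + B\<^sup>2))) \<le> w powr (- 1/2) * exp (- (A\<^sup>2 / 8 / w))"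
    using 1 by (intro mult_mono) auto
  also have "\<dots> \<le> (w + A\<^sup>2 / 8) powr (- 1/2)" using w by (intro gaussian_decay_bound) auto
  finally show ?thesis .
qed

text \<open>The superposition is cut at \<open>w = \<bar>B\<bar>\<close>, where
  \<open>w = v + \<tau>\<close>. For larger \<open>w\<close> the bound is that of a heat kernel and
  yields the power \<open>2 * s - 1\<close> of \<open>\<bar>A\<bar>\<close>. For smaller
  \<open>w\<close> the modulus is at most \<open>\<bar>B\<bar> powr (- 1/2)\<close> and the
  exponential at most \<open>exp (- b * v)\<close>; the Gamma integral gives
  \<open>\<bar>A\<bar> powr (- 2 * s)\<close> times \<open>\<bar>B\<bar> powr (2 * s - 1/2)\<close>,
  and \<open>s \<ge> 1/4\<close> with \<open>\<bar>B\<bar> \<le> 1\<close> removes the last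
  factor.\<close>

lemma dispersive_kernel_le_nonstationary:
  fixes s A B \<tau> :: real
  assumes s: "0 < s" "s < 1/2" and \<tau>: "\<tau> > 0" and A: "A \<noteq> 0" and B: "\<bar>B\<bar> \<le> 1"
    and sB: "1/4 \<le> s \<or> \<bar>B\<bar> \<le> \<tau>"
  shows "Gamma s * norm (dispersive_kernel s A B \<tau>) \<le>
    sqrt pi * (kernel_const s * (A\<^sup>2 / 8) powr (s - 1/2) + Gamma s * 8 powr s * \<bar>A\<bar> powr (- 2 * s))"
proof -
  \<comment> \<open>If \<open>\<bar>B\<bar> \<le> \<tau>\<close>, then
    \<open>w > \<bar>B\<bar>\<close> throughout: \<open>c = 0\<close> deletes the second term and
    \<open>b = 1\<close> is merely a positive placeholder. Otherwise \<open>b\<close> comes from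
    \<open>4 * (w\<^sup>2 + B\<^sup>2) \<le> 8 * B\<^sup>2\<close>.\<close>
  define c where "c = (if \<bar>B\<bar> \<le> \<tau> then 0 else \<bar>B\<bar> powr (- 1/2))"
  define b where "b = (if \<bar>B\<bar> \<le> \<tau> then 1 else A\<^sup>2 / (8 * B\<^sup>2))"
  have A8: "A\<^sup>2 / 8 > 0" using A by simp
  have c0: "c \<ge> 0" by (simp add: c_def)
  have b0: "b > 0" using A \<tau> by (auto simp: b_def)
  have "ennreal (Gamma s * norm (dispersive_kernel s A B \<tau>)) \<le>
    (\<integral>\<^sup>+v. ennreal (sqrt pi) * (ennreal (indicator {0<..} v * (v powr (s - 1) * (v + A\<^sup>2 / 8) powr (- 1/2)))
       + ennreal c * ennreal (indicator {0<..} v * (v powr (s - 1) * exp (- b * v)))) \<partial>lborel)"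
  proof (rule order_trans[OF dispersive_kernel_le[OF s(1) \<tau>]], intro nn_integral_mono)
    fix v :: real
    show "ennreal (indicator {0<..} v * (v powr (s - 1) * (sqrt pi * ((v + \<tau>)\<^sup>2 + B\<^sup>2) powr (- 1 / 4) *
        exp (- (A\<^sup>2 * (v + \<tau>)) / (4 * ((v + \<tau>)\<^sup>2 + B\<^sup>2)))))) \<le>
       ennreal (sqrt pi) * (ennreal (indicator {0<..} v * (v powr (s - 1) * (v + A\<^sup>2 / 8) powr (- 1/2)))
       + ennreal c * ennreal (indicator {0<..} v * (v powr (s - 1) * exp (- b * v))))"
    proof (cases "v > 0")
      case True
      define w where "w = v + \<tau>"
      have w: "w > 0" using True \<tau> by (simp add: w_def)
      have "(w\<^sup>2 + B\<^sup>2) powr (- 1 / 4) * exp (- (A\<^sup>2 * w) / (4 * (w\<^sup>2 + B\<^sup>2))) \<le> (v + A\<^sup>2 / 8) powr (- 1/2) + c * exp (- b * v)"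
      proof (cases "\<bar>B\<bar> \<le> w")
        case True
        have "(w\<^sup>2 + B\<^sup>2) powr (- 1 / 4) * exp (- (A\<^sup>2 * w) / (4 * (w\<^sup>2 + B\<^sup>2))) \<le> (w + A\<^sup>2 / 8) powr (- 1/2)"
          by (rule dispersive_kernel_le_nonstationary_pointwise[OF w True])
        also have "\<dots> \<le> (v + A\<^sup>2 / 8) powr (- 1/2)"
          using \<open>v > 0\<close> \<tau> A8 by (intro powr_mono2') (auto simp: w_def intro: add_pos_pos)
        finally show ?thesis using c0 by (simp add: add_increasing2)
      next
        case False
        then have Bt: "\<not> \<bar>B\<bar> \<le> \<tau>" "B \<noteq> 0" and Bw: "w < \<bar>B\<bar>" using \<open>v > 0\<close> w by (auto simp: w_def)
        have "w\<^sup>2 \<le> \<bar>B\<bar>\<^sup>2" using w Bw by (intro power_mono) auto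
        then have w2: "w\<^sup>2 \<le> B\<^sup>2" by simp
        have "(w\<^sup>2 + B\<^sup>2) powr (- 1 / 4) \<le> (\<bar>B\<bar>\<^sup>2) powr (- 1 / 4)"
          using Bt by (intro powr_mono2') auto
        also have "\<dots> = \<bar>B\<bar> powr (- 1/2)"
          using Bt powr_powr[of "\<bar>B\<bar>" 2 "- 1 / 4"] by (simp del: power2_abs)
        finally have 1: "(w\<^sup>2 + B\<^sup>2) powr (- 1 / 4) \<le> c" using Bt by (simp add: c_def)
        have "b * v = A\<^sup>2 * v / (8 * B\<^sup>2)" using Bt by (simp add: b_def)
        also have "\<dots> \<le> A\<^sup>2 * w / (4 * (w\<^sup>2 + B\<^sup>2))"
          using w w2 \<open>v > 0\<close> \<tau> by (intro frac_le mult_left_mono) (auto simp: w_def add_pos_nonneg)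
        finally have "exp (- (A\<^sup>2 * w) / (4 * (w\<^sup>2 + B\<^sup>2))) \<le> exp (- b * v)" by simp
        then have "(w\<^sup>2 + B\<^sup>2) powr (- 1 / 4) * exp (- (A\<^sup>2 * w) / (4 * (w\<^sup>2 + B\<^sup>2))) \<le> c * exp (- b * v)"
          using 1 c0 by (intro mult_mono) auto
        then show ?thesis by (simp add: add_increasing)
      qed
      then have "(v powr (s - 1) * sqrt pi) * ((w\<^sup>2 + B\<^sup>2) powr (- 1 / 4) * exp (- (A\<^sup>2 * w) / (4 * (w\<^sup>2 + B\<^sup>2)))) \<le>
         (v powr (s - 1) * sqrt pi) * ((v + A\<^sup>2 / 8) powr (- 1/2) + c * exp (- b * v))"
        by (intro mult_left_mono) auto
      then have "ennreal (v powr (s - 1) * (sqrt pi * (w\<^sup>2 + B\<^sup>2) powr (- 1 / 4) * exp (- (A\<^sup>2 * w) / (4 * (w\<^sup>2 + B\<^sup>2))))) \<le>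
         ennreal (sqrt pi * (v powr (s - 1) * (v + A\<^sup>2 / 8) powr (- 1/2) + c * (v powr (s - 1) * exp (- b * v))))"
        by (intro ennreal_leI) (simp add: algebra_simps)
      then show ?thesis using True c0
        by (simp add: w_def ennreal_mult ennreal_plus)
    qed simp
  qed
  also have "\<dots> = ennreal (sqrt pi) * ((\<integral>\<^sup>+v. ennreal (indicator {0<..} v * (v powr (s - 1) * (v + A\<^sup>2 / 8) powr (- 1/2))) \<partial>lborel)
       + ennreal c * (\<integral>\<^sup>+v. ennreal (indicator {0<..} v * (v powr (s - 1) * exp (- b * v))) \<partial>lborel))"
    by (subst nn_integral_cmult, measurable, subst nn_integral_add, measurable, subst nn_integral_cmult, measurable)
  also have "\<dots> \<le> ennreal (sqrt pi) * (ennreal (kernel_const s * (A\<^sup>2 / 8) powr (s - 1/2)) + ennreal c * ennreal (Gamma s * b powr (- s)))"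
    unfolding kernel_const_def using nn_integral_powr_shift_le[OF s A8] nn_integral_powr_exp[OF s(1) b0]
    by (intro mult_left_mono add_mono) auto
  also have "\<dots> = ennreal (sqrt pi * (kernel_const s * (A\<^sup>2 / 8) powr (s - 1/2) + c * (Gamma s * b powr (- s))))"
    using s c0 Gamma_real_pos[OF s(1)] by (simp add: ennreal_mult ennreal_plus kernel_const_def)
  finally have "Gamma s * norm (dispersive_kernel s A B \<tau>) \<le> sqrt pi * (kernel_const s * (A\<^sup>2 / 8) powr (s - 1/2) + c * (Gamma s * b powr (- s)))"
    by (rule ennreal_le_iff[THEN iffD1, rotated]) (use s c0 Gamma_real_pos[OF s(1)] in \<open>auto simp: kernel_const_def\<close>)
  also have "c * (Gamma s * b powr (- s)) \<le> Gamma s * 8 powr s * \<bar>A\<bar> powr (- 2 * s)"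
  proof (cases "\<bar>B\<bar> \<le> \<tau>")
    case True
    then show ?thesis using Gamma_real_pos[OF s(1)] by (simp add: c_def)
  next
    case False
    then have B0: "\<bar>B\<bar> > 0" and s4: "1/4 \<le> s" using \<tau> sB by auto
    have "b powr (- s) = (\<bar>A\<bar> powr 2 / (8 * \<bar>B\<bar> powr 2)) powr (- s)" using False B0 by (simp add: b_def powr_numeral)
    also have "\<dots> = \<bar>A\<bar> powr (- 2 * s) * 8 powr s * \<bar>B\<bar> powr (2 * s)"
      using A B0 by (simp add: powr_divide powr_mult powr_powr powr_minus field_simps del: powr_numeral)
    finally have "c * (Gamma s * b powr (- s)) = Gamma s * 8 powr s * \<bar>A\<bar> powr (- 2 * s) * (\<bar>B\<bar> powr (- 1/2) * \<bar>B\<bar> powr (2 * s))"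
      using False by (simp add: c_def)
    moreover have "\<bar>B\<bar> powr (- 1/2) * \<bar>B\<bar> powr (2 * s) \<le> 1"
      unfolding powr_add[symmetric] using B s4 by (intro powr_le1) auto
    ultimately show ?thesis
      using Gamma_real_pos[OF s(1)] by (auto simp only: intro!: mult_left_le mult_nonneg_nonneg) auto
  qed
  finally show ?thesis by (simp add: mult_left_mono)
qed

section \<open>The critical exponent and kernel bounds along curves\<close>

lemma s_crit_nonneg:
  assumes "\<alpha> \<le> 1/2"
  shows "0 \<le> s_crit \<gamma> \<alpha>"
  using assms by (simp add: s_crit_def)

text \<open>The two forms in which \<open>s > s_crit\<close> is used: the first makes the power of
  \<open>\<bar>x - x'\<bar>\<close> from distant times locally integrable, the second gives
  \<open>s \<ge> 1/4\<close> once \<alpha> \<le> 1/4 is added.\<close>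

lemma s_crit_exponent:
  assumes "\<gamma> > 0" "\<alpha> > 0" "s_crit \<gamma> \<alpha> < s"
  shows "min 1 \<gamma> * (1/2 - s) < \<alpha>" and "\<gamma> > 1 \<Longrightarrow> 1/2 - \<alpha> < s"
proof -
  show 1: "1/2 - \<alpha> < s" if "\<gamma> > 1"
  proof -
    have "\<alpha> / \<gamma> \<le> \<alpha> / 1" using that assms by (intro divide_left_mono) auto
    then have "1/2 - \<alpha> \<le> s_crit \<gamma> \<alpha>"
      unfolding s_crit_def by (intro min.boundedI max.coboundedI1) linarith+
    then show ?thesis using assms(3) by linarith
  qed
  show "min 1 \<gamma> * (1/2 - s) < \<alpha>"
  proof (cases "\<gamma> > 1")
    case True
    then show ?thesis using 1 by simp
  next
    case False
    have "\<alpha> / 1 \<le> \<alpha> / \<gamma>" using False assms by (intro divide_left_mono) auto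
    then have "1/2 - \<alpha> / \<gamma> \<le> s_crit \<gamma> \<alpha>"
      unfolding s_crit_def by (intro min.boundedI max.coboundedI1) linarith+
    then have "1/2 - \<alpha> / \<gamma> < s" using assms(3) by linarith
    then show ?thesis using False assms by (simp add: min_def field_simps)
  qed
qed

text \<open>The dichotomy compares \<open>C1 * \<bar>x - x'\<bar>\<close> with twice the possible
  displacement in time. If the displacement may be large, the damped bound yields the power
  -\<theta>; if not, the bilipschitz bound forces
  \<open>\<bar>A\<bar> \<ge> C1 / 2 * \<bar>x - x'\<bar>\<close> and the nonstationary bound yields
  the other two powers. All three exponents exceed -1.\<close>

lemma curve_kernel_bound:
  assumes \<gamma>: "\<gamma> > 0" and \<alpha>: "\<alpha> > 0" "\<alpha> \<le> 1/4"
    and s: "s_crit \<gamma> \<alpha> < s" "s < 1/2" and adm: "admissible_curve \<alpha> \<Gamma>"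
  obtains C \<theta> where "C > 0" "0 < \<theta>" "\<theta> < 1"
    "\<And>x x' t t'. x \<noteq> x' \<Longrightarrow> t \<in> {0<..1} \<Longrightarrow> t' \<in> {0<..1} \<Longrightarrow>
       norm (dispersive_kernel s (\<Gamma> x t - \<Gamma> x' t') (t - t') (t powr \<gamma> + t' powr \<gamma>)) \<le>
       C * (\<bar>x - x'\<bar> powr (2 * s - 1) + \<bar>x - x'\<bar> powr (- 2 * s) + \<bar>x - x'\<bar> powr (- \<theta>))"
proof -
  obtain C1 C2 C3 where C: "C1 > 0" "C2 > 0" "C3 > 0"
    and lip': "\<forall>t\<in>{-1..1}. \<forall>x x'. C1 * \<bar>x - x'\<bar> \<le> \<bar>\<Gamma> x t - \<Gamma> x' t\<bar> \<and> \<bar>\<Gamma> x t - \<Gamma> x' t\<bar> \<le> C2 * \<bar>x - x'\<bar>"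
    and hol': "\<forall>x. \<forall>t\<in>{-1..1}. \<forall>t'\<in>{-1..1}. \<bar>\<Gamma> x t - \<Gamma> x t'\<bar> \<le> C3 * \<bar>t - t'\<bar> powr \<alpha>"
    using adm unfolding admissible_curve_def by (elim conjE exE) (rule that)
  have lip: "C1 * \<bar>x - x'\<bar> \<le> \<bar>\<Gamma> x t - \<Gamma> x' t\<bar>" if "t \<in> {-1..1}" for t x x'
    using lip' that by blast
  have hol: "\<bar>\<Gamma> x t - \<Gamma> x t'\<bar> \<le> C3 * \<bar>t - t'\<bar> powr \<alpha>" if "t \<in> {-1..1}" "t' \<in> {-1..1}" for t t' x
    using hol' that by blast
  have s0: "0 < s" using s_crit_nonneg[of \<alpha> \<gamma>] \<alpha> s by linarith
  note G = Gamma_real_pos[OF s0]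
  have kc: "kernel_const s > 0" using s0 s by (simp add: kernel_const_def add_pos_pos)
  define \<sigma> where "\<sigma> = min 1 \<gamma>"
  \<comment> \<open>From \<rho> powr (s - 1/2) with \<rho> =
    \<open>\<bar>B\<bar> powr \<sigma>\<close>, rewritten as a power of
    \<open>\<bar>B\<bar> powr \<alpha>\<close>, the quantity that is comparable to
    \<open>\<bar>x - x'\<bar>\<close>.\<close>
  define \<theta> where "\<theta> = \<sigma> * (1/2 - s) / \<alpha>"
  have \<sigma>: "\<sigma> > 0" using \<gamma> by (simp add: \<sigma>_def)
  have th: "0 < \<theta>" "\<theta> < 1"
    using s_crit_exponent(1)[OF \<gamma> \<alpha>(1) s(1)] \<sigma> s \<alpha> by (auto simp: \<theta>_def \<sigma>_def[symmetric])
  define D1 where "D1 = sqrt (2 * pi) * kernel_const s * (C1 / (2 * C3)) powr (- \<theta>)"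
  define D2 where "D2 = sqrt pi * kernel_const s * (C1\<^sup>2 / 32) powr (s - 1/2)"
  define D3 where "D3 = sqrt pi * Gamma s * 8 powr s * (C1 / 2) powr (- 2 * s)"
  have D: "D1 > 0" "D2 > 0" "D3 > 0" using C kc G by (auto simp: D1_def D2_def D3_def)
  have main: "Gamma s * norm (dispersive_kernel s (\<Gamma> x t - \<Gamma> x' t') (t - t') (t powr \<gamma> + t' powr \<gamma>)) \<le>
       D1 * \<bar>x - x'\<bar> powr (- \<theta>) + (D2 * \<bar>x - x'\<bar> powr (2 * s - 1) + D3 * \<bar>x - x'\<bar> powr (- 2 * s))"
    (is "_ \<le> ?R1 + (?R2 + ?R3)")
    if x: "x \<noteq> x'" and t: "t \<in> {0<..1}" "t' \<in> {0<..1}" for x x' t t'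
  proof -
    define r where "r = \<bar>x - x'\<bar>"
    define B where "B = t - t'"
    define A where "A = \<Gamma> x t - \<Gamma> x' t'"
    define \<tau> where "\<tau> = t powr \<gamma> + t' powr \<gamma>"
    have r: "r > 0" using x by (simp add: r_def)
    have B1: "\<bar>B\<bar> \<le> 1" using t by (auto simp: B_def)
    have \<tau>: "\<tau> > 0" using t by (simp add: \<tau>_def add_pos_pos)
    have B\<tau>: "\<bar>B\<bar> powr \<gamma> \<le> \<tau>"
    proof (cases "t \<ge> t'")
      case True
      then have "\<bar>B\<bar> powr \<gamma> \<le> t powr \<gamma>" using t \<gamma> by (intro powr_mono2) (auto simp: B_def)
      then show ?thesis by (simp add: \<tau>_def add_increasing2)
    next
      case False
      then have "\<bar>B\<bar> powr \<gamma> \<le> t' powr \<gamma>" using t \<gamma> by (intro powr_mono2) (auto simp: B_def)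
      then show ?thesis by (simp add: \<tau>_def add_increasing)
    qed
    have R: "?R1 \<ge> 0" "?R2 \<ge> 0" "?R3 \<ge> 0" using D by auto
    show ?thesis
    proof (cases "C1 * r < 2 * C3 * \<bar>B\<bar> powr \<alpha>")
      case True
      then have B0: "\<bar>B\<bar> > 0" using mult_pos_pos[OF C(1) r] by (cases "B = 0") auto
      \<comment> \<open>For \<gamma> \<ge> 1 this is \<open>\<bar>B\<bar>\<close> and dispersion is
        used; for \<gamma> < 1 it is \<open>\<bar>B\<bar> powr \<gamma>\<close>, which the damping
        dominates.\<close>
      define \<rho> where "\<rho> = \<bar>B\<bar> powr \<sigma>"
      have \<rho>: "\<rho> > 0" "\<rho> \<le> \<tau> \<or> \<rho> \<le> \<bar>B\<bar>" using B0 B\<tau> by (auto simp: \<rho>_def \<sigma>_def min_def)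
      have "Gamma s * norm (dispersive_kernel s A B \<tau>) \<le> sqrt (2 * pi) * kernel_const s * \<rho> powr (s - 1/2)"
        by (rule dispersive_kernel_le_damped[OF s0 s(2) \<tau> \<rho>])
      also have "\<rho> powr (s - 1/2) = (\<bar>B\<bar> powr \<alpha>) powr (- \<theta>)"
      proof -
        have "\<sigma> * (s - 1/2) = \<alpha> * - \<theta>" using \<alpha> by (simp add: \<theta>_def field_simps)
        then show ?thesis by (simp only: \<rho>_def powr_powr)
      qed
      also have "(\<bar>B\<bar> powr \<alpha>) powr (- \<theta>) \<le> (C1 / (2 * C3) * r) powr (- \<theta>)"
        using True C r th by (intro powr_mono2') (auto simp: field_simps)
      also have "(C1 / (2 * C3) * r) powr (- \<theta>) = (C1 / (2 * C3)) powr (- \<theta>) * r powr (- \<theta>)"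
        using C r by (intro powr_mult)
      finally have "Gamma s * norm (dispersive_kernel s A B \<tau>) \<le> ?R1"
        using kc by (simp add: D1_def r_def mult_ac mult_left_mono)
      then show ?thesis using R unfolding A_def B_def \<tau>_def by linarith
    next
      case False
      have "C1 * r \<le> \<bar>\<Gamma> x t - \<Gamma> x' t\<bar>" using lip[of t x x'] t by (simp add: r_def)
      moreover have "\<bar>\<Gamma> x' t - \<Gamma> x' t'\<bar> \<le> C3 * \<bar>B\<bar> powr \<alpha>" using hol[of t t' x'] t by (simp add: B_def)
      moreover have "C3 * \<bar>B\<bar> powr \<alpha> \<le> C1 * r / 2" using False by simp
      moreover have "\<bar>\<Gamma> x t - \<Gamma> x' t\<bar> \<le> \<bar>A\<bar> + \<bar>\<Gamma> x' t - \<Gamma> x' t'\<bar>" unfolding A_def by linarith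
      ultimately have A: "C1 / 2 * r \<le> \<bar>A\<bar>" by linarith
      then have A0: "A \<noteq> 0" "\<bar>A\<bar> > 0" using mult_pos_pos[OF C(1) r] by auto
      \<comment> \<open>For \<gamma> > 1 the first alternative follows from s > 1/2 - \<alpha> and
        \<alpha> \<le> 1/4; for \<gamma> \<le> 1 the second from
        \<open>\<bar>B\<bar> \<le> \<bar>B\<bar> powr \<gamma> \<le> \<tau>\<close>.\<close>
      have sB: "1/4 \<le> s \<or> \<bar>B\<bar> \<le> \<tau>"
      proof (cases "\<gamma> > 1")
        case True
        then show ?thesis using s_crit_exponent(2)[OF \<gamma> \<alpha>(1) s(1)] \<alpha> by simp
      next
        case False
        have "\<bar>B\<bar> powr 1 \<le> \<bar>B\<bar> powr \<gamma>"
        proof (cases "B = 0")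
          case False
          then show ?thesis using \<open>\<not> \<gamma> > 1\<close> B1 by (intro powr_mono') auto
        qed simp
        then show ?thesis using B\<tau> by (simp add: powr_one_gt_zero_iff split: if_splits)
      qed
      have "Gamma s * norm (dispersive_kernel s A B \<tau>) \<le> sqrt pi * (kernel_const s * (A\<^sup>2 / 8) powr (s - 1/2) + Gamma s * 8 powr s * \<bar>A\<bar> powr (- 2 * s))"
        by (rule dispersive_kernel_le_nonstationary[OF s0 s(2) \<tau> A0(1) B1 sB])
      also have "\<dots> \<le> sqrt pi * (kernel_const s * ((C1\<^sup>2 / 32) powr (s - 1/2) * r powr (2 * s - 1)) + Gamma s * 8 powr s * ((C1 / 2) powr (- 2 * s) * r powr (- 2 * s)))"
      proof (intro mult_left_mono add_mono)
        have "(C1 / 2 * r)\<^sup>2 \<le> \<bar>A\<bar>\<^sup>2" using A C r by (intro power_mono) auto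
        then have "C1\<^sup>2 / 32 * r\<^sup>2 \<le> A\<^sup>2 / 8" by (simp add: power_mult_distrib power_divide)
        then have "(A\<^sup>2 / 8) powr (s - 1/2) \<le> (C1\<^sup>2 / 32 * r\<^sup>2) powr (s - 1/2)"
          using C r s by (intro powr_mono2') auto
        also have "\<dots> = (C1\<^sup>2 / 32) powr (s - 1/2) * (r\<^sup>2) powr (s - 1/2)" by (rule powr_mult)
        also have "(r\<^sup>2) powr (s - 1/2) = r powr (2 * s - 1)"
          using r powr_powr[of r 2 "s - 1/2"] by (simp add: algebra_simps)
        finally show "(A\<^sup>2 / 8) powr (s - 1/2) \<le> (C1\<^sup>2 / 32) powr (s - 1/2) * r powr (2 * s - 1)" .
        have "\<bar>A\<bar> powr (- 2 * s) \<le> (C1 / 2 * r) powr (- 2 * s)"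
          using A C r s0 by (intro powr_mono2') auto
        also have "\<dots> = (C1 / 2) powr (- 2 * s) * r powr (- 2 * s)" using C r by (intro powr_mult)
        finally show "\<bar>A\<bar> powr (- 2 * s) \<le> (C1 / 2) powr (- 2 * s) * r powr (- 2 * s)" .
      qed (use kc G in auto)
      also have "\<dots> = ?R2 + ?R3" by (simp add: D2_def D3_def r_def algebra_simps)
      finally show ?thesis using R unfolding A_def B_def \<tau>_def by linarith
    qed
  qed
  define C where "C = (D1 + D2 + D3) / Gamma s"
  have C0: "C > 0" using D G by (simp add: C_def)
  show ?thesis
  proof (rule that[OF C0 th])
    fix x x' t t' :: real
    assume x: "x \<noteq> x'" and t: "t \<in> {0<..1}" "t' \<in> {0<..1}"
    let ?p = "\<bar>x - x'\<bar> powr (2 * s - 1)" and ?q = "\<bar>x - x'\<bar> powr (- 2 * s)" and ?o = "\<bar>x - x'\<bar> powr (- \<theta>)"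
    have "D1 * ?o + (D2 * ?p + D3 * ?q) \<le> (D1 + D2 + D3) * ?o + ((D1 + D2 + D3) * ?p + (D1 + D2 + D3) * ?q)"
      using D by (intro add_mono mult_right_mono) auto
    also have "\<dots> = (D1 + D2 + D3) * (?p + ?q + ?o)" by (simp add: algebra_simps)
    finally have "Gamma s * norm (dispersive_kernel s (\<Gamma> x t - \<Gamma> x' t') (t - t') (t powr \<gamma> + t' powr \<gamma>)) \<le> (D1 + D2 + D3) * (?p + ?q + ?o)"
      using main[OF x t] by linarith
    then show "norm (dispersive_kernel s (\<Gamma> x t - \<Gamma> x' t') (t - t') (t powr \<gamma> + t' powr \<gamma>)) \<le> C * (?p + ?q + ?o)"
      using G by (simp add: C_def field_simps)
  qed
qed

text \<open>The nonstationary bound at \<open>B = 0\<close>, where its side condition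
  \<open>\<bar>B\<bar> \<le> \<tau>\<close> is automatic.\<close>

lemma heat_kernel_bound:
  assumes s: "0 < s" "s < 1/2"
  obtains C where "C > 0"
    "\<And>x x' \<tau>. x \<noteq> x' \<Longrightarrow> \<tau> > 0 \<Longrightarrow>
       norm (dispersive_kernel s (x - x') 0 \<tau>) \<le> C * (\<bar>x - x'\<bar> powr (2 * s - 1) + \<bar>x - x'\<bar> powr (- 2 * s))"
proof -
  note G = Gamma_real_pos[OF s(1)]
  have kc: "kernel_const s > 0" using s by (simp add: kernel_const_def add_pos_pos)
  define D1 where "D1 = sqrt pi * kernel_const s * (1 / 8) powr (s - 1/2)"
  define D2 where "D2 = sqrt pi * Gamma s * 8 powr s"
  have D: "D1 > 0" "D2 > 0" using kc G by (auto simp: D1_def D2_def)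
  have "norm (dispersive_kernel s (x - x') 0 \<tau>) \<le> (D1 + D2) / Gamma s * (\<bar>x - x'\<bar> powr (2 * s - 1) + \<bar>x - x'\<bar> powr (- 2 * s))"
    if x: "x \<noteq> x'" and \<tau>: "\<tau> > 0" for x x' \<tau>
  proof -
    let ?r = "\<bar>x - x'\<bar>"
    have r: "?r > 0" using x by simp
    have "Gamma s * norm (dispersive_kernel s (x - x') 0 \<tau>) \<le>
       sqrt pi * (kernel_const s * ((x - x')\<^sup>2 / 8) powr (s - 1/2) + Gamma s * 8 powr s * ?r powr (- 2 * s))"
      using x \<tau> by (intro dispersive_kernel_le_nonstationary[OF s \<tau>]) auto
    also have "((x - x')\<^sup>2 / 8) powr (s - 1/2) = (1 / 8) powr (s - 1/2) * (?r\<^sup>2) powr (s - 1/2)"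
      using powr_mult[of "1/8" "?r\<^sup>2" "s - 1/2"] by simp
    also have "(?r\<^sup>2) powr (s - 1/2) = ?r powr (2 * s - 1)"
      using r powr_powr[of ?r 2 "s - 1/2"] by (simp add: algebra_simps del: power2_abs)
    also have "sqrt pi * (kernel_const s * ((1 / 8) powr (s - 1/2) * ?r powr (2 * s - 1)) + Gamma s * 8 powr s * ?r powr (- 2 * s)) =
       D1 * ?r powr (2 * s - 1) + D2 * ?r powr (- 2 * s)"
      by (simp add: D1_def D2_def algebra_simps)
    also have "\<dots> \<le> (D1 + D2) * ?r powr (2 * s - 1) + (D1 + D2) * ?r powr (- 2 * s)"
      using D by (intro add_mono mult_right_mono) auto
    finally show ?thesis using G by (simp add: field_simps)
  qed
  moreover have "(D1 + D2) / Gamma s > 0" using D G by simp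
  ultimately show ?thesis using that by blast
qed

lemma nn_integral_shifted_powr_le:
  fixes a L :: real
  assumes a: "-1 < a" and x: "x \<in> {-L..L}"
  shows "(\<integral>\<^sup>+x'. ennreal (indicator {-L..L} x' * \<bar>x - x'\<bar> powr a) \<partial>lborel) \<le> ennreal (2 * ((2 * L) powr (a + 1) / (a + 1)))"
proof -
  have L: "L \<ge> 0" using x by auto
  have *: "(\<integral>\<^sup>+u. ennreal (indicator {0..2 * L} u * u powr a) \<partial>lborel) = ennreal ((2 * L) powr (a + 1) / (a + 1))"
    using has_integral_powr_from_0[OF a, of "2 * L"] L by (intro nn_integral_has_integral_lebesgue) auto
  have "(\<integral>\<^sup>+x'. ennreal (indicator {-L..L} x' * \<bar>x - x'\<bar> powr a) \<partial>lborel) =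
     (\<integral>\<^sup>+u. ennreal (indicator {-L..L} (x + 1 * u) * \<bar>x - (x + 1 * u)\<bar> powr a) \<partial>lborel)"
    by (subst nn_integral_real_affine[where c=1 and t=x]) auto
  also have "\<dots> \<le> (\<integral>\<^sup>+u. ennreal (indicator {0..2 * L} u * u powr a) + ennreal (indicator {0..2 * L} (0 + (- 1) * u) * (0 + (- 1) * u) powr a) \<partial>lborel)"
    using x by (intro nn_integral_mono) (auto simp: indicator_def abs_if ennreal_plus[symmetric] simp del: ennreal_plus)
  also have "\<dots> = (\<integral>\<^sup>+u. ennreal (indicator {0..2 * L} u * u powr a) \<partial>lborel) + (\<integral>\<^sup>+u. ennreal (indicator {0..2 * L} (0 + (- 1) * u) * (0 + (- 1) * u) powr a) \<partial>lborel)"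
    by (intro nn_integral_add) auto
  also have "(\<integral>\<^sup>+u. ennreal (indicator {0..2 * L} (0 + (- 1) * u) * (0 + (- 1) * u) powr a) \<partial>lborel) = (\<integral>\<^sup>+u. ennreal (indicator {0..2 * L} u * u powr a) \<partial>lborel)"
    by (subst (2) nn_integral_real_affine[where c="-1" and t=0]) auto
  finally show ?thesis using a L by (simp add: * ennreal_plus[symmetric] del: ennreal_plus)
qed

section \<open>The maximal estimate\<close>

text \<open>No integrability is required, because the Bochner integral of a function that is not
  integrable is 0 by convention.\<close>

lemma norm_integral_le_nn_integral:
  fixes f :: "'a \<Rightarrow> complex"
  shows "ennreal (norm (integral\<^sup>L M f)) \<le> (\<integral>\<^sup>+x. ennreal (norm (f x)) \<partial>M)"
  by (cases "integrable M f") (auto simp: integral_norm_bound_ennreal not_integrable_integral_eq)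

text \<open>Time and damping are independent parameters, so that the flow along the curve
  (\<open>b = t\<close>, \<open>\<tau> = t powr \<gamma>\<close>) and the heat flow
  (\<open>b = 0\<close>) are instances of one operator.\<close>

definition disp :: "real \<Rightarrow> real \<Rightarrow> real \<Rightarrow> real \<Rightarrow> complex" where
  "disp y b \<tau> \<xi> = cis (y * \<xi> + b * \<xi>\<^sup>2) * complex_of_real (exp (- \<tau> * \<xi>\<^sup>2))"

definition disp_int :: "(real \<Rightarrow> complex) \<Rightarrow> real \<Rightarrow> real \<Rightarrow> real \<Rightarrow> complex" where
  "disp_int g y b \<tau> = (LINT \<xi>|lborel. disp y b \<tau> \<xi> * g \<xi>)"

lemma Pgamma_eq_disp_int:
  "Pgamma \<gamma> g y t = complex_of_real (1 / (2 * pi)) * disp_int g y t (t powr \<gamma>)"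
  by (simp add: Pgamma_def disp_int_def disp_def)

lemma norm_disp: "norm (disp y b \<tau> \<xi>) = exp (- \<tau> * \<xi>\<^sup>2)"
  by (simp add: disp_def norm_mult)

lemma borel_measurable_cis [measurable]:
  assumes [measurable]: "f \<in> borel_measurable M"
  shows "(\<lambda>x. cis (f x)) \<in> borel_measurable M"
proof -
  have "cis \<in> borel_measurable borel" by (intro borel_measurable_continuous_onI continuous_intros)
  from measurable_compose[OF assms this] show ?thesis .
qed

lemma borel_measurable_cnj [measurable]:
  assumes [measurable]: "f \<in> borel_measurable M"
  shows "(\<lambda>x. cnj (f x)) \<in> borel_measurable M"
proof -
  have "cnj \<in> borel_measurable borel" by (intro borel_measurable_continuous_onI continuous_intros)
  from measurable_compose[OF assms this] show ?thesis .
qed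

lemma borel_measurable_disp [measurable]:
  assumes [measurable]: "y \<in> borel_measurable M" "b \<in> borel_measurable M" "\<tau> \<in> borel_measurable M" "\<xi> \<in> borel_measurable M"
  shows "(\<lambda>x. disp (y x) (b x) (\<tau> x) (\<xi> x)) \<in> borel_measurable M"
  unfolding disp_def by measurable

text \<open>In \<open>T T\<^sup>*\<close> positions and times subtract, but dampings add, so the
  damping persists between equal times.\<close>

lemma disp_mult_cnj:
  "disp y b \<tau> \<xi> * cnj (disp y' b' \<tau>' \<xi>) = disp (y - y') (b - b') (\<tau> + \<tau>') \<xi>"
proof -
  have "cis (y * \<xi> + b * \<xi>\<^sup>2) * cnj (cis (y' * \<xi> + b' * \<xi>\<^sup>2)) = cis ((y - y') * \<xi> + (b - b') * \<xi>\<^sup>2)"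
    by (simp add: cis_cnj cis_mult algebra_simps)
  moreover have "exp (- \<tau> * \<xi>\<^sup>2) * exp (- \<tau>' * \<xi>\<^sup>2) = exp (- (\<tau> + \<tau>') * \<xi>\<^sup>2)"
    by (simp add: mult_exp_exp algebra_simps)
  ultimately show ?thesis by (simp add: disp_def mult_ac flip: of_real_mult)
qed

lemma weighted_imp_square_integrable:
  fixes g :: "real \<Rightarrow> complex"
  assumes [measurable]: "g \<in> borel_measurable borel" and s: "0 \<le> s"
    and N: "integrable lborel (\<lambda>\<xi>. (1 + \<xi>\<^sup>2) powr s * (cmod (g \<xi>))\<^sup>2)"
  shows "integrable lborel (\<lambda>\<xi>. (cmod (g \<xi>))\<^sup>2)"
proof (rule Bochner_Integration.integrable_bound[OF N])
  show "AE \<xi> in lborel. norm ((cmod (g \<xi>))\<^sup>2) \<le> norm ((1 + \<xi>\<^sup>2) powr s * (cmod (g \<xi>))\<^sup>2)"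
  proof (rule AE_I2)
    fix \<xi> :: real
    have "1 * (cmod (g \<xi>))\<^sup>2 \<le> (1 + \<xi>\<^sup>2) powr s * (cmod (g \<xi>))\<^sup>2"
      using s by (intro mult_right_mono ge_one_powr_ge_zero) auto
    then show "norm ((cmod (g \<xi>))\<^sup>2) \<le> norm ((1 + \<xi>\<^sup>2) powr s * (cmod (g \<xi>))\<^sup>2)" by simp
  qed
qed simp

lemma integrable_gaussian_mult:
  fixes g :: "real \<Rightarrow> complex"
  assumes [measurable]: "g \<in> borel_measurable borel"
    and g2: "integrable lborel (\<lambda>\<xi>. (cmod (g \<xi>))\<^sup>2)" and c: "c > 0"
  shows "integrable lborel (\<lambda>\<xi>. exp (- c * \<xi>\<^sup>2) * cmod (g \<xi>))"
proof (rule Bochner_Integration.integrable_bound)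
  show "integrable lborel (\<lambda>\<xi>. exp (- (2 * c) * \<xi>\<^sup>2) + (cmod (g \<xi>))\<^sup>2)"
    using c by (intro Bochner_Integration.integrable_add gaussian_integrable g2) auto
  show "AE \<xi> in lborel. norm (exp (- c * \<xi>\<^sup>2) * cmod (g \<xi>)) \<le> norm (exp (- (2 * c) * \<xi>\<^sup>2) + (cmod (g \<xi>))\<^sup>2)"
  proof (rule AE_I2)
    fix \<xi> :: real
    define a where "a = exp (- c * \<xi>\<^sup>2)"
    have a2: "exp (- (2 * c) * \<xi>\<^sup>2) = a\<^sup>2" by (simp add: a_def power2_eq_square mult_exp_exp algebra_simps)
    have "0 \<le> (a - cmod (g \<xi>))\<^sup>2 + a\<^sup>2 + (cmod (g \<xi>))\<^sup>2" by simp
    then have "a * cmod (g \<xi>) \<le> a\<^sup>2 + (cmod (g \<xi>))\<^sup>2" by (simp add: power2_eq_square algebra_simps)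
    moreover have "a \<ge> 0" by (simp add: a_def)
    ultimately show "norm (exp (- c * \<xi>\<^sup>2) * cmod (g \<xi>)) \<le> norm (exp (- (2 * c) * \<xi>\<^sup>2) + (cmod (g \<xi>))\<^sup>2)"
      unfolding a2 unfolding a_def[symmetric] by (simp add: abs_mult)
  qed
qed simp

lemma integrable_disp_mult:
  fixes g :: "real \<Rightarrow> complex"
  assumes [measurable]: "g \<in> borel_measurable borel"
    and g2: "integrable lborel (\<lambda>\<xi>. (cmod (g \<xi>))\<^sup>2)" and \<tau>: "\<tau> > 0"
  shows "integrable lborel (\<lambda>\<xi>. disp y b \<tau> \<xi> * g \<xi>)"
proof (rule Bochner_Integration.integrable_bound[OF integrable_gaussian_mult[OF assms]])
  show "(\<lambda>\<xi>. disp y b \<tau> \<xi> * g \<xi>) \<in> borel_measurable lborel" by measurable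
qed (auto simp: norm_mult norm_disp)

text \<open>Expanding the square of \<open>m\<close> and integrating \<xi> out first leaves a
  quadratic form in \<open>w\<close> whose kernel is dominated by \<open>k\<close> off the diagonal,
  a null set; Schur's test bounds it. The majorant \<open>E\<close> licenses both applications of
  Fubini. The abstract form serves the maximal estimate as well as the Plancherel
  inequality.\<close>

lemma schur_quadratic_bound:
  fixes w :: "real \<Rightarrow> complex" and e :: "real \<Rightarrow> real \<Rightarrow> complex" and W E :: "real \<Rightarrow> real" and k :: "real \<Rightarrow> real \<Rightarrow> real"
  assumes w1: "integrable lborel w" and w2: "integrable lborel (\<lambda>x. (cmod (w x))\<^sup>2)"
    and em: "(\<lambda>p. e (fst p) (snd p)) \<in> borel_measurable (borel \<Otimes>\<^sub>M borel)"
    and eE: "\<And>x \<xi>. norm (e x \<xi>) \<le> E \<xi>"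
    and [measurable]: "W \<in> borel_measurable borel" and W0: "\<And>\<xi>. 0 \<le> W \<xi>"
    and WE: "integrable lborel (\<lambda>\<xi>. W \<xi> * (E \<xi>)\<^sup>2)"
    and km: "(\<lambda>p. k (fst p) (snd p)) \<in> borel_measurable (borel \<Otimes>\<^sub>M borel)"
    and k0: "\<And>x y. 0 \<le> k x y" and sym: "\<And>x y. k x y = k y x" and \<kappa>: "0 \<le> \<kappa>"
    and k: "\<And>x. (\<integral>\<^sup>+y. ennreal (k x y) \<partial>lborel) \<le> ennreal \<kappa>"
    and K: "\<And>x y. x \<noteq> y \<Longrightarrow> w x \<noteq> 0 \<Longrightarrow> w y \<noteq> 0 \<Longrightarrow>
        norm (LINT \<xi>|lborel. complex_of_real (W \<xi>) * (e x \<xi> * cnj (e y \<xi>))) \<le> k x y"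
  defines "m \<equiv> \<lambda>\<xi>. LINT x|lborel. w x * e x \<xi>"
  shows "integrable lborel (\<lambda>\<xi>. W \<xi> * (cmod (m \<xi>))\<^sup>2)"
    and "(LINT \<xi>|lborel. W \<xi> * (cmod (m \<xi>))\<^sup>2) \<le> \<kappa> * (LINT x|lborel. (cmod (w x))\<^sup>2)"
proof -
  have [measurable]: "w \<in> borel_measurable borel" using borel_measurable_integrable[OF w1] by simp
  have em'[measurable]: "(\<lambda>z. e (f z) (g z)) \<in> borel_measurable M"
    if [measurable]: "f \<in> borel_measurable M" "g \<in> borel_measurable M" for f g M
    using measurable_compose[OF measurable_Pair[OF that] em] by simp
  have km'[measurable]: "(\<lambda>z. k (f z) (g z)) \<in> borel_measurable M"
    if [measurable]: "f \<in> borel_measurable M" "g \<in> borel_measurable M" for f g M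
    using measurable_compose[OF measurable_Pair[OF that] km] by simp
  have [measurable]: "m \<in> borel_measurable borel" unfolding m_def by measurable
  define S where "S = (LINT x|lborel. (cmod (w x))\<^sup>2)"
  define V where "V = (LINT x|lborel. cmod (w x))"
  have S0: "S \<ge> 0" and V0: "V \<ge> 0" unfolding S_def V_def by (auto intro: Bochner_Integration.integral_nonneg)
  have E0: "E \<xi> \<ge> 0" for \<xi> using order_trans[OF norm_ge_zero eE] .
  have SN: "(\<integral>\<^sup>+x. ennreal ((cmod (w x))\<^sup>2) \<partial>lborel) = ennreal S"
    unfolding S_def by (rule nn_integral_eq_integral[OF w2]) simp
  have mV: "norm (m \<xi>) \<le> V * E \<xi>" for \<xi>
  proof -
    have "norm (m \<xi>) \<le> (LINT x|lborel. norm (w x * e x \<xi>))" unfolding m_def by (rule integral_norm_bound)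
    also have "\<dots> \<le> (LINT x|lborel. cmod (w x) * E \<xi>)"
      using w1 E0 by (intro integral_mono') (auto simp: norm_mult eE mult_left_mono)
    finally show ?thesis by (simp add: V_def)
  qed
  have wE: "integrable lborel (\<lambda>x. cmod (w x))" using w1 by simp
  define Q where "Q = (LINT \<xi>|lborel. W \<xi> * (cmod (m \<xi>))\<^sup>2)"
  show "integrable lborel (\<lambda>\<xi>. W \<xi> * (cmod (m \<xi>))\<^sup>2)"
  proof (rule Bochner_Integration.integrable_bound)
    show "integrable lborel (\<lambda>\<xi>. V\<^sup>2 * (W \<xi> * (E \<xi>)\<^sup>2))" using WE by simp
    have "W \<xi> * (cmod (m \<xi>))\<^sup>2 \<le> V\<^sup>2 * (W \<xi> * (E \<xi>)\<^sup>2)" for \<xi>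
      using mult_left_mono[OF power_mono[OF mV norm_ge_zero, of \<xi> 2] W0[of \<xi>]] by (simp add: power_mult_distrib mult_ac)
    then show "AE \<xi> in lborel. norm (W \<xi> * (cmod (m \<xi>))\<^sup>2) \<le> norm (V\<^sup>2 * (W \<xi> * (E \<xi>)\<^sup>2))"
      using W0 by (intro AE_I2) (simp add: abs_mult)
  qed measurable
  define F where "F = (\<lambda>x \<xi>. w x * (complex_of_real (W \<xi>) * e x \<xi> * cnj (m \<xi>)))"
  have Fi: "integrable (lborel \<Otimes>\<^sub>M lborel) (\<lambda>(x, \<xi>). F x \<xi>)"
  proof (rule Bochner_Integration.integrable_bound)
    show "integrable (lborel \<Otimes>\<^sub>M lborel) (\<lambda>(x, \<xi>). cmod (w x) * (V * (W \<xi> * (E \<xi>)\<^sup>2)))"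
      using WE by (intro integrable_pair_mult wE) auto
    show "(\<lambda>(x, \<xi>). F x \<xi>) \<in> borel_measurable (lborel \<Otimes>\<^sub>M lborel)" unfolding F_def by measurable
    have "norm (F x \<xi>) \<le> norm (cmod (w x) * (V * (W \<xi> * (E \<xi>)\<^sup>2)))" for x \<xi>
    proof -
      have "norm (F x \<xi>) = norm (w x) * (W \<xi> * (norm (e x \<xi>) * norm (m \<xi>)))"
        using W0[of \<xi>] by (simp add: F_def norm_mult)
      also have "\<dots> \<le> norm (w x) * (W \<xi> * (E \<xi> * (V * E \<xi>)))"
        using W0[of \<xi>] E0[of \<xi>] by (intro mult_left_mono mult_mono eE mV) auto
      also have "\<dots> = cmod (w x) * (V * (W \<xi> * (E \<xi>)\<^sup>2))" by (simp add: power2_eq_square)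
      finally show ?thesis by (rule order_trans) simp
    qed
    then show "AE p in lborel \<Otimes>\<^sub>M lborel. norm (case p of (x, \<xi>) \<Rightarrow> F x \<xi>) \<le> norm (case p of (x, \<xi>) \<Rightarrow> cmod (w x) * (V * (W \<xi> * (E \<xi>)\<^sup>2)))"
      by (intro AE_I2) (simp only: split_beta)
  qed
  define Kk where "Kk = (\<lambda>x y. LINT \<xi>|lborel. complex_of_real (W \<xi>) * (e x \<xi> * cnj (e y \<xi>)))"
  \<comment> \<open>Here \<open>cnj (m \<xi>)\<close> is expanded as an integral over
    \<open>y\<close>; exchanging the order again produces the kernel \<open>Kk x y\<close>.\<close>
  have inner: "(LINT \<xi>|lborel. F x \<xi>) = w x * (LINT y|lborel. cnj (w y) * Kk x y)" for x
  proof -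
    define H where "H = (\<lambda>y \<xi>. complex_of_real (W \<xi>) * e x \<xi> * (cnj (w y) * cnj (e y \<xi>)))"
    have Hi: "integrable (lborel \<Otimes>\<^sub>M lborel) (\<lambda>(y, \<xi>). H y \<xi>)"
    proof (rule Bochner_Integration.integrable_bound)
      show "integrable (lborel \<Otimes>\<^sub>M lborel) (\<lambda>(y, \<xi>). cmod (w y) * (W \<xi> * (E \<xi>)\<^sup>2))"
        by (intro integrable_pair_mult wE WE)
      show "(\<lambda>(y, \<xi>). H y \<xi>) \<in> borel_measurable (lborel \<Otimes>\<^sub>M lborel)" unfolding H_def by measurable
      have "norm (H y \<xi>) \<le> norm (cmod (w y) * (W \<xi> * (E \<xi>)\<^sup>2))" for y \<xi>
      proof -
        have "norm (H y \<xi>) = norm (w y) * (W \<xi> * (norm (e x \<xi>) * norm (e y \<xi>)))"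
          using W0[of \<xi>] by (simp add: H_def norm_mult)
        also have "\<dots> \<le> norm (w y) * (W \<xi> * (E \<xi> * E \<xi>))"
          using W0[of \<xi>] E0[of \<xi>] by (intro mult_left_mono mult_mono eE) auto
        finally show ?thesis unfolding power2_eq_square by (rule order_trans) simp
      qed
      then show "AE p in lborel \<Otimes>\<^sub>M lborel. norm (case p of (y, \<xi>) \<Rightarrow> H y \<xi>) \<le> norm (case p of (y, \<xi>) \<Rightarrow> cmod (w y) * (W \<xi> * (E \<xi>)\<^sup>2))"
        by (intro AE_I2) (simp only: split_beta)
    qed
    have "(LINT \<xi>|lborel. F x \<xi>) = w x * (LINT \<xi>|lborel. complex_of_real (W \<xi>) * e x \<xi> * cnj (m \<xi>))"
      unfolding F_def by (rule integral_mult_right_zero)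
    also have "(LINT \<xi>|lborel. complex_of_real (W \<xi>) * e x \<xi> * cnj (m \<xi>)) = (LINT \<xi>|lborel. (LINT y|lborel. H y \<xi>))"
      unfolding H_def m_def by (simp only: integral_mult_right_zero complex_cnj_mult[symmetric] Bochner_Integration.integral_cnj)
    also have "\<dots> = (LINT y|lborel. (LINT \<xi>|lborel. H y \<xi>))" by (rule lborel_pair.Fubini_integral[OF Hi])
    also have "\<dots> = (LINT y|lborel. cnj (w y) * Kk x y)"
    proof (rule Bochner_Integration.integral_cong[OF refl])
      fix y
      have "H y \<xi> = cnj (w y) * (complex_of_real (W \<xi>) * (e x \<xi> * cnj (e y \<xi>)))" for \<xi>
        unfolding H_def by (simp only: mult_ac)
      then show "(LINT \<xi>|lborel. H y \<xi>) = cnj (w y) * Kk x y" by (simp only: Kk_def integral_mult_right_zero)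
    qed
    finally show ?thesis .
  qed
  have "complex_of_real Q = (LINT \<xi>|lborel. complex_of_real (W \<xi> * (cmod (m \<xi>))\<^sup>2))"
    unfolding Q_def by (rule integral_complex_of_real[symmetric])
  also have "\<dots> = (LINT \<xi>|lborel. (LINT x|lborel. F x \<xi>))"
  proof (rule Bochner_Integration.integral_cong[OF refl])
    fix \<xi>
    have "(LINT x|lborel. F x \<xi>) = (LINT x|lborel. (complex_of_real (W \<xi>) * cnj (m \<xi>)) * (w x * e x \<xi>))"
      unfolding F_def by (simp only: mult_ac)
    also have "\<dots> = (complex_of_real (W \<xi>) * cnj (m \<xi>)) * m \<xi>" unfolding m_def by (rule integral_mult_right_zero)
    finally show "complex_of_real (W \<xi> * (cmod (m \<xi>))\<^sup>2) = (LINT x|lborel. F x \<xi>)"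
      by (simp only: of_real_mult complex_norm_square mult_ac)
  qed
  also have "\<dots> = (LINT x|lborel. (LINT \<xi>|lborel. F x \<xi>))" by (rule lborel_pair.Fubini_integral[OF Fi])
  finally have Qeq: "complex_of_real Q = (LINT x|lborel. w x * (LINT y|lborel. cnj (w y) * Kk x y))" by (simp only: inner)
  \<comment> \<open>Half of the inequality between the means:
    \<open>cmod (w x) * cmod (w y) * k x y \<le> B x y + B y x\<close>. By symmetry each half has
    double integral at most \<open>\<kappa> * S / 2\<close>.\<close>
  define B where "B = (\<lambda>x y. (cmod (w x))\<^sup>2 / 2 * k x y)"
  have B0: "0 \<le> B x y" for x y by (simp add: B_def k0)
  have [measurable]: "(\<lambda>z. B (f z) (g z)) \<in> borel_measurable M"
    if [measurable]: "f \<in> borel_measurable M" "g \<in> borel_measurable M" for f g M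
    unfolding B_def by measurable
  have BN: "(\<integral>\<^sup>+x. (\<integral>\<^sup>+y. ennreal (B x y) \<partial>lborel) \<partial>lborel) \<le> ennreal (\<kappa> * S / 2)"
  proof -
    have "(\<integral>\<^sup>+x. (\<integral>\<^sup>+y. ennreal (B x y) \<partial>lborel) \<partial>lborel) \<le> (\<integral>\<^sup>+x. ennreal (\<kappa> / 2) * ennreal ((cmod (w x))\<^sup>2) \<partial>lborel)"
    proof (rule nn_integral_mono)
      fix x :: real
      have a: "0 \<le> (cmod (w x))\<^sup>2 / 2" by simp
      have "(\<integral>\<^sup>+y. ennreal (B x y) \<partial>lborel) = ennreal ((cmod (w x))\<^sup>2 / 2) * (\<integral>\<^sup>+y. ennreal (k x y) \<partial>lborel)"
        unfolding B_def ennreal_mult'[OF a] by (rule nn_integral_cmult) measurable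
      also have "\<dots> \<le> ennreal ((cmod (w x))\<^sup>2 / 2) * ennreal \<kappa>" by (intro mult_left_mono k) simp
      also have "\<dots> = ennreal (\<kappa> / 2) * ennreal ((cmod (w x))\<^sup>2)" using \<kappa> by (simp add: ennreal_mult[symmetric])
      finally show "(\<integral>\<^sup>+y. ennreal (B x y) \<partial>lborel) \<le> ennreal (\<kappa> / 2) * ennreal ((cmod (w x))\<^sup>2)" .
    qed
    also have "\<dots> = ennreal (\<kappa> * S / 2)"
      using \<kappa> S0 by (subst nn_integral_cmult) (auto simp: SN ennreal_mult[symmetric])
    finally show ?thesis .
  qed
  have "ennreal Q \<le> ennreal (norm (complex_of_real Q))" by (simp add: ennreal_leI)
  also have "\<dots> \<le> (\<integral>\<^sup>+x. ennreal (norm (w x * (LINT y|lborel. cnj (w y) * Kk x y))) \<partial>lborel)"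
    unfolding Qeq by (rule norm_integral_le_nn_integral)
  also have "\<dots> \<le> (\<integral>\<^sup>+x. (\<integral>\<^sup>+y. ennreal (B x y) + ennreal (B y x) \<partial>lborel) \<partial>lborel)"
  proof (rule nn_integral_mono)
    fix x :: real
    have "ennreal (norm (w x * (LINT y|lborel. cnj (w y) * Kk x y))) = ennreal (norm (LINT y|lborel. w x * (cnj (w y) * Kk x y)))"
      by (simp only: integral_mult_right_zero)
    also have "\<dots> \<le> (\<integral>\<^sup>+y. ennreal (norm (w x * (cnj (w y) * Kk x y))) \<partial>lborel)" by (rule norm_integral_le_nn_integral)
    also have "\<dots> \<le> (\<integral>\<^sup>+y. ennreal (B x y) + ennreal (B y x) \<partial>lborel)"
    proof (rule nn_integral_mono_AE)
      show "AE y in lborel. ennreal (norm (w x * (cnj (w y) * Kk x y))) \<le> ennreal (B x y) + ennreal (B y x)"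
        using AE_lborel_singleton[of x]
      proof eventually_elim
        case (elim y)
        have "norm (w x * (cnj (w y) * Kk x y)) \<le> B x y + B y x"
        proof (cases "w x = 0 \<or> w y = 0")
          case False
          then have "norm (Kk x y) \<le> k x y" using K elim by (auto simp: Kk_def)
          then have "norm (w x * (cnj (w y) * Kk x y)) \<le> cmod (w x) * (cmod (w y) * k x y)"
            unfolding norm_mult complex_mod_cnj by (intro mult_left_mono) auto
          also have "\<dots> = (cmod (w x) * cmod (w y)) * k x y" by simp
          also have "\<dots> \<le> ((cmod (w x))\<^sup>2 / 2 + (cmod (w y))\<^sup>2 / 2) * k x y"
            using sum_squares_bound[of "cmod (w x)" "cmod (w y)"] by (intro mult_right_mono k0) auto
          also have "\<dots> = B x y + B y x" by (simp add: B_def sym[of y x] distrib_right)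
          finally show ?thesis .
        qed (use B0 in \<open>auto intro: add_nonneg_nonneg\<close>)
        then show ?case by (simp add: ennreal_plus[symmetric] B0 ennreal_leI del: ennreal_plus)
      qed
    qed
    finally show "ennreal (norm (w x * (LINT y|lborel. cnj (w y) * Kk x y))) \<le> (\<integral>\<^sup>+y. ennreal (B x y) + ennreal (B y x) \<partial>lborel)" .
  qed
  also have "\<dots> = (\<integral>\<^sup>+x. (\<integral>\<^sup>+y. ennreal (B x y) \<partial>lborel) \<partial>lborel) + (\<integral>\<^sup>+x. (\<integral>\<^sup>+y. ennreal (B y x) \<partial>lborel) \<partial>lborel)"
    by (subst nn_integral_add[symmetric]) (auto intro!: nn_integral_cong nn_integral_add)
  also have "(\<integral>\<^sup>+x. (\<integral>\<^sup>+y. ennreal (B y x) \<partial>lborel) \<partial>lborel) = (\<integral>\<^sup>+y. (\<integral>\<^sup>+x. ennreal (B y x) \<partial>lborel) \<partial>lborel)"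
    by (rule lborel_pair.Fubini') measurable
  also have "(\<integral>\<^sup>+x. (\<integral>\<^sup>+y. ennreal (B x y) \<partial>lborel) \<partial>lborel) + \<dots> \<le> ennreal (\<kappa> * S / 2) + ennreal (\<kappa> * S / 2)"
    by (rule add_mono[OF BN BN])
  also have "\<dots> = ennreal (\<kappa> * S)" using \<kappa> S0 by (simp add: ennreal_plus[symmetric] del: ennreal_plus)
  finally show "Q \<le> \<kappa> * S" using \<kappa> S0 by (simp add: ennreal_le_iff)
qed

text \<open>The \<open>TT\<^sup>*\<close> method: boundedness of a linearised maximal operator follows from an
  integrable pointwise bound on the kernel of \<open>T T\<^sup>*\<close> (Schur's test).\<close>

lemma ttstar_bound:
  fixes y b \<tau> :: "real \<Rightarrow> real" and g :: "real \<Rightarrow> complex" and k :: "real \<Rightarrow> real"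
  assumes [measurable]: "y \<in> borel_measurable borel" "b \<in> borel_measurable borel" "\<tau> \<in> borel_measurable borel"
    and \<tau>0: "\<tau>0 > 0" "\<And>x. \<tau>0 \<le> \<tau> x"
    and [measurable]: "g \<in> borel_measurable borel" and s: "0 \<le> s"
    and N: "integrable lborel (\<lambda>\<xi>. (1 + \<xi>\<^sup>2) powr s * (cmod (g \<xi>))\<^sup>2)"
    and [measurable]: "k \<in> borel_measurable borel" and k0: "\<And>r. 0 \<le> k r" and \<kappa>: "\<kappa> > 0"
    and k: "\<And>x. x \<in> {-L..L} \<Longrightarrow> (\<integral>\<^sup>+x'. ennreal (indicator {-L..L} x' * k \<bar>x - x'\<bar>) \<partial>lborel) \<le> ennreal \<kappa>"
    and K: "\<And>x x'. x \<in> {-L..L} \<Longrightarrow> x' \<in> {-L..L} \<Longrightarrow> x \<noteq> x' \<Longrightarrow>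
        norm (dispersive_kernel s (y x - y x') (b x - b x') (\<tau> x + \<tau> x')) \<le> k \<bar>x - x'\<bar>"
  shows "(\<integral>\<^sup>+x. ennreal (indicator {-L..L} x * (cmod (disp_int g (y x) (b x) (\<tau> x)))\<^sup>2) \<partial>lborel)
    \<le> ennreal (\<kappa> * (LINT \<xi>|lborel. (1 + \<xi>\<^sup>2) powr s * (cmod (g \<xi>))\<^sup>2))"
proof -
  define I where "I = {-L..L}"
  define e where "e = (\<lambda>x \<xi>. disp (y x) (b x) (\<tau> x) \<xi>)"
  \<comment> \<open>A majorant for all multipliers at once, needed for absolute convergence. The
    resulting estimate is free of \<open>\<tau>0\<close>, which may therefore shrink to 0 when the
    supremum is exhausted.\<close>
  define E where "E = (\<lambda>\<xi>. exp (- \<tau>0 * \<xi>\<^sup>2))"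
  define u where "u = (\<lambda>x. LINT \<xi>|lborel. e x \<xi> * g \<xi>)"
  \<comment> \<open>The dual function: pairing \<open>u\<close> with its own conjugate on the
    interval gives exactly \<open>S\<close>, and Fubini moves the pairing to the frequency side as
    the integral of \<open>g * m\<close>.\<close>
  define w where "w = (\<lambda>x. complex_of_real (indicator I x) * cnj (u x))"
  define W where "W = (\<lambda>\<xi>::real. (1 + \<xi>\<^sup>2) powr s)"
  define W' where "W' = (\<lambda>\<xi>::real. (1 + \<xi>\<^sup>2) powr (- s))"
  define m where "m = (\<lambda>\<xi>. LINT x|lborel. w x * e x \<xi>)"
  define D where "D = (LINT \<xi>|lborel. E \<xi> * cmod (g \<xi>))"
  have [measurable]: "I \<in> sets borel" by (simp add: I_def)
  have [measurable]: "(\<lambda>p. e (fst p) (snd p)) \<in> borel_measurable (borel \<Otimes>\<^sub>M borel)"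
    unfolding e_def by measurable
  have em[measurable]: "(\<lambda>z. e (f z) (h z)) \<in> borel_measurable M'"
    if [measurable]: "f \<in> borel_measurable M'" "h \<in> borel_measurable M'" for f h M'
    unfolding e_def by measurable
  have [measurable]: "u \<in> borel_measurable borel" unfolding u_def by measurable
  have [measurable]: "w \<in> borel_measurable borel" unfolding w_def by measurable
  have [measurable]: "W \<in> borel_measurable borel" "W' \<in> borel_measurable borel" "E \<in> borel_measurable borel"
    unfolding W_def W'_def E_def by measurable
  have [measurable]: "m \<in> borel_measurable borel" unfolding m_def by measurable
  have g2: "integrable lborel (\<lambda>\<xi>. (cmod (g \<xi>))\<^sup>2)" by (rule weighted_imp_square_integrable[OF _ s N]) measurable
  have Ei: "integrable lborel E" unfolding E_def by (rule gaussian_integrable[OF \<tau>0(1)])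
  have E0: "E \<xi> > 0" for \<xi> by (simp add: E_def)
  have Eg: "integrable lborel (\<lambda>\<xi>. E \<xi> * cmod (g \<xi>))" unfolding E_def by (rule integrable_gaussian_mult[OF _ g2 \<tau>0(1)]) measurable
  have eE: "norm (e x \<xi>) \<le> E \<xi>" for x \<xi>
    using \<tau>0(2)[of x] by (simp add: e_def norm_disp E_def mult_right_mono)
  have eg: "integrable lborel (\<lambda>\<xi>. e x \<xi> * g \<xi>)" for x
    unfolding e_def by (rule integrable_disp_mult[OF _ g2]) (use \<tau>0 less_le_trans in auto)
  have D0: "D \<ge> 0" unfolding D_def by (intro Bochner_Integration.integral_nonneg) (simp add: less_imp_le[OF E0])
  have uD: "norm (u x) \<le> D" for x
    unfolding u_def D_def
    by (rule Bochner_Integration.integral_norm_bound_integral[OF eg Eg]) (simp add: norm_mult eE mult_right_mono)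
  have wD: "norm (w x) \<le> D * indicator I x" for x using uD[of x] by (simp add: w_def norm_mult indicator_def)
  have Ii: "integrable lborel (\<lambda>x. D * indicator I x)"
    by (intro integrable_mult_right integrable_real_indicator) (auto simp: I_def emeasure_lborel_Icc_eq)
  have Wpos: "W \<xi> > 0" "W' \<xi> > 0" "W' \<xi> \<le> 1" "W \<xi> * W' \<xi> = 1" for \<xi>
  proof -
    have 1: "1 \<le> 1 + \<xi>\<^sup>2" by simp
    then have 2: "1 + \<xi>\<^sup>2 > 0" by linarith
    show "W \<xi> > 0" "W' \<xi> > 0" using 2 by (auto simp: W_def W'_def)
    show "W \<xi> * W' \<xi> = 1" using 2 by (simp add: W_def W'_def powr_minus)
    have "(1 + \<xi>\<^sup>2) powr (- s) \<le> (1 + \<xi>\<^sup>2) powr 0" using 1 s by (intro powr_mono) auto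
    then show "W' \<xi> \<le> 1" using 2 by (simp add: W'_def)
  qed
  define S where "S = (LINT x|lborel. (cmod (w x))\<^sup>2)"
  have wsq: "(cmod (w x))\<^sup>2 = indicator I x * (cmod (u x))\<^sup>2" for x
    by (simp add: w_def norm_mult power_mult_distrib indicator_def)
  have Si: "integrable lborel (\<lambda>x. (cmod (w x))\<^sup>2)"
  proof (rule Bochner_Integration.integrable_bound)
    show "integrable lborel (\<lambda>x. D * (D * indicator I x))" using Ii by simp
    show "AE x in lborel. norm ((cmod (w x))\<^sup>2) \<le> norm (D * (D * indicator I x))"
    proof (rule AE_I2)
      fix x
      have "(cmod (u x))\<^sup>2 \<le> D\<^sup>2" using uD[of x] by (intro power_mono) auto
      then show "norm ((cmod (w x))\<^sup>2) \<le> norm (D * (D * indicator I x))"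
        unfolding wsq using D0 by (cases "x \<in> I") (auto simp: power2_eq_square)
    qed
  qed simp
  have S0: "S \<ge> 0" unfolding S_def by (intro Bochner_Integration.integral_nonneg) simp
  have SN: "(\<integral>\<^sup>+x. ennreal ((cmod (w x))\<^sup>2) \<partial>lborel) = ennreal S"
    unfolding S_def by (rule nn_integral_eq_integral[OF Si]) simp
  have S_gm: "complex_of_real S = (LINT \<xi>|lborel. g \<xi> * m \<xi>)"
  proof -
    have fi: "integrable (lborel \<Otimes>\<^sub>M lborel) (\<lambda>(x, \<xi>). w x * (e x \<xi> * g \<xi>))"
    proof (rule Bochner_Integration.integrable_bound[OF integrable_pair_mult[OF Ii Eg]])
      show "(\<lambda>(x, \<xi>). w x * (e x \<xi> * g \<xi>)) \<in> borel_measurable (lborel \<Otimes>\<^sub>M lborel)" by measurable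
      have "norm (w x * (e x \<xi> * g \<xi>)) \<le> norm ((D * indicator I x) * (E \<xi> * cmod (g \<xi>)))" for x \<xi>
        using D0 E0[of \<xi>] by (simp only: norm_mult norm_of_real real_norm_def abs_mult, intro mult_mono order_trans[OF wD] order_trans[OF eE], auto)
      then show "AE p in lborel \<Otimes>\<^sub>M lborel. norm (case p of (x, \<xi>) \<Rightarrow> w x * (e x \<xi> * g \<xi>)) \<le> norm (case p of (x, \<xi>) \<Rightarrow> (D * indicator I x) * (E \<xi> * cmod (g \<xi>)))"
        by (intro AE_I2) (simp only: split_beta)
    qed
    have "complex_of_real S = (LINT x|lborel. complex_of_real ((cmod (w x))\<^sup>2))"
      unfolding S_def by (rule integral_complex_of_real[symmetric])
    also have "\<dots> = (LINT x|lborel. (LINT \<xi>|lborel. w x * (e x \<xi> * g \<xi>)))"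
    proof (rule Bochner_Integration.integral_cong[OF refl])
      fix x
      have "(LINT \<xi>|lborel. w x * (e x \<xi> * g \<xi>)) = w x * u x" unfolding u_def by (rule integral_mult_right_zero)
      also have "\<dots> = complex_of_real ((cmod (w x))\<^sup>2)"
        unfolding wsq unfolding of_real_mult complex_norm_square w_def by (simp only: mult_ac)
      finally show "complex_of_real ((cmod (w x))\<^sup>2) = (LINT \<xi>|lborel. w x * (e x \<xi> * g \<xi>))" ..
    qed
    also have "\<dots> = (LINT \<xi>|lborel. (LINT x|lborel. w x * (e x \<xi> * g \<xi>)))"
      by (rule lborel_pair.Fubini_integral[OF fi, symmetric])
    also have "\<dots> = (LINT \<xi>|lborel. g \<xi> * m \<xi>)"
      unfolding m_def
    proof (rule Bochner_Integration.integral_cong[OF refl])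
      fix \<xi>
      have "(LINT x|lborel. w x * (e x \<xi> * g \<xi>)) = (LINT x|lborel. g \<xi> * (w x * e x \<xi>))" by (simp add: mult_ac)
      then show "(LINT x|lborel. w x * (e x \<xi> * g \<xi>)) = g \<xi> * (LINT x|lborel. w x * e x \<xi>)" by simp
    qed
    finally show ?thesis .
  qed
  define Q where "Q = (LINT \<xi>|lborel. W' \<xi> * (cmod (m \<xi>))\<^sup>2)"
  have w1: "integrable lborel w"
    using wD D0 by (intro Bochner_Integration.integrable_bound[OF Ii]) auto
  have WE: "integrable lborel (\<lambda>\<xi>. W' \<xi> * (E \<xi>)\<^sup>2)"
  proof (rule Bochner_Integration.integrable_bound[OF Ei])
    have "W' \<xi> * (E \<xi>)\<^sup>2 \<le> E \<xi>" for \<xi>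
    proof -
      have "E \<xi> \<le> 1" using \<tau>0 by (simp add: E_def)
      then have "W' \<xi> * (E \<xi> * E \<xi>) \<le> 1 * (E \<xi> * 1)"
        using Wpos[of \<xi>] E0[of \<xi>] by (intro mult_mono) auto
      then show ?thesis by (simp add: power2_eq_square)
    qed
    then show "AE \<xi> in lborel. norm (W' \<xi> * (E \<xi>)\<^sup>2) \<le> norm (E \<xi>)"
      using Wpos E0 by (intro AE_I2) (simp add: abs_mult less_imp_le)
  qed measurable
  define kI where "kI = (\<lambda>x x'. indicator I x * (indicator I x' * k \<bar>x - x'\<bar>))"
  have kI: "(\<lambda>p. kI (fst p) (snd p)) \<in> borel_measurable (borel \<Otimes>\<^sub>M borel)" "\<And>x x'. 0 \<le> kI x x'" "\<And>x x'. kI x x' = kI x' x"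
    unfolding kI_def using k0 by (measurable, auto simp: abs_minus_commute mult_ac)
  have kI\<kappa>: "(\<integral>\<^sup>+x'. ennreal (kI x x') \<partial>lborel) \<le> ennreal \<kappa>" for x
    using k[of x] by (cases "x \<in> I") (auto simp: kI_def I_def)
  have KK: "norm (LINT \<xi>|lborel. complex_of_real (W' \<xi>) * (e x \<xi> * cnj (e x' \<xi>))) \<le> kI x x'"
    if "x \<noteq> x'" "w x \<noteq> 0" "w x' \<noteq> 0" for x x'
  proof -
    have "x \<in> I" "x' \<in> I" using that by (auto simp: w_def indicator_def split: if_splits)
    moreover have "(LINT \<xi>|lborel. complex_of_real (W' \<xi>) * (e x \<xi> * cnj (e x' \<xi>))) = dispersive_kernel s (y x - y x') (b x - b x') (\<tau> x + \<tau> x')"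
      unfolding e_def disp_mult_cnj dispersive_kernel_def by (simp add: disp_def W'_def mult_ac)
    ultimately show ?thesis using K[of x x'] that(1) by (simp add: kI_def I_def)
  qed
  note Q_bound = schur_quadratic_bound[OF w1 Si _ eE _ less_imp_le[OF Wpos(2)] WE kI less_imp_le[OF \<kappa>] kI\<kappa> KK]
  have Qi: "integrable lborel (\<lambda>\<xi>. W' \<xi> * (cmod (m \<xi>))\<^sup>2)" unfolding m_def by (rule Q_bound(1)) measurable
  have QS: "Q \<le> \<kappa> * S" unfolding Q_def S_def m_def by (rule Q_bound(2)) measurable
  define Nn where "Nn = (LINT \<xi>|lborel. W \<xi> * (cmod (g \<xi>))\<^sup>2)"
  have "S = norm (LINT \<xi>|lborel. g \<xi> * m \<xi>)" using S0 by (simp flip: S_gm)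
  \<comment> \<open>The weighted inequality between the means, tuned by \<kappa> so that
    \<open>Q \<le> \<kappa> * S\<close> turns the second term into \<open>S / 2\<close>, which the
    left side absorbs because \<open>S\<close> is finite.\<close>
  also have "\<dots> \<le> (LINT \<xi>|lborel. \<kappa> / 2 * (W \<xi> * (cmod (g \<xi>))\<^sup>2) + 1 / (2 * \<kappa>) * (W' \<xi> * (cmod (m \<xi>))\<^sup>2))"
  proof (cases "integrable lborel (\<lambda>\<xi>. g \<xi> * m \<xi>)")
    case True
    show ?thesis
    proof (rule Bochner_Integration.integral_norm_bound_integral[OF True])
      show "integrable lborel (\<lambda>\<xi>. \<kappa> / 2 * (W \<xi> * (cmod (g \<xi>))\<^sup>2) + 1 / (2 * \<kappa>) * (W' \<xi> * (cmod (m \<xi>))\<^sup>2))"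
        using N Qi by (intro Bochner_Integration.integrable_add integrable_mult_right) (auto simp: W_def)
      fix \<xi>
      define p where "p = sqrt (\<kappa> * W \<xi>) * cmod (g \<xi>)"
      define q where "q = sqrt (W' \<xi> / \<kappa>) * cmod (m \<xi>)"
      have "sqrt (\<kappa> * W \<xi>) * sqrt (W' \<xi> / \<kappa>) = 1"
        using Wpos[of \<xi>] \<kappa> by (simp flip: real_sqrt_mult)
      moreover have "p * q = (sqrt (\<kappa> * W \<xi>) * sqrt (W' \<xi> / \<kappa>)) * (cmod (g \<xi>) * cmod (m \<xi>))"
        unfolding p_def q_def by (simp only: mult_ac)
      ultimately have "p * q = cmod (g \<xi>) * cmod (m \<xi>)" by (simp only: mult_1)
      moreover have "p\<^sup>2 = \<kappa> * W \<xi> * (cmod (g \<xi>))\<^sup>2" "q\<^sup>2 = W' \<xi> / \<kappa> * (cmod (m \<xi>))\<^sup>2"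
        using Wpos[of \<xi>] \<kappa> by (auto simp: p_def q_def power_mult_distrib less_imp_le)
      moreover have "2 * p * q \<le> p\<^sup>2 + q\<^sup>2" by (rule sum_squares_bound)
      ultimately show "norm (g \<xi> * m \<xi>) \<le> \<kappa> / 2 * (W \<xi> * (cmod (g \<xi>))\<^sup>2) + 1 / (2 * \<kappa>) * (W' \<xi> * (cmod (m \<xi>))\<^sup>2)"
        by (simp add: norm_mult)
    qed
  next
    case False
    then show ?thesis using Wpos \<kappa>
      by (simp add: not_integrable_integral_eq) (intro Bochner_Integration.integral_nonneg add_nonneg_nonneg mult_nonneg_nonneg divide_nonneg_nonneg, auto simp: less_imp_le)
  qed
  also have "\<dots> = \<kappa> / 2 * Nn + 1 / (2 * \<kappa>) * Q"
    unfolding Nn_def Q_def using N Qi by (subst Bochner_Integration.integral_add) (auto simp: W_def)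
  also have "1 / (2 * \<kappa>) * Q \<le> 1 / (2 * \<kappa>) * (\<kappa> * S)" using QS \<kappa> by (intro mult_left_mono) auto
  also have "1 / (2 * \<kappa>) * (\<kappa> * S) = S / 2" using \<kappa> by simp
  finally have "S \<le> \<kappa> * Nn" by simp
  moreover have "(\<integral>\<^sup>+x. ennreal (indicator {-L..L} x * (cmod (disp_int g (y x) (b x) (\<tau> x)))\<^sup>2) \<partial>lborel) = ennreal S"
    unfolding SN[symmetric] wsq by (simp add: I_def u_def e_def disp_int_def)
  ultimately show ?thesis by (simp add: ennreal_leI Nn_def W_def)
qed

text \<open>The first index up to \<open>n\<close> at which the maximum is attained. The recursion
  is a case distinction between measurable functions, so measurability in \<open>x\<close> follows
  by induction.\<close>

primrec argmax_upto :: "(nat \<Rightarrow> real \<Rightarrow> real) \<Rightarrow> nat \<Rightarrow> real \<Rightarrow> nat" where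
  "argmax_upto A 0 x = 0"
| "argmax_upto A (Suc n) x = (if A (argmax_upto A n x) x < A (Suc n) x then Suc n else argmax_upto A n x)"

lemma argmax_upto_le: "argmax_upto A n x \<le> n"
  by (induction n) (auto intro: le_SucI)

lemma argmax_upto_max: "i \<le> n \<Longrightarrow> A i x \<le> A (argmax_upto A n x) x"
proof (induction n)
  case (Suc n)
  then show ?case by (cases "i = Suc n") (auto intro: order_trans)
qed simp

lemma measurable_argmax_upto:
  assumes A: "\<And>i. A i \<in> borel_measurable borel"
  shows "argmax_upto A n \<in> measurable borel (count_space UNIV)"
proof (induction n)
  case 0
  have "argmax_upto A 0 = (\<lambda>x. 0)" by (simp add: fun_eq_iff)
  then show ?case by simp
next
  case (Suc n)
  note [measurable] = A Suc
  have [measurable]: "(\<lambda>x. A (argmax_upto A n x) x) \<in> borel_measurable borel"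
    by (rule measurable_compose_countable[OF A Suc])
  have "argmax_upto A (Suc n) = (\<lambda>x. if A (argmax_upto A n x) x < A (Suc n) x then Suc n else argmax_upto A n x)"
    by (simp add: fun_eq_iff)
  then show ?case by simp
qed

lemma borel_measurable_disp_int [measurable]:
  assumes [measurable]: "g \<in> borel_measurable borel" "y \<in> borel_measurable M" "b \<in> borel_measurable M" "\<tau> \<in> borel_measurable M"
  shows "(\<lambda>x. disp_int g (y x) (b x) (\<tau> x)) \<in> borel_measurable M"
  unfolding disp_int_def by measurable

text \<open>The supremum over finitely many indices is reduced to a single operator with a
  measurable choice of the maximising index; monotone convergence gives the full supremum.\<close>

lemma maximal_bound:
  fixes Y :: "nat \<Rightarrow> real \<Rightarrow> real" and b \<tau> :: "nat \<Rightarrow> real" and g :: "real \<Rightarrow> complex" and k :: "real \<Rightarrow> real"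
  assumes Y: "\<And>i. Y i \<in> borel_measurable borel" and \<tau>: "\<And>i. 0 < \<tau> i"
    and g [measurable]: "g \<in> borel_measurable borel" and s: "0 \<le> s"
    and N: "integrable lborel (\<lambda>\<xi>. (1 + \<xi>\<^sup>2) powr s * (cmod (g \<xi>))\<^sup>2)"
    and kb: "k \<in> borel_measurable borel" and k0: "\<And>r. 0 \<le> k r" and \<kappa>: "\<kappa> > 0"
    and k: "\<And>x. x \<in> {-L..L} \<Longrightarrow> (\<integral>\<^sup>+x'. ennreal (indicator {-L..L} x' * k \<bar>x - x'\<bar>) \<partial>lborel) \<le> ennreal \<kappa>"
    and K: "\<And>x x' i j. x \<noteq> x' \<Longrightarrow>
        norm (dispersive_kernel s (Y i x - Y j x') (b i - b j) (\<tau> i + \<tau> j)) \<le> k \<bar>x - x'\<bar>"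
  shows "(\<integral>\<^sup>+x. indicator {-L..L} x * (SUP i. ennreal ((cmod (disp_int g (Y i x) (b i) (\<tau> i)))\<^sup>2)) \<partial>lborel)
    \<le> ennreal (\<kappa> * (LINT \<xi>|lborel. (1 + \<xi>\<^sup>2) powr s * (cmod (g \<xi>))\<^sup>2))"
proof -
  note [measurable] = Y
  define A where "A = (\<lambda>i x. (cmod (disp_int g (Y i x) (b i) (\<tau> i)))\<^sup>2)"
  have Am: "A i \<in> borel_measurable borel" for i unfolding A_def by measurable
  define J where "J = argmax_upto A"
  have Jm: "J n \<in> measurable borel (count_space UNIV)" for n unfolding J_def by (rule measurable_argmax_upto[OF Am])
  have AJm[measurable]: "(\<lambda>x. A (J n x) x) \<in> borel_measurable borel" for n
    by (rule measurable_compose_countable[OF Am Jm])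
  have mono: "A (J n x) x \<le> A (J (Suc n) x) x" for n x by (simp add: J_def)
  have inc: "incseq (\<lambda>n x. indicator {-L..L} x * ennreal (A (J n x) x))"
    by (intro incseq_SucI le_funI mult_left_mono ennreal_leI mono) simp
  have bound: "(\<integral>\<^sup>+x. indicator {-L..L} x * ennreal (A (J n x) x) \<partial>lborel) \<le> ennreal (\<kappa> * (LINT \<xi>|lborel. (1 + \<xi>\<^sup>2) powr s * (cmod (g \<xi>))\<^sup>2))" for n
  proof -
    have "(\<integral>\<^sup>+x. ennreal (indicator {-L..L} x * (cmod (disp_int g (Y (J n x) x) (b (J n x)) (\<tau> (J n x))))\<^sup>2) \<partial>lborel)
      \<le> ennreal (\<kappa> * (LINT \<xi>|lborel. (1 + \<xi>\<^sup>2) powr s * (cmod (g \<xi>))\<^sup>2))"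
    \<comment> \<open>Only the indices up to \<open>n\<close> occur as \<open>J n x\<close>, so the
      least of their dampings is a positive lower bound.\<close>
    proof (rule ttstar_bound[where ?\<tau>0.0="Min (\<tau> ` {..n})" and k=k and b="\<lambda>x. b (J n x)" and \<tau>="\<lambda>x. \<tau> (J n x)"])
      show "(\<lambda>x. Y (J n x) x) \<in> borel_measurable borel" by (rule measurable_compose_countable[OF Y Jm])
      show "(\<lambda>x. b (J n x)) \<in> borel_measurable borel" using Jm by (rule measurable_compose) simp
      show "(\<lambda>x. \<tau> (J n x)) \<in> borel_measurable borel" using Jm by (rule measurable_compose) simp
      show "0 < Min (\<tau> ` {..n})" using \<tau> by (subst Min_gr_iff) auto
      show "Min (\<tau> ` {..n}) \<le> \<tau> (J n x)" for x using argmax_upto_le[of A n x] by (intro Min_le) (auto simp: J_def)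
    qed (use g s N kb k0 \<kappa> k K in auto)
    moreover have "indicator {-L..L} x * ennreal (A (J n x) x) = ennreal (indicator {-L..L} x * (cmod (disp_int g (Y (J n x) x) (b (J n x)) (\<tau> (J n x))))\<^sup>2)" for x
      by (simp add: A_def indicator_def)
    ultimately show ?thesis by simp
  qed
  have "indicator {-L..L} x * (SUP i. ennreal (A i x)) \<le> (SUP n. indicator {-L..L} x * ennreal (A (J n x) x))" for x
  proof -
    have "(SUP i. ennreal (A i x)) \<le> (SUP n. ennreal (A (J n x) x))"
      using argmax_upto_max[of _ _ A x] by (intro SUP_mono) (auto simp: J_def intro!: ennreal_leI)
    then show ?thesis by (simp add: SUP_mult_left_ennreal[symmetric] mult_left_mono)
  qed
  then have "(\<integral>\<^sup>+x. indicator {-L..L} x * (SUP i. ennreal (A i x)) \<partial>lborel) \<le> (\<integral>\<^sup>+x. (SUP n. indicator {-L..L} x * ennreal (A (J n x) x)) \<partial>lborel)"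
    by (intro nn_integral_mono)
  also have "\<dots> = (SUP n. \<integral>\<^sup>+x. indicator {-L..L} x * ennreal (A (J n x) x) \<partial>lborel)"
    by (rule nn_integral_monotone_convergence_SUP[OF inc]) measurable
  also have "\<dots> \<le> ennreal (\<kappa> * (LINT \<xi>|lborel. (1 + \<xi>\<^sup>2) powr s * (cmod (g \<xi>))\<^sup>2))"
    by (intro SUP_least bound)
  finally show ?thesis by (simp add: A_def)
qed

section \<open>Continuity of the flows and passage to the limit\<close>

lemma disp_int_LIMSEQ:
  assumes g: "integrable lborel g" and y: "y \<longlonglongrightarrow> y0" and b: "b \<longlonglongrightarrow> b0" and \<tau>: "\<tau> \<longlonglongrightarrow> \<tau>0" "\<And>n::nat. 0 \<le> \<tau> n"
  shows "(\<lambda>n. disp_int g (y n) (b n) (\<tau> n)) \<longlonglongrightarrow> disp_int g y0 b0 \<tau>0"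
  unfolding disp_int_def
proof (rule integral_dominated_convergence[where w="\<lambda>\<xi>. norm (g \<xi>)"])
  have [measurable]: "g \<in> borel_measurable borel" using borel_measurable_integrable[OF g] by simp
  show "(\<lambda>\<xi>. disp y0 b0 \<tau>0 \<xi> * g \<xi>) \<in> borel_measurable lborel" by measurable
  show "(\<lambda>\<xi>. disp (y n) (b n) (\<tau> n) \<xi> * g \<xi>) \<in> borel_measurable lborel" for n by measurable
  show "integrable lborel (\<lambda>\<xi>. norm (g \<xi>))" using g by simp
  show "AE \<xi> in lborel. (\<lambda>n. disp (y n) (b n) (\<tau> n) \<xi> * g \<xi>) \<longlonglongrightarrow> disp y0 b0 \<tau>0 \<xi> * g \<xi>"
    unfolding disp_def cis_conv_exp by (intro AE_I2 tendsto_intros y b \<tau>)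
  show "AE \<xi> in lborel. norm (disp (y n) (b n) (\<tau> n) \<xi> * g \<xi>) \<le> norm (g \<xi>)" for n
    using \<tau>(2)[of n] by (intro AE_I2) (simp add: norm_mult norm_disp mult_left_le_one_le)
qed

text \<open>Part of the damping is moved into the data: for \<open>c > 0\<close> the Gaussian factor
  makes a square integrable \<open>g\<close> integrable, and dominated convergence applies.\<close>

lemma disp_int_gaussian_shift:
  "disp_int g y b \<tau> = disp_int (\<lambda>\<xi>. complex_of_real (exp (- c * \<xi>\<^sup>2)) * g \<xi>) y b (\<tau> - c)"
proof -
  have "exp (- (\<tau> - c) * \<xi>\<^sup>2) * exp (- c * \<xi>\<^sup>2) = exp (- \<tau> * \<xi>\<^sup>2)" for \<xi> :: real
    by (simp add: mult_exp_exp algebra_simps)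
  then have "disp y b (\<tau> - c) \<xi> * complex_of_real (exp (- c * \<xi>\<^sup>2)) = disp y b \<tau> \<xi>" for \<xi>
    unfolding disp_def mult.assoc of_real_mult[symmetric] by simp
  then show ?thesis by (simp add: disp_int_def mult.assoc[symmetric])
qed

lemma continuous_on_disp_int:
  fixes g :: "real \<Rightarrow> complex" and y b \<tau> :: "real \<Rightarrow> real"
  assumes [measurable]: "g \<in> borel_measurable borel"
    and g2: "integrable lborel (\<lambda>\<xi>. (cmod (g \<xi>))\<^sup>2)" and c: "c > 0" "\<And>t. t \<in> S \<Longrightarrow> c \<le> \<tau> t"
    and cont: "continuous_on S y" "continuous_on S b" "continuous_on S \<tau>"
  shows "continuous_on S (\<lambda>t. disp_int g (y t) (b t) (\<tau> t))"
proof (rule continuous_on_sequentiallyI)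
  fix u a assume u: "\<forall>n. u n \<in> S" "a \<in> S" "u \<longlonglongrightarrow> a"
  let ?g = "\<lambda>\<xi>. complex_of_real (exp (- c * \<xi>\<^sup>2)) * g \<xi>"
  have "integrable lborel (\<lambda>\<xi>. norm (?g \<xi>))" using integrable_gaussian_mult[OF assms(1) g2 c(1)] by (simp add: norm_mult)
  then have gi: "integrable lborel ?g" by (rule integrable_norm_cancel) measurable
  have lim: "(\<lambda>n. h (u n)) \<longlonglongrightarrow> h a" if "continuous_on S h" for h :: "real \<Rightarrow> real"
    using that u by (auto simp: continuous_on_sequentially comp_def)
  have "(\<lambda>n. disp_int ?g (y (u n)) (b (u n)) (\<tau> (u n) - c)) \<longlonglongrightarrow> disp_int ?g (y a) (b a) (\<tau> a - c)"
    using c u by (intro disp_int_LIMSEQ gi lim cont tendsto_intros) auto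
  then show "(\<lambda>n. disp_int g (y (u n)) (b (u n)) (\<tau> (u n))) \<longlonglongrightarrow> disp_int g (y a) (b a) (\<tau> a)"
    by (simp only: disp_int_gaussian_shift[of g _ _ _ c, symmetric])
qed

text \<open>Passes from the supremum over countably many times, which is measurable, to all times in
  \<open>(0, 1]\<close>. Continuity is assumed only away from 0.\<close>

lemma continuous_le_of_rational_le:
  fixes h :: "real \<Rightarrow> real"
  assumes cont: "\<And>a. 0 < a \<Longrightarrow> continuous_on {a..1} h"
    and le: "\<And>r. r \<in> \<rat> \<inter> {0<..1} \<Longrightarrow> h r \<le> c" and t: "t \<in> {0<..1}"
  shows "h t \<le> c"
proof (rule ccontr)
  assume "\<not> h t \<le> c"
  then have c: "c < h t" by simp
  have "(h \<longlongrightarrow> h t) (at t within {t/2..1})"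
    using cont[of "t/2"] t by (auto simp: continuous_on_def)
  then have "\<forall>\<^sub>F u in at t within {t/2..1}. c < h u" using c by (rule order_tendstoD)
  then obtain d where d: "d > 0" "\<And>u. u \<in> {t/2..1} \<Longrightarrow> u \<noteq> t \<Longrightarrow> dist u t < d \<Longrightarrow> c < h u"
    unfolding eventually_at by auto
  \<comment> \<open>The rational is taken to the left of \<open>t\<close>, since \<open>t\<close>
    may be the endpoint 1.\<close>
  have "max (t / 2) (t - d) < t" using t d by simp
  then obtain r where r: "r \<in> \<rat>" "max (t / 2) (t - d) < r" "r < t" using Rats_dense_in_real by blast
  then have "c < h r" using t by (intro d) (auto simp: dist_real_def)
  moreover have "h r \<le> c" using r t by (intro le) auto
  ultimately show False by simp
qed

text \<open>A Cauchy criterion for two functions at once: centres \<open>c n\<close> at precision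
  \<open>1 / (n + 1)\<close> form a Cauchy sequence, and both functions tend to its limit. The
  centres will be values of a low frequency part at time 0.\<close>

lemma common_limit:
  fixes V H :: "real \<Rightarrow> complex"
  assumes F: "F \<noteq> bot"
    and ap: "\<And>e. e > 0 \<Longrightarrow> \<exists>c. \<forall>\<^sub>F t in F. dist (V t) c < e \<and> dist (H t) c < e"
  obtains l where "(V \<longlongrightarrow> l) F" "(H \<longlongrightarrow> l) F"
proof -
  have "\<exists>c. \<forall>n. \<forall>\<^sub>F t in F. dist (V t) (c n) < inverse (real (Suc n)) \<and> dist (H t) (c n) < inverse (real (Suc n))"
    using ap by (intro choice allI) simp
  then obtain c where c: "\<And>n. \<forall>\<^sub>F t in F. dist (V t) (c n) < inverse (real (Suc n)) \<and> dist (H t) (c n) < inverse (real (Suc n))"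
    by blast
  have d: "dist (c n) (c m) < inverse (real (Suc n)) + inverse (real (Suc m))" for n m
  proof -
    have "\<forall>\<^sub>F t in F. dist (V t) (c n) < inverse (real (Suc n)) \<and> dist (V t) (c m) < inverse (real (Suc m))"
      using c[of n] c[of m] by eventually_elim simp
    then obtain t where "dist (V t) (c n) < inverse (real (Suc n))" "dist (V t) (c m) < inverse (real (Suc m))"
      using eventually_happens'[OF F] by blast
    then show ?thesis using dist_triangle[of "c n" "c m" "V t"] by (simp add: dist_commute)
  qed
  have "Cauchy c"
  proof (rule metric_CauchyI)
    fix e :: real assume e: "e > 0"
    then obtain M where M: "inverse (real (Suc M)) < e / 2" using reals_Archimedean[of "e/2"] by auto
    show "\<exists>M. \<forall>m\<ge>M. \<forall>n\<ge>M. dist (c m) (c n) < e"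
    proof (intro exI allI impI)
      fix m n assume "M \<le> m" "M \<le> n"
      then have "inverse (real (Suc m)) \<le> inverse (real (Suc M))" "inverse (real (Suc n)) \<le> inverse (real (Suc M))"
        by (auto intro!: le_imp_inverse_le)
      then show "dist (c m) (c n) < e" using d[of m n] M by linarith
    qed
  qed
  then obtain l where l: "c \<longlonglongrightarrow> l" using Cauchy_convergent convergent_def by blast
  have ev: "\<forall>\<^sub>F t in F. dist (V t) l < e \<and> dist (H t) l < e" if e: "e > 0" for e
  proof -
    have "\<forall>\<^sub>F n in sequentially. dist (c n) l < e / 2" using l e by (intro tendstoD) auto
    moreover have "\<forall>\<^sub>F n in sequentially. inverse (real (Suc n)) < e / 2"
      using LIMSEQ_inverse_real_of_nat e by (intro order_tendstoD) auto
    ultimately have "\<forall>\<^sub>F n in sequentially. dist (c n) l < e / 2 \<and> inverse (real (Suc n)) < e / 2"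
      by eventually_elim simp
    then obtain n where n: "dist (c n) l < e / 2" "inverse (real (Suc n)) < e / 2"
      using eventually_happens'[OF sequentially_bot] by blast
    show ?thesis using c[of n]
    proof eventually_elim
      case (elim t)
      then show ?case using n dist_triangle[of "V t" l "c n"] dist_triangle[of "H t" l "c n"] by linarith
    qed
  qed
  have "(V \<longlongrightarrow> l) F" "(H \<longlongrightarrow> l) F"
    by (auto intro!: tendstoI intro: eventually_mono[OF ev])
  then show ?thesis by (rule that)
qed

lemma weighted_tail_tendsto_0:
  fixes g :: "real \<Rightarrow> complex"
  assumes [measurable]: "g \<in> borel_measurable borel"
    and N: "integrable lborel (\<lambda>\<xi>. (1 + \<xi>\<^sup>2) powr s * (cmod (g \<xi>))\<^sup>2)"
  shows "(\<lambda>n. LINT \<xi>|lborel. (1 + \<xi>\<^sup>2) powr s * (cmod (indicator (- {- real n..real n}) \<xi> * g \<xi>))\<^sup>2) \<longlonglongrightarrow> 0"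
proof -
  have "(\<lambda>n. LINT \<xi>|lborel. (1 + \<xi>\<^sup>2) powr s * (cmod (indicator (- {- real n..real n}) \<xi> * g \<xi>))\<^sup>2) \<longlonglongrightarrow> (LINT (\<xi>::real)|lborel. 0)"
  proof (rule integral_dominated_convergence[OF _ _ N])
    show "AE \<xi> in lborel. (\<lambda>n. (1 + \<xi>\<^sup>2) powr s * (cmod (indicator (- {- real n..real n}) \<xi> * g \<xi>))\<^sup>2) \<longlonglongrightarrow> 0"
    proof (rule AE_I2)
      fix \<xi> :: real
      have "eventually (\<lambda>n. (1 + \<xi>\<^sup>2) powr s * (cmod (indicator (- {- real n..real n}) \<xi> * g \<xi>))\<^sup>2 = 0) sequentially"
        using eventually_in_Icc_nat[of \<xi>] by eventually_elim (simp add: indicator_def)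
      then show "(\<lambda>n. (1 + \<xi>\<^sup>2) powr s * (cmod (indicator (- {- real n..real n}) \<xi> * g \<xi>))\<^sup>2) \<longlonglongrightarrow> 0"
        by (rule tendsto_eventually)
    qed
    show "AE \<xi> in lborel. norm ((1 + \<xi>\<^sup>2) powr s * (cmod (indicator (- {- real n..real n}) \<xi> * g \<xi>))\<^sup>2) \<le> (1 + \<xi>\<^sup>2) powr s * (cmod (g \<xi>))\<^sup>2" for n
      by (intro AE_I2) (auto simp: indicator_def)
  qed measurable
  then show ?thesis by simp
qed

lemma integrable_truncation:
  fixes g :: "real \<Rightarrow> complex"
  assumes [measurable]: "g \<in> borel_measurable borel" and g2: "integrable lborel (\<lambda>\<xi>. (cmod (g \<xi>))\<^sup>2)"
  shows "integrable lborel (\<lambda>\<xi>. indicator {- L..L} \<xi> * g \<xi>)"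
proof (rule Bochner_Integration.integrable_bound)
  show "integrable lborel (\<lambda>\<xi>. indicator {- L..L} \<xi> + (cmod (g \<xi>))\<^sup>2)"
    by (intro Bochner_Integration.integrable_add g2 integrable_real_indicator) (auto simp: emeasure_lborel_Icc_eq)
  show "AE \<xi> in lborel. norm (indicator {- L..L} \<xi> * g \<xi>) \<le> norm (indicator {- L..L} \<xi> + (cmod (g \<xi>))\<^sup>2)"
  proof (rule AE_I2)
    fix \<xi>
    have "0 \<le> (cmod (g \<xi>) - 1)\<^sup>2 + 1 + (cmod (g \<xi>))\<^sup>2" by simp
    then have "cmod (g \<xi>) \<le> 1 + (cmod (g \<xi>))\<^sup>2" by (simp add: power2_eq_square algebra_simps)
    then show "norm (indicator {- L..L} \<xi> * g \<xi>) \<le> norm (indicator {- L..L} \<xi> + (cmod (g \<xi>))\<^sup>2)"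
      by (simp add: indicator_def)
  qed
qed measurable

lemma disp_int_split:
  fixes g :: "real \<Rightarrow> complex"
  assumes [measurable]: "g \<in> borel_measurable borel" "A \<in> sets borel" and g2: "integrable lborel (\<lambda>\<xi>. (cmod (g \<xi>))\<^sup>2)" and \<tau>: "\<tau> > 0"
  shows "disp_int g y b \<tau> = disp_int (\<lambda>\<xi>. indicator A \<xi> * g \<xi>) y b \<tau> + disp_int (\<lambda>\<xi>. indicator (- A) \<xi> * g \<xi>) y b \<tau>"
proof -
  have i: "integrable lborel (\<lambda>\<xi>. disp y b \<tau> \<xi> * (indicator B \<xi> * g \<xi>))" if [measurable]: "B \<in> sets borel" for B
  proof (rule integrable_disp_mult[OF _ _ \<tau>])
    show "integrable lborel (\<lambda>\<xi>. (cmod (indicator B \<xi> * g \<xi>))\<^sup>2)"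
      by (rule Bochner_Integration.integrable_bound[OF g2]) (auto simp: indicator_def)
  qed measurable
  have "disp y b \<tau> \<xi> * g \<xi> = disp y b \<tau> \<xi> * (indicator A \<xi> * g \<xi>) + disp y b \<tau> \<xi> * (indicator (- A) \<xi> * g \<xi>)" for \<xi>
    by (simp add: indicator_def)
  then show ?thesis unfolding disp_int_def by (subst Bochner_Integration.integral_add[symmetric]) (auto intro!: i)
qed

section \<open>Almost everywhere convergence\<close>

lemma power_kernel_mass:
  fixes a1 a2 a3 C L :: real
  assumes a: "-1 < a1" "-1 < a2" "-1 < a3" and C: "C > 0"
  obtains \<kappa> where "\<kappa> > 0"
    "\<And>x. x \<in> {-L..L} \<Longrightarrow> (\<integral>\<^sup>+x'. ennreal (indicator {-L..L} x' * (C * (\<bar>x - x'\<bar> powr a1 + \<bar>x - x'\<bar> powr a2 + \<bar>x - x'\<bar> powr a3))) \<partial>lborel) \<le> ennreal \<kappa>"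
proof -
  define m where "m = (\<lambda>a. 2 * ((2 * L) powr (a + 1) / (a + 1)))"
  have m: "m a1 \<ge> 0" "m a2 \<ge> 0" "m a3 \<ge> 0" using a by (auto simp: m_def)
  \<comment> \<open>The summand 1 keeps the bound positive when the masses vanish, as for
    \<open>L = 0\<close>.\<close>
  have "(\<integral>\<^sup>+x'. ennreal (indicator {-L..L} x' * (C * (\<bar>x - x'\<bar> powr a1 + \<bar>x - x'\<bar> powr a2 + \<bar>x - x'\<bar> powr a3))) \<partial>lborel) \<le> ennreal (C * (m a1 + m a2 + m a3) + 1)"
    if x: "x \<in> {-L..L}" for x
  proof -
    have "(\<integral>\<^sup>+x'. ennreal (indicator {-L..L} x' * (C * (\<bar>x - x'\<bar> powr a1 + \<bar>x - x'\<bar> powr a2 + \<bar>x - x'\<bar> powr a3))) \<partial>lborel)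
      = (\<integral>\<^sup>+x'. ennreal C * (ennreal (indicator {-L..L} x' * \<bar>x - x'\<bar> powr a1) + ennreal (indicator {-L..L} x' * \<bar>x - x'\<bar> powr a2) + ennreal (indicator {-L..L} x' * \<bar>x - x'\<bar> powr a3)) \<partial>lborel)"
      using C by (intro nn_integral_cong) (auto simp: indicator_def ennreal_mult)
    also have "\<dots> = ennreal C * ((\<integral>\<^sup>+x'. ennreal (indicator {-L..L} x' * \<bar>x - x'\<bar> powr a1) \<partial>lborel) + (\<integral>\<^sup>+x'. ennreal (indicator {-L..L} x' * \<bar>x - x'\<bar> powr a2) \<partial>lborel) + (\<integral>\<^sup>+x'. ennreal (indicator {-L..L} x' * \<bar>x - x'\<bar> powr a3) \<partial>lborel))"
      by (simp add: nn_integral_cmult nn_integral_add)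
    also have "\<dots> \<le> ennreal C * (ennreal (m a1) + ennreal (m a2) + ennreal (m a3))"
      unfolding m_def by (intro mult_left_mono add_mono nn_integral_shifted_powr_le a x) auto
    also have "\<dots> = ennreal (C * (m a1 + m a2 + m a3))"
      using m C by (simp add: ennreal_mult)
    also have "\<dots> \<le> ennreal (C * (m a1 + m a2 + m a3) + 1)" by (intro ennreal_leI) simp
    finally show ?thesis .
  qed
  moreover have "C * (m a1 + m a2 + m a3) + 1 > 0"
    using m C by (intro add_nonneg_pos mult_nonneg_nonneg) auto
  ultimately show ?thesis using that by blast
qed

lemma admissible_curve_continuous:
  assumes "admissible_curve \<alpha> \<Gamma>"
  shows "continuous_on {-1..1} (\<Gamma> x)" and "t \<in> {-1..1} \<Longrightarrow> continuous_on UNIV (\<lambda>x. \<Gamma> x t)"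
    and "((\<lambda>t. \<Gamma> x t) \<longlongrightarrow> x) (at_right 0)"
proof -
  have c: "continuous_on (UNIV \<times> {-1..1}) (\<lambda>(x, t). \<Gamma> x t)" and 0: "\<And>x. \<Gamma> x 0 = x"
    using assms by (auto simp: admissible_curve_def)
  have "continuous_on {-1..1} (\<lambda>t. (\<lambda>(x, t). \<Gamma> x t) (x, t))"
    by (rule continuous_on_compose2[OF c]) (auto intro!: continuous_intros)
  then show 1: "continuous_on {-1..1} (\<Gamma> x)" by simp
  show "continuous_on UNIV (\<lambda>x. \<Gamma> x t)" if "t \<in> {-1..1}"
  proof -
    have "continuous_on UNIV (\<lambda>x. (\<lambda>(x, t). \<Gamma> x t) (x, t))"
      by (rule continuous_on_compose2[OF c]) (use that in \<open>auto intro!: continuous_intros\<close>)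
    then show ?thesis by simp
  qed
  have "continuous_on {0..1} (\<Gamma> x)" using 1 by (rule continuous_on_subset) auto
  then have "(\<Gamma> x \<longlongrightarrow> \<Gamma> x 0) (at 0 within {0..1})" by (auto simp: continuous_on_def)
  then show "((\<lambda>t. \<Gamma> x t) \<longlongrightarrow> x) (at_right 0)" by (simp add: at_within_Icc_at_right 0)
qed

lemma disp_int_tendsto_at_right:
  assumes g: "integrable lborel g" and y: "(y \<longlongrightarrow> y0) (at_right 0)" and b: "(b \<longlongrightarrow> b0) (at_right 0)"
    and \<tau>: "(\<tau> \<longlongrightarrow> \<tau>0) (at_right 0)" "\<And>t::real. t > 0 \<Longrightarrow> 0 \<le> \<tau> t"
  shows "((\<lambda>t. disp_int g (y t) (b t) (\<tau> t)) \<longlongrightarrow> disp_int g y0 b0 \<tau>0) (at_right 0)"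
  unfolding tendsto_at_iff_sequentially comp_def
proof (intro allI impI)
  fix X :: "nat \<Rightarrow> real" assume X: "\<forall>i. X i \<in> {0<..} - {0}" "X \<longlonglongrightarrow> 0"
  show "(\<lambda>n. disp_int g (y (X n)) (b (X n)) (\<tau> (X n))) \<longlonglongrightarrow> disp_int g y0 b0 \<tau>0"
    using y b \<tau> X unfolding tendsto_at_iff_sequentially comp_def by (intro disp_int_LIMSEQ g) auto
qed

text \<open>The low frequency part of \<open>g\<close> is integrable, so both flows of it tend to
  the same value at every \<open>x\<close>. The maximal functions of the high frequency tail are
  controlled by its weighted norm, which tends to 0, hence both flows of \<open>g\<close> share a
  limit almost everywhere. The second conclusion is the domination needed to identify that
  limit.\<close>

lemma curve_heat_convergence:
  fixes g :: "real \<Rightarrow> complex"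
  assumes \<gamma>: "\<gamma> > 0" and \<alpha>: "\<alpha> > 0" "\<alpha> \<le> 1/4"
    and s: "s_crit \<gamma> \<alpha> < s" "s < 1/2" and adm: "admissible_curve \<alpha> \<Gamma>"
    and g [measurable]: "g \<in> borel_measurable borel"
    and N: "integrable lborel (\<lambda>\<xi>. (1 + \<xi>\<^sup>2) powr s * (cmod (g \<xi>))\<^sup>2)"
  shows "AE x in lborel. \<exists>l. ((\<lambda>t. disp_int g (\<Gamma> x t) t (t powr \<gamma>)) \<longlongrightarrow> l) (at_right 0) \<and>
      ((\<lambda>t. disp_int g x 0 t) \<longlongrightarrow> l) (at_right 0)"
    and "\<And>L (q :: nat \<Rightarrow> real). (\<And>i. 0 < q i) \<Longrightarrow>
      (\<integral>\<^sup>+x. indicator {-L..L} x * (SUP i. ennreal ((cmod (disp_int g x 0 (q i)))\<^sup>2)) \<partial>lborel) < \<infinity>"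
proof -
  have s0: "0 < s" using s_crit_nonneg[of \<alpha> \<gamma>] \<alpha> s by linarith
  obtain C1 \<theta> where C1: "C1 > 0" "0 < \<theta>" "\<theta> < 1" and K1: "\<And>x x' t t'. x \<noteq> x' \<Longrightarrow> t \<in> {0<..1} \<Longrightarrow> t' \<in> {0<..1} \<Longrightarrow>
       norm (dispersive_kernel s (\<Gamma> x t - \<Gamma> x' t') (t - t') (t powr \<gamma> + t' powr \<gamma>)) \<le>
       C1 * (\<bar>x - x'\<bar> powr (2 * s - 1) + \<bar>x - x'\<bar> powr (- 2 * s) + \<bar>x - x'\<bar> powr (- \<theta>))"
    using curve_kernel_bound[OF \<gamma> \<alpha> s adm] by blast
  obtain C2 where C2: "C2 > 0" and K2: "\<And>x x' \<tau>. x \<noteq> x' \<Longrightarrow> \<tau> > 0 \<Longrightarrow>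
       norm (dispersive_kernel s (x - x') 0 \<tau>) \<le> C2 * (\<bar>x - x'\<bar> powr (2 * s - 1) + \<bar>x - x'\<bar> powr (- 2 * s))"
    using heat_kernel_bound[OF s0 s(2)] by blast
  define k where "k = (\<lambda>r. (C1 + C2) * (r powr (2 * s - 1) + r powr (- 2 * s) + r powr (- \<theta>)))"
  have kb[measurable]: "k \<in> borel_measurable borel" unfolding k_def by measurable
  have k0: "k r \<ge> 0" for r using C1 C2 by (simp add: k_def)
  have k1: "C1 * (r powr (2 * s - 1) + r powr (- 2 * s) + r powr (- \<theta>)) \<le> k r" for r
    unfolding k_def using C2 by (intro mult_right_mono) auto
  have k2: "C2 * (r powr (2 * s - 1) + r powr (- 2 * s)) \<le> k r" for r
    unfolding k_def using C1 C2 by (intro mult_mono) auto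
  have g2: "integrable lborel (\<lambda>\<xi>. (cmod (g \<xi>))\<^sup>2)" by (rule weighted_imp_square_integrable[OF g _ N]) (use s0 in simp)
  \<comment> \<open>Quantified over all data \<open>h\<close>, since the estimates are applied to
    the tails of \<open>g\<close> with a constant that depends on \<open>L\<close> alone.\<close>
  define PB where "PB = (\<lambda>L \<kappa>. \<forall>h::real \<Rightarrow> complex. h \<in> borel_measurable borel \<longrightarrow> integrable lborel (\<lambda>\<xi>. (1 + \<xi>\<^sup>2) powr s * (cmod (h \<xi>))\<^sup>2) \<longrightarrow>
     (\<forall>q::nat \<Rightarrow> real. (\<forall>i. 0 < q i) \<longrightarrow> (\<integral>\<^sup>+x. indicator {-L..L} x * (SUP i. ennreal ((cmod (disp_int h x 0 (q i)))\<^sup>2)) \<partial>lborel)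
        \<le> ennreal (\<kappa> * (LINT \<xi>|lborel. (1 + \<xi>\<^sup>2) powr s * (cmod (h \<xi>))\<^sup>2))) \<and>
     (\<forall>q::nat \<Rightarrow> real. (\<forall>i. q i \<in> {0<..1}) \<longrightarrow> (\<integral>\<^sup>+x. indicator {-L..L} x * (SUP i. ennreal ((cmod (disp_int h (\<Gamma> x (q i)) (q i) (q i powr \<gamma>)))\<^sup>2)) \<partial>lborel)
        \<le> ennreal (\<kappa> * (LINT \<xi>|lborel. (1 + \<xi>\<^sup>2) powr s * (cmod (h \<xi>))\<^sup>2))))"
  have heat: "\<exists>\<kappa>>0. PB L \<kappa>" for L
  proof -
    obtain \<kappa> where \<kappa>: "\<kappa> > 0" "\<And>x. x \<in> {-L..L} \<Longrightarrow> (\<integral>\<^sup>+x'. ennreal (indicator {-L..L} x' * k \<bar>x - x'\<bar>) \<partial>lborel) \<le> ennreal \<kappa>"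
      using power_kernel_mass[of "2 * s - 1" "- 2 * s" "- \<theta>" "C1 + C2" L] s0 s C1 C2 unfolding k_def by auto
    show ?thesis
      unfolding PB_def
    proof (intro exI[of _ \<kappa>] conjI allI impI)
      show "\<kappa> > 0" by fact
      fix h :: "real \<Rightarrow> complex" and q :: "nat \<Rightarrow> real"
      assume h: "h \<in> borel_measurable borel" "integrable lborel (\<lambda>\<xi>. (1 + \<xi>\<^sup>2) powr s * (cmod (h \<xi>))\<^sup>2)"
      {
        assume q: "\<forall>i. 0 < q i"
        show "(\<integral>\<^sup>+x. indicator {-L..L} x * (SUP i. ennreal ((cmod (disp_int h x 0 (q i)))\<^sup>2)) \<partial>lborel)
          \<le> ennreal (\<kappa> * (LINT \<xi>|lborel. (1 + \<xi>\<^sup>2) powr s * (cmod (h \<xi>))\<^sup>2))"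
        proof (rule maximal_bound[where Y="\<lambda>i x. x" and b="\<lambda>i. 0" and \<tau>=q and k=k])
          show "norm (dispersive_kernel s (x - x') (0 - 0) (q i + q j)) \<le> k \<bar>x - x'\<bar>" if "x \<noteq> x'" for x x' i j
            using order_trans[OF K2[OF that] k2, of "q i + q j"] q by (simp add: add_pos_pos)
        qed (use h q s0 k0 \<kappa> kb in auto)
      next
        assume q: "\<forall>i. q i \<in> {0<..1}"
        show "(\<integral>\<^sup>+x. indicator {-L..L} x * (SUP i. ennreal ((cmod (disp_int h (\<Gamma> x (q i)) (q i) (q i powr \<gamma>)))\<^sup>2)) \<partial>lborel)
          \<le> ennreal (\<kappa> * (LINT \<xi>|lborel. (1 + \<xi>\<^sup>2) powr s * (cmod (h \<xi>))\<^sup>2))"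
        proof (rule maximal_bound[where Y="\<lambda>i x. \<Gamma> x (q i)" and b=q and \<tau>="\<lambda>i. q i powr \<gamma>" and k=k])
          show "(\<lambda>x. \<Gamma> x (q i)) \<in> borel_measurable borel" for i
          proof (rule borel_measurable_continuous_onI[OF admissible_curve_continuous(2)[OF adm]])
            show "q i \<in> {-1..1}" using q[rule_format, of i] by auto
          qed
          show "0 < q i powr \<gamma>" for i using q[rule_format, of i] by simp
          show "norm (dispersive_kernel s (\<Gamma> x (q i) - \<Gamma> x' (q j)) (q i - q j) (q i powr \<gamma> + q j powr \<gamma>)) \<le> k \<bar>x - x'\<bar>" if "x \<noteq> x'" for x x' i j
            using q by (intro order_trans[OF K1[OF that] k1]) auto
        qed (use h s0 k0 \<kappa> kb in auto)
      }
    qed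
  qed
  show "(\<integral>\<^sup>+x. indicator {-L..L} x * (SUP i. ennreal ((cmod (disp_int g x 0 (q i)))\<^sup>2)) \<partial>lborel) < \<infinity>"
    if q0: "\<And>i. 0 < q i" for L and q :: "nat \<Rightarrow> real"
  proof -
    obtain \<kappa> where "(\<integral>\<^sup>+x. indicator {-L..L} x * (SUP i. ennreal ((cmod (disp_int g x 0 (q i)))\<^sup>2)) \<partial>lborel)
        \<le> ennreal (\<kappa> * (LINT \<xi>|lborel. (1 + \<xi>\<^sup>2) powr s * (cmod (g \<xi>))\<^sup>2))"
      using heat[of L] g N q0 unfolding PB_def by blast
    from order_le_less_trans[OF this] show ?thesis by simp
  qed
  \<comment> \<open>Rational times keep the maximal functions measurable; continuity in time
    recovers the others.\<close>
  define T where "T = (\<rat> \<inter> {0<..1} :: real set)"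
  have "1 \<in> T" by (simp add: T_def)
  then have Tne: "T \<noteq> {}" by blast
  have Tc: "countable T" unfolding T_def using countable_rat by (rule countable_subset[rotated]) auto
  define q where "q = from_nat_into T"
  have qr: "range q = T" unfolding q_def by (rule range_from_nat_into[OF Tne Tc])
  then have qT: "q i \<in> T" for i by auto
  then have q: "\<forall>i. q i \<in> {0<..1}" "\<forall>i. 0 < q i" by (auto simp: T_def)
  define h where "h = (\<lambda>n::nat. \<lambda>\<xi>. indicator (- {- real n..real n}) \<xi> * g \<xi>)"
  have hm[measurable]: "h n \<in> borel_measurable borel" for n unfolding h_def by measurable
  have hN: "integrable lborel (\<lambda>\<xi>. (1 + \<xi>\<^sup>2) powr s * (cmod (h n \<xi>))\<^sup>2)" for n
    by (rule Bochner_Integration.integrable_bound[OF N]) (auto simp: h_def indicator_def)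
  have h2: "integrable lborel (\<lambda>\<xi>. (cmod (h n \<xi>))\<^sup>2)" for n
    by (rule weighted_imp_square_integrable[OF hm _ hN]) (use s0 in simp)
  define V where "V = (\<lambda>n x t. disp_int (h n) (\<Gamma> x t) t (t powr \<gamma>))"
  define H where "H = (\<lambda>n x t. disp_int (h n) x 0 t)"
  \<comment> \<open>Adding the two maximal functions lets a single \<open>n\<close> work for both
    flows at a given point.\<close>
  define M where "M = (\<lambda>L n x. indicator {- L..L} x * ((SUP i. ennreal ((cmod (V n x (q i)))\<^sup>2)) + (SUP i. ennreal ((cmod (H n x (q i)))\<^sup>2))))"
  have \<Gamma>m[measurable]: "(\<lambda>x. \<Gamma> x (q i)) \<in> borel_measurable borel" for i
  proof (rule borel_measurable_continuous_onI[OF admissible_curve_continuous(2)[OF adm]])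
    show "q i \<in> {-1..1}" using q(1)[rule_format, of i] by auto
  qed
  have VHm[measurable]: "(\<lambda>x. V n x (q i)) \<in> borel_measurable borel" "(\<lambda>x. H n x (q i)) \<in> borel_measurable borel" for n i
    unfolding V_def H_def by measurable
  have Mm[measurable]: "M L n \<in> borel_measurable borel" for L n unfolding M_def by measurable
  \<comment> \<open>The integrals of \<open>M L n\<close> tend to 0, so Fatou's lemma gives the
    lower limit 0. This is enough: at each point one suitable \<open>n\<close> is needed for each
    tolerance.\<close>
  have lim0: "AE x in lborel. liminf (\<lambda>n. M L n x) = 0" for L
  proof -
    obtain \<kappa> where \<kappa>: "\<kappa> > 0" and PB: "PB L \<kappa>" using heat[of L] by blast
    have mb: "(\<integral>\<^sup>+x. indicator {-L..L} x * (SUP i. ennreal ((cmod (disp_int h x 0 (q i)))\<^sup>2)) \<partial>lborel)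
        \<le> ennreal (\<kappa> * (LINT \<xi>|lborel. (1 + \<xi>\<^sup>2) powr s * (cmod (h \<xi>))\<^sup>2)) \<and>
     (\<integral>\<^sup>+x. indicator {-L..L} x * (SUP i. ennreal ((cmod (disp_int h (\<Gamma> x (q i)) (q i) (q i powr \<gamma>)))\<^sup>2)) \<partial>lborel)
        \<le> ennreal (\<kappa> * (LINT \<xi>|lborel. (1 + \<xi>\<^sup>2) powr s * (cmod (h \<xi>))\<^sup>2))"
      if "h \<in> borel_measurable borel" "integrable lborel (\<lambda>\<xi>. (1 + \<xi>\<^sup>2) powr s * (cmod (h \<xi>))\<^sup>2)" for h :: "real \<Rightarrow> complex"
      using PB[unfolded PB_def, THEN spec, THEN mp, THEN mp, OF that] q by simp
    define e where "e = (\<lambda>n. \<kappa> * (LINT \<xi>|lborel. (1 + \<xi>\<^sup>2) powr s * (cmod (h n \<xi>))\<^sup>2))"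
    have e0: "e n \<ge> 0" for n unfolding e_def using \<kappa> by (intro mult_nonneg_nonneg Bochner_Integration.integral_nonneg) auto
    have Me0: "(\<integral>\<^sup>+x. M L n x \<partial>lborel) \<le> ennreal (e n) + ennreal (e n)" for n
    proof -
      have "(\<integral>\<^sup>+x. M L n x \<partial>lborel) = (\<integral>\<^sup>+x. indicator {- L..L} x * (SUP i. ennreal ((cmod (V n x (q i)))\<^sup>2)) \<partial>lborel) + (\<integral>\<^sup>+x. indicator {- L..L} x * (SUP i. ennreal ((cmod (H n x (q i)))\<^sup>2)) \<partial>lborel)"
        unfolding M_def distrib_left by (rule nn_integral_add) measurable
      also have "\<dots> \<le> ennreal (e n) + ennreal (e n)"
        using mb[OF hm hN, of n] unfolding V_def H_def e_def by (intro add_mono) auto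
      finally show ?thesis .
    qed
    have Me: "(\<integral>\<^sup>+x. M L n x \<partial>lborel) \<le> ennreal (2 * e n)" for n
    proof -
      have "ennreal (2 * e n) = ennreal (e n) + ennreal (e n)"
        unfolding mult_2 using e0[of n] by (intro ennreal_plus) auto
      then show ?thesis using Me0[of n] by (simp only:)
    qed
    have "e \<longlonglongrightarrow> \<kappa> * 0"
      unfolding e_def h_def by (intro tendsto_mult_left weighted_tail_tendsto_0[OF g N])
    then have "(\<lambda>n. ennreal (2 * e n)) \<longlonglongrightarrow> ennreal (2 * 0)"
      by (intro tendsto_ennrealI tendsto_mult_left) simp
    then have e2: "liminf (\<lambda>n. ennreal (2 * e n)) = 0" using lim_imp_Liminf[OF sequentially_bot] by fastforce
    have "(\<integral>\<^sup>+x. liminf (\<lambda>n. M L n x) \<partial>lborel) \<le> liminf (\<lambda>n. \<integral>\<^sup>+x. M L n x \<partial>lborel)"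
      by (rule nn_integral_liminf) measurable
    also have "\<dots> \<le> liminf (\<lambda>n. ennreal (2 * e n))" by (intro Liminf_mono always_eventually allI Me)
    finally have "(\<integral>\<^sup>+x. liminf (\<lambda>n. M L n x) \<partial>lborel) = 0" using e2 by simp
    then show ?thesis by (subst (asm) nn_integral_0_iff_AE) (simp_all)
  qed
  have "AE x in lborel. \<forall>L::nat. liminf (\<lambda>n. M (real L) n x) = 0"
    using lim0 by (simp add: AE_all_countable)
  then show "AE x in lborel. \<exists>l. ((\<lambda>t. disp_int g (\<Gamma> x t) t (t powr \<gamma>)) \<longlongrightarrow> l) (at_right 0) \<and>
      ((\<lambda>t. disp_int g x 0 t) \<longlongrightarrow> l) (at_right 0)"
  proof eventually_elim
    case (elim x)
    obtain L :: nat where L: "\<bar>x\<bar> \<le> real L" using real_arch_simple by blast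
    then have xL: "x \<in> {- real L..real L}" by auto
    have ev01: "\<forall>\<^sub>F t in at_right (0::real). t \<in> {0<..1}"
      by (rule eventually_at_rightI[of 0 1]) auto
    have small: "\<exists>n. (\<forall>t\<in>{0<..1}. cmod (V n x t) \<le> e) \<and> (\<forall>t\<in>{0<..1}. cmod (H n x t) \<le> e)" if e: "e > 0" for e
    proof -
      have "\<not> (\<forall>\<^sub>F n in sequentially. ennreal (e\<^sup>2) \<le> M (real L) n x)"
      proof
        assume "\<forall>\<^sub>F n in sequentially. ennreal (e\<^sup>2) \<le> M (real L) n x"
        then have "ennreal (e\<^sup>2) \<le> liminf (\<lambda>n. M (real L) n x)" by (rule Liminf_bounded)
        then show False using elim e by simp
      qed
      then obtain n where n: "M (real L) n x < ennreal (e\<^sup>2)"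
        by (meson always_eventually not_le)
      have Vq: "cmod (V n x (q i)) \<le> e" for i
      proof -
        have "ennreal ((cmod (V n x (q i)))\<^sup>2) \<le> (SUP i. ennreal ((cmod (V n x (q i)))\<^sup>2))" by (rule SUP_upper) simp
        also have "\<dots> \<le> M (real L) n x" using xL by (simp add: M_def)
        also have "\<dots> \<le> ennreal (e\<^sup>2)" using n by simp
        finally have "(cmod (V n x (q i)))\<^sup>2 \<le> e\<^sup>2" by simp
        then show ?thesis by (rule power2_le_imp_le) (use e in simp)
      qed
      have Hq: "cmod (H n x (q i)) \<le> e" for i
      proof -
        have "ennreal ((cmod (H n x (q i)))\<^sup>2) \<le> (SUP i. ennreal ((cmod (H n x (q i)))\<^sup>2))" by (rule SUP_upper) simp
        also have "\<dots> \<le> M (real L) n x" using xL by (simp add: M_def)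
        also have "\<dots> \<le> ennreal (e\<^sup>2)" using n by simp
        finally have "(cmod (H n x (q i)))\<^sup>2 \<le> e\<^sup>2" by simp
        then show ?thesis by (rule power2_le_imp_le) (use e in simp)
      qed
      have "cmod (V n x t) \<le> e" if t: "t \<in> {0<..1}" for t
      proof (rule continuous_le_of_rational_le[OF _ _ t])
        show "continuous_on {a..1} (\<lambda>t. cmod (V n x t))" if a: "0 < a" for a
          unfolding V_def
        proof (intro continuous_on_norm continuous_on_disp_int[OF hm h2, of "a powr \<gamma>"])
          show "continuous_on {a..1} (\<Gamma> x)" using a by (intro continuous_on_subset[OF admissible_curve_continuous(1)[OF adm]]) auto
          show "continuous_on {a..1} (\<lambda>t. t powr \<gamma>)" using a by (intro continuous_intros) auto
          show "a powr \<gamma> \<le> t powr \<gamma>" if "t \<in> {a..1}" for t using that a \<gamma> by (intro powr_mono2) auto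
        qed (use a in auto)
        fix r :: real assume "r \<in> \<rat> \<inter> {0<..1}"
        then show "cmod (V n x r) \<le> e" using qr Vq unfolding T_def by (metis rangeE)
      qed
      moreover have "cmod (H n x t) \<le> e" if t: "t \<in> {0<..1}" for t
      proof (rule continuous_le_of_rational_le[OF _ _ t])
        show "continuous_on {a..1} (\<lambda>t. cmod (H n x t))" if a: "0 < a" for a
          unfolding H_def by (intro continuous_on_norm continuous_on_disp_int[OF hm h2 a] continuous_intros) auto
        fix r :: real assume "r \<in> \<rat> \<inter> {0<..1}"
        then show "cmod (H n x r) \<le> e" using qr Hq unfolding T_def by (metis rangeE)
      qed
      ultimately show ?thesis by blast
    qed
    show ?case
    proof (rule common_limit[of "at_right (0::real)" "\<lambda>t. disp_int g (\<Gamma> x t) t (t powr \<gamma>)" "\<lambda>t. disp_int g x 0 t"])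
      show "at_right (0::real) \<noteq> bot" by simp
      fix e :: real assume e: "e > 0"
      then have "e / 3 > 0" by simp
      from small[OF this] obtain n where n: "\<forall>t\<in>{0<..1}. cmod (V n x t) \<le> e / 3" "\<forall>t\<in>{0<..1}. cmod (H n x t) \<le> e / 3" by blast
      let ?g = "\<lambda>\<xi>. indicator {- real n..real n} \<xi> * g \<xi>"
      have gi: "integrable lborel ?g" by (rule integrable_truncation[OF g g2])
      have t1: "((\<lambda>t. disp_int ?g (\<Gamma> x t) t (t powr \<gamma>)) \<longlongrightarrow> disp_int ?g x 0 0) (at_right 0)"
      proof (rule disp_int_tendsto_at_right[OF gi admissible_curve_continuous(3)[OF adm]])
        have "((\<lambda>t. t powr \<gamma>) \<longlongrightarrow> 0 powr \<gamma>) (at_right (0::real))"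
          using \<gamma> by (intro tendsto_powr2 tendsto_intros) (auto simp: eventually_at_filter)
        then show "((\<lambda>t::real. t powr \<gamma>) \<longlongrightarrow> 0) (at_right 0)" using \<gamma> by simp
      qed (auto intro!: tendsto_intros)
      have t2: "((\<lambda>t. disp_int ?g x 0 t) \<longlongrightarrow> disp_int ?g x 0 0) (at_right 0)"
        by (rule disp_int_tendsto_at_right[OF gi]) (auto intro!: tendsto_intros)
      have "\<forall>\<^sub>F t in at_right 0. dist (disp_int ?g (\<Gamma> x t) t (t powr \<gamma>)) (disp_int ?g x 0 0) < e / 3"
        using t1 e by (intro tendstoD) auto
      moreover have "\<forall>\<^sub>F t in at_right 0. dist (disp_int ?g x 0 t) (disp_int ?g x 0 0) < e / 3"
        using t2 e by (intro tendstoD) auto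
      ultimately show "\<exists>c. \<forall>\<^sub>F t in at_right 0. dist (disp_int g (\<Gamma> x t) t (t powr \<gamma>)) c < e \<and> dist (disp_int g x 0 t) c < e"
        using ev01
      proof (intro exI[of _ "disp_int ?g x 0 0"], eventually_elim)
        case (elim t)
        have "disp_int g (\<Gamma> x t) t (t powr \<gamma>) = disp_int ?g (\<Gamma> x t) t (t powr \<gamma>) + V n x t"
          unfolding V_def h_def using elim by (intro disp_int_split[OF g _ g2]) auto
        moreover have "disp_int g x 0 t = disp_int ?g x 0 t + H n x t"
          unfolding H_def h_def using elim by (intro disp_int_split[OF g _ g2]) auto
        moreover have "cmod (V n x t) \<le> e / 3" "cmod (H n x t) \<le> e / 3" using n elim by auto
        ultimately show ?case using elim e
            norm_triangle_ineq[of "disp_int ?g (\<Gamma> x t) t (t powr \<gamma>) - disp_int ?g x 0 0" "V n x t"]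
            norm_triangle_ineq[of "disp_int ?g x 0 t - disp_int ?g x 0 0" "H n x t"]
          by (simp add: dist_norm algebra_simps)
      qed
    qed blast
  qed
qed

text \<open>The multiplication formula: it holds for truncations of \<open>f\<close> by Fubini and passes to the
  limit because the Gaussian side is square integrable.\<close>

lemma heat_extension_eq:
  assumes F: "fourier_L2 f g" and \<tau>: "\<tau> > 0"
  shows "disp_int g x 0 \<tau> = (LINT u|lborel. complex_of_real (sqrt (pi / \<tau>) * exp (- (x - u)\<^sup>2 / (4 * \<tau>))) * f u)"
proof -
  have [measurable]: "f \<in> borel_measurable borel" and f2: "integrable lborel (\<lambda>x. (cmod (f x))\<^sup>2)"
    and gm[measurable]: "g \<in> borel_measurable borel" and g2: "integrable lborel (\<lambda>x. (cmod (g x))\<^sup>2)"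
    using F by (auto simp: fourier_L2_def square_integrable_def)
  define fn where "fn = (\<lambda>n::nat. \<lambda>u. indicator {- real n..real n} u * f u)"
  define \<phi> where "\<phi> = (\<lambda>\<xi>. disp x 0 \<tau> \<xi>)"
  define gn where "gn = (\<lambda>n::nat. \<lambda>\<xi>. LINT u|lborel. cis (- (u * \<xi>)) * fn n u)"
  define G where "G = (\<lambda>u. complex_of_real (sqrt (pi / \<tau>) * exp (- (x - u)\<^sup>2 / (4 * \<tau>))))"
  have [measurable]: "fn n \<in> borel_measurable borel" for n unfolding fn_def by measurable
  have [measurable]: "\<phi> \<in> borel_measurable borel" unfolding \<phi>_def by measurable
  have [measurable]: "G \<in> borel_measurable borel" unfolding G_def by measurable
  have [measurable]: "gn n \<in> borel_measurable borel" for n unfolding gn_def by measurable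
  have fi: "integrable lborel (fn n)" for n unfolding fn_def by (rule integrable_truncation[OF _ f2]) measurable
  have n\<phi>: "norm (\<phi> \<xi>) = exp (- \<tau> * \<xi>\<^sup>2)" for \<xi> by (simp add: \<phi>_def norm_disp)
  have \<phi>i: "integrable lborel (\<lambda>\<xi>. norm (\<phi> \<xi>))" unfolding n\<phi> by (rule gaussian_integrable[OF \<tau>])
  have gne: "gn n \<xi> = (LINT u:{- real n..real n}|lborel. cis (- (u * \<xi>)) * f u)" for n \<xi>
    unfolding gn_def fn_def set_lebesgue_integral_def
    by (intro Bochner_Integration.integral_cong) (auto simp: indicator_def)
  have gnb: "norm (gn n \<xi>) \<le> (LINT u|lborel. norm (fn n u))" for n \<xi>
    unfolding gn_def by (rule order_trans[OF integral_norm_bound]) (simp add: norm_mult)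
  have Gi: "integrable lborel (\<lambda>u. complex_of_real (sqrt (pi / \<tau>) * exp (- (x - u)\<^sup>2 / (4 * \<tau>))) * f u)"
  proof -
    have "integrable lborel (\<lambda>u. exp (- (1 / (4 * \<tau>)) * u\<^sup>2) * cmod (f (x + 1 * u)))"
    proof (rule integrable_gaussian_mult)
      show "integrable lborel (\<lambda>u. (cmod (f (x + 1 * u)))\<^sup>2)" using lborel_integrable_real_affine[OF f2, of 1 x] by simp
    qed (use \<tau> in auto)
    then have "integrable lborel (\<lambda>u. exp (- (1 / (4 * \<tau>)) * (- x + 1 * u)\<^sup>2) * cmod (f (x + 1 * (- x + 1 * u))))"
      by (rule lborel_integrable_real_affine) simp
    then have "integrable lborel (\<lambda>u. exp (- (x - u)\<^sup>2 / (4 * \<tau>)) * cmod (f u))"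
      by (simp add: power2_commute[of x])
    then have "integrable lborel (\<lambda>u. sqrt (pi / \<tau>) * (exp (- (x - u)\<^sup>2 / (4 * \<tau>)) * cmod (f u)))" by simp
    then show ?thesis
      by (rule Bochner_Integration.integrable_bound) (use \<tau> in \<open>auto simp: norm_mult abs_mult\<close>)
  qed
  have A: "(LINT \<xi>|lborel. \<phi> \<xi> * gn n \<xi>) = (LINT u|lborel. G u * fn n u)" for n
  proof -
    have Hi: "integrable (lborel \<Otimes>\<^sub>M lborel) (\<lambda>(u, \<xi>). \<phi> \<xi> * (cis (- (u * \<xi>)) * fn n u))"
    proof (rule Bochner_Integration.integrable_bound)
      show "integrable (lborel \<Otimes>\<^sub>M lborel) (\<lambda>(u, \<xi>). norm (fn n u) * norm (\<phi> \<xi>))"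
        by (intro integrable_pair_mult \<phi>i) (use fi[of n] in simp)
      show "(\<lambda>(u, \<xi>). \<phi> \<xi> * (cis (- (u * \<xi>)) * fn n u)) \<in> borel_measurable (lborel \<Otimes>\<^sub>M lborel)" by measurable
    qed (auto simp: norm_mult)
    have "(LINT \<xi>|lborel. \<phi> \<xi> * gn n \<xi>) = (LINT \<xi>|lborel. (LINT u|lborel. \<phi> \<xi> * (cis (- (u * \<xi>)) * fn n u)))"
      unfolding gn_def by simp
    also have "\<dots> = (LINT u|lborel. (LINT \<xi>|lborel. \<phi> \<xi> * (cis (- (u * \<xi>)) * fn n u)))"
      by (rule lborel_pair.Fubini_integral[OF Hi])
    also have "\<dots> = (LINT u|lborel. G u * fn n u)"
    proof (rule Bochner_Integration.integral_cong[OF refl])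
      fix u
      have "\<phi> \<xi> * (cis (- (u * \<xi>)) * fn n u) = fn n u * (cis ((x - u) * \<xi>) * complex_of_real (exp (- \<tau> * \<xi>\<^sup>2)))" for \<xi>
      proof -
        have "cis (x * \<xi>) * cis (- (u * \<xi>)) = cis ((x - u) * \<xi>)" by (simp add: cis_mult algebra_simps)
        then show ?thesis by (simp add: \<phi>_def disp_def mult_ac)
      qed
      then have "(LINT \<xi>|lborel. \<phi> \<xi> * (cis (- (u * \<xi>)) * fn n u)) = fn n u * (LINT \<xi>|lborel. cis ((x - u) * \<xi>) * complex_of_real (exp (- \<tau> * \<xi>\<^sup>2)))"
        by (simp only: integral_mult_right_zero)
      also have "\<dots> = G u * fn n u" unfolding gaussian_fourier_real[OF \<tau>] G_def by (rule mult.commute)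
      finally show "(LINT \<xi>|lborel. \<phi> \<xi> * (cis (- (u * \<xi>)) * fn n u)) = G u * fn n u" .
    qed
    finally show ?thesis .
  qed
  have B: "(\<lambda>n. LINT u|lborel. G u * fn n u) \<longlonglongrightarrow> (LINT u|lborel. G u * f u)"
  proof (rule integral_dominated_convergence)
    show "integrable lborel (\<lambda>u. norm (G u * f u))" using Gi by (intro integrable_norm) (simp add: G_def)
    show "AE u in lborel. (\<lambda>n. G u * fn n u) \<longlonglongrightarrow> G u * f u"
    proof (rule AE_I2)
      fix u :: real
      have "eventually (\<lambda>n. G u * fn n u = G u * f u) sequentially"
        using eventually_in_Icc_nat[of u] by eventually_elim (simp add: fn_def)
      then show "(\<lambda>n. G u * fn n u) \<longlonglongrightarrow> G u * f u" by (rule tendsto_eventually)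
    qed
    show "AE u in lborel. norm (G u * fn n u) \<le> norm (G u * f u)" for n
      by (intro AE_I2) (auto simp: fn_def indicator_def)
  qed measurable
  have C: "(\<lambda>n. LINT \<xi>|lborel. \<phi> \<xi> * gn n \<xi>) \<longlonglongrightarrow> disp_int g x 0 \<tau>"
  proof -
    define d where "d = (\<lambda>n. \<integral>\<^sup>+\<xi>. ennreal ((cmod (g \<xi> - gn n \<xi>))\<^sup>2) \<partial>lborel)"
    have "((\<lambda>R. \<integral>\<^sup>+ \<xi>. ennreal ((cmod (g \<xi> - (LINT x:{-R..R}|lborel. cis (- (x * \<xi>)) * f x)))\<^sup>2) \<partial>lborel) \<longlongrightarrow> 0) at_top"
      using F by (simp add: fourier_L2_def)
    then have "((\<lambda>n::nat. \<integral>\<^sup>+ \<xi>. ennreal ((cmod (g \<xi> - (LINT x:{-real n..real n}|lborel. cis (- (x * \<xi>)) * f x)))\<^sup>2) \<partial>lborel) \<longlongrightarrow> 0) sequentially"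
      by (rule filterlim_compose[OF _ filterlim_real_sequentially])
    then have d0: "d \<longlonglongrightarrow> 0" unfolding d_def gne .
    define E where "E = (\<integral>\<^sup>+\<xi>. (ennreal (norm (\<phi> \<xi>)))\<^sup>2 \<partial>lborel)"
    have Efin: "E < \<infinity>"
    proof -
      have "E = (\<integral>\<^sup>+\<xi>. ennreal (exp (- (2 * \<tau>) * \<xi>\<^sup>2)) \<partial>lborel)"
        unfolding E_def n\<phi> by (intro nn_integral_cong) (simp add: power2_eq_square mult_exp_exp ennreal_mult[symmetric])
      also have "\<dots> < \<infinity>" using gaussian_integrable[of "2 * \<tau>"] \<tau> by (auto simp: integrable_iff_bounded)
      finally show ?thesis .
    qed
    have dist: "(ennreal (norm (disp_int g x 0 \<tau> - (LINT \<xi>|lborel. \<phi> \<xi> * gn n \<xi>))))\<^sup>2 \<le> E * d n" for n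
    proof -
      have i1: "integrable lborel (\<lambda>\<xi>. \<phi> \<xi> * g \<xi>)" unfolding \<phi>_def by (rule integrable_disp_mult[OF gm g2 \<tau>])
      have i2: "integrable lborel (\<lambda>\<xi>. \<phi> \<xi> * gn n \<xi>)"
      proof (rule Bochner_Integration.integrable_bound)
        show "integrable lborel (\<lambda>\<xi>. norm (\<phi> \<xi>) * (LINT u|lborel. norm (fn n u)))" using \<phi>i by simp
        show "AE \<xi> in lborel. norm (\<phi> \<xi> * gn n \<xi>) \<le> norm (norm (\<phi> \<xi>) * (LINT u|lborel. norm (fn n u)))"
          using gnb[of n] by (intro AE_I2) (auto simp: norm_mult abs_mult intro!: mult_left_mono order_trans[OF gnb abs_ge_self])
      qed measurable
      have "ennreal (norm (disp_int g x 0 \<tau> - (LINT \<xi>|lborel. \<phi> \<xi> * gn n \<xi>))) = ennreal (norm (LINT \<xi>|lborel. \<phi> \<xi> * g \<xi> - \<phi> \<xi> * gn n \<xi>))"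
        using i1 i2 by (simp add: disp_int_def \<phi>_def)
      also have "\<dots> \<le> (\<integral>\<^sup>+\<xi>. ennreal (norm (\<phi> \<xi> * g \<xi> - \<phi> \<xi> * gn n \<xi>)) \<partial>lborel)"
        by (rule norm_integral_le_nn_integral)
      also have "\<dots> = (\<integral>\<^sup>+\<xi>. ennreal (norm (\<phi> \<xi>)) * ennreal (norm (g \<xi> - gn n \<xi>)) \<partial>lborel)"
        by (simp add: right_diff_distrib[symmetric] norm_mult ennreal_mult)
      finally have "(ennreal (norm (disp_int g x 0 \<tau> - (LINT \<xi>|lborel. \<phi> \<xi> * gn n \<xi>))))\<^sup>2 \<le>
        (\<integral>\<^sup>+\<xi>. ennreal (norm (\<phi> \<xi>)) * ennreal (norm (g \<xi> - gn n \<xi>)) \<partial>lborel)\<^sup>2" by (intro power_mono) auto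
      also have "\<dots> \<le> E * (\<integral>\<^sup>+\<xi>. (ennreal (norm (g \<xi> - gn n \<xi>)))\<^sup>2 \<partial>lborel)"
        unfolding E_def by (rule Cauchy_Schwarz_nn_integral) measurable
      also have "(\<integral>\<^sup>+\<xi>. (ennreal (norm (g \<xi> - gn n \<xi>)))\<^sup>2 \<partial>lborel) = d n"
        by (simp add: d_def ennreal_power)
      finally show ?thesis .
    qed
    have "(\<lambda>n. E * d n) \<longlonglongrightarrow> E * 0" using Efin d0 by (intro ennreal_tendsto_cmult) auto
    then have "(\<lambda>n. (ennreal (norm (disp_int g x 0 \<tau> - (LINT \<xi>|lborel. \<phi> \<xi> * gn n \<xi>))))\<^sup>2) \<longlonglongrightarrow> 0"
      by (intro tendsto_sandwich[OF _ always_eventually[OF allI[OF dist]] tendsto_const]) auto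
    then have "(\<lambda>n. ennreal ((norm (disp_int g x 0 \<tau> - (LINT \<xi>|lborel. \<phi> \<xi> * gn n \<xi>)))\<^sup>2)) \<longlonglongrightarrow> ennreal 0"
      by (simp add: ennreal_power)
    then have "(\<lambda>n. (norm (disp_int g x 0 \<tau> - (LINT \<xi>|lborel. \<phi> \<xi> * gn n \<xi>)))\<^sup>2) \<longlonglongrightarrow> 0"
      by (subst (asm) tendsto_ennreal_iff) auto
    then have "(\<lambda>n. sqrt ((norm (disp_int g x 0 \<tau> - (LINT \<xi>|lborel. \<phi> \<xi> * gn n \<xi>)))\<^sup>2)) \<longlonglongrightarrow> sqrt 0"
      by (intro tendsto_real_sqrt)
    then have "(\<lambda>n. disp_int g x 0 \<tau> - (LINT \<xi>|lborel. \<phi> \<xi> * gn n \<xi>)) \<longlonglongrightarrow> 0"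
      by (simp add: tendsto_norm_zero_iff)
    then have "(\<lambda>n. disp_int g x 0 \<tau> - (disp_int g x 0 \<tau> - (LINT \<xi>|lborel. \<phi> \<xi> * gn n \<xi>))) \<longlonglongrightarrow> disp_int g x 0 \<tau> - 0"
      by (intro tendsto_diff tendsto_const)
    then show ?thesis by simp
  qed
  show "disp_int g x 0 \<tau> = (LINT u|lborel. complex_of_real (sqrt (pi / \<tau>) * exp (- (x - u)\<^sup>2 / (4 * \<tau>))) * f u)"
    using LIMSEQ_unique[OF C] B by (simp only: A) (simp add: G_def)
qed

text \<open>The substitution \<open>u = x + sqrt \<tau> * z\<close> fixes the averaging density, a
  Gaussian of total mass 1, and puts the scale into the argument of \<open>f\<close>.\<close>

lemma heat_average:
  assumes F: "fourier_L2 f g" and \<tau>: "\<tau> > 0"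
  shows "complex_of_real (1 / (2 * pi)) * disp_int g x 0 \<tau> =
      (LINT z|lborel. complex_of_real (exp (- (1/4) * z\<^sup>2) / (2 * sqrt pi)) * f (x + sqrt \<tau> * z))"
proof -
  have "disp_int g x 0 \<tau> = (LINT u|lborel. complex_of_real (sqrt (pi / \<tau>) * exp (- (x - u)\<^sup>2 / (4 * \<tau>))) * f u)"
    by (rule heat_extension_eq[OF assms])
  also have "\<dots> = sqrt \<tau> *\<^sub>R (LINT z|lborel. complex_of_real (sqrt (pi / \<tau>) * exp (- (x - (x + sqrt \<tau> * z))\<^sup>2 / (4 * \<tau>))) * f (x + sqrt \<tau> * z))"
    using \<tau> by (subst lborel_integral_real_affine[where c="sqrt \<tau>" and t=x]) auto
  finally have "complex_of_real (1 / (2 * pi)) * disp_int g x 0 \<tau> =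
     (LINT z|lborel. complex_of_real (sqrt \<tau> / (2 * pi)) * (complex_of_real (sqrt (pi / \<tau>) * exp (- (x - (x + sqrt \<tau> * z))\<^sup>2 / (4 * \<tau>))) * f (x + sqrt \<tau> * z)))"
    by (simp only: integral_mult_right_zero scaleR_conv_of_real) simp
  also have "\<dots> = (LINT z|lborel. complex_of_real (exp (- (1/4) * z\<^sup>2) / (2 * sqrt pi)) * f (x + sqrt \<tau> * z))"
  proof (rule Bochner_Integration.integral_cong[OF refl])
    fix z
    have "sqrt \<tau> / (2 * pi) * (sqrt (pi / \<tau>) * exp (- (x - (x + sqrt \<tau> * z))\<^sup>2 / (4 * \<tau>))) = exp (- (1/4) * z\<^sup>2) / (2 * sqrt pi)"
    proof -
      have "sqrt \<tau> / (2 * pi) * (sqrt pi / sqrt \<tau>) = (sqrt pi / pi) / 2"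
        using \<tau> by (subst times_divide_times_eq) (simp add: mult.commute)
      then have "sqrt \<tau> / (2 * pi) * sqrt (pi / \<tau>) = (sqrt pi / pi) / 2"
        by (simp only: real_sqrt_divide)
      also have "sqrt pi / pi = inverse (sqrt pi)" by (rule sqrt_divide_self_eq) simp
      finally have "sqrt \<tau> / (2 * pi) * sqrt (pi / \<tau>) = 1 / (2 * sqrt pi)" by (simp add: inverse_eq_divide)
      moreover have "- (x - (x + sqrt \<tau> * z))\<^sup>2 / (4 * \<tau>) = - (1/4) * z\<^sup>2"
        using \<tau> by (simp add: power_mult_distrib)
      ultimately show ?thesis by (simp only: mult.assoc[symmetric]) (simp only: times_divide_eq_left mult_1)
    qed
    then show "complex_of_real (sqrt \<tau> / (2 * pi)) * (complex_of_real (sqrt (pi / \<tau>) * exp (- (x - (x + sqrt \<tau> * z))\<^sup>2 / (4 * \<tau>))) * f (x + sqrt \<tau> * z)) =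
      complex_of_real (exp (- (1/4) * z\<^sup>2) / (2 * sqrt pi)) * f (x + sqrt \<tau> * z)"
      by (simp only: mult.assoc[symmetric] of_real_mult[symmetric])
  qed
  finally show ?thesis .
qed

text \<open>By Fubini the left side is the average of \<open>\<Phi> (\<epsilon> n * z)\<close>
  against a probability density, where \<Phi> integrates a translate of \<open>f\<close> over the
  interval. Boundedness of \<Phi> and its continuity at 0 suffice, so the averages need not converge
  pointwise.\<close>

lemma gaussian_average_interval_limit:
  fixes f :: "real \<Rightarrow> complex" and \<epsilon> :: "nat \<Rightarrow> real"
  assumes [measurable]: "f \<in> borel_measurable borel" and f2: "integrable lborel (\<lambda>x. (cmod (f x))\<^sup>2)"
    and \<epsilon>: "\<epsilon> \<longlonglongrightarrow> 0" "\<And>n. \<bar>\<epsilon> n\<bar> \<le> 1"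
  shows "(\<lambda>n. LINT x|lborel. indicator {a..b} x * (LINT z|lborel. complex_of_real (exp (- (1/4) * z\<^sup>2) / (2 * sqrt pi)) * f (x + \<epsilon> n * z)))
     \<longlonglongrightarrow> (LINT x|lborel. indicator {a..b} x * f x)"
proof -
  define \<rho> where "\<rho> = (\<lambda>z::real. exp (- (1/4) * z\<^sup>2) / (2 * sqrt pi))"
  define \<Phi> where "\<Phi> = (\<lambda>h. LINT x|lborel. indicator {a..b} x * f (x + h))"
  \<comment> \<open>Bounds \<Phi> uniformly by way of
    \<open>cmod (f y) \<le> 1 + (cmod (f y))\<^sup>2\<close>, since \<open>f\<close> is only square
    integrable.\<close>
  define B where "B = (LINT x|lborel. indicator {a..b} x) + (LINT x|lborel. (cmod (f x))\<^sup>2)"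
  have [measurable]: "\<rho> \<in> borel_measurable borel" unfolding \<rho>_def by measurable
  have \<rho>0: "\<rho> z > 0" for z by (simp add: \<rho>_def)
  have \<rho>i: "integrable lborel \<rho>" unfolding \<rho>_def using gaussian_integrable[of "1/4"] by simp
  have "(LINT z|lborel. \<rho> z) = sqrt (pi / (1/4)) / (2 * sqrt pi)"
    unfolding \<rho>_def using gaussian_integral[of "1/4"] by simp
  also have "\<dots> = 1" by (simp add: real_sqrt_mult)
  finally have \<rho>1: "(LINT z|lborel. \<rho> z) = 1" .
  have indi: "integrable lborel (\<lambda>x. indicator {a..b} x :: real)"
    by (intro integrable_real_indicator) (auto simp: emeasure_lborel_Icc_eq)
  have fh: "integrable lborel (\<lambda>x. (cmod (f (x + h)))\<^sup>2)" for h
    using lborel_integrable_real_affine[OF f2, of 1 h] by (simp add: add.commute)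
  have fh_eq: "(LINT x|lborel. (cmod (f (x + h)))\<^sup>2) = (LINT x|lborel. (cmod (f x))\<^sup>2)" for h
    by (subst (2) lborel_integral_real_affine[where c=1 and t=h]) (auto simp: add.commute)
  have pt: "norm (indicator {a..b} x * f y) \<le> indicator {a..b} x + (cmod (f y))\<^sup>2" for x y
  proof -
    have "0 \<le> (cmod (f y) - 1)\<^sup>2 + 1 + (cmod (f y))\<^sup>2" by simp
    then have "cmod (f y) \<le> 1 + (cmod (f y))\<^sup>2" by (simp add: power2_eq_square algebra_simps)
    then show ?thesis by (simp add: indicator_def)
  qed
  have ifh: "integrable lborel (\<lambda>x. indicator {a..b} x * f (x + h))" for h
  proof (rule Bochner_Integration.integrable_bound)
    show "integrable lborel (\<lambda>x. indicator {a..b} x + (cmod (f (x + h)))\<^sup>2)" using indi fh by simp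
    show "AE x in lborel. norm (indicator {a..b} x * f (x + h)) \<le> norm (indicator {a..b} x + (cmod (f (x + h)))\<^sup>2)"
      using pt by (intro AE_I2) (auto intro: order_trans[OF _ abs_ge_self])
  qed measurable
  have nB: "(LINT x|lborel. norm (indicator {a..b} x * f (x + h))) \<le> B" for h
  proof -
    have "(LINT x|lborel. norm (indicator {a..b} x * f (x + h))) \<le> (LINT x|lborel. indicator {a..b} x + (cmod (f (x + h)))\<^sup>2)"
      using ifh[of h] indi fh[of h] by (intro integral_mono pt) (auto intro: integrable_norm)
    also have "\<dots> = B" using indi fh[of h] by (simp add: B_def fh_eq)
    finally show ?thesis .
  qed
  have \<Phi>B: "norm (\<Phi> h) \<le> B" for h
    unfolding \<Phi>_def by (rule order_trans[OF integral_norm_bound nB])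
  have [measurable]: "\<Phi> \<in> borel_measurable borel" unfolding \<Phi>_def by measurable
  have \<Phi>lim: "(\<lambda>n. \<Phi> (u n)) \<longlonglongrightarrow> \<Phi> 0" if u: "u \<longlonglongrightarrow> 0" "\<And>n. \<bar>u n\<bar> \<le> H" for u :: "nat \<Rightarrow> real" and H
  proof -
    \<comment> \<open>Moving the translation from \<open>f\<close> to the interval reduces
      continuity to that of an indicator away from the two endpoints.\<close>
    have \<Phi>e: "\<Phi> h = (LINT y|lborel. indicator {a..b} (y - h) * f y)" for h
      unfolding \<Phi>_def by (subst (2) lborel_integral_real_affine[where c=1 and t=h]) (auto simp: add.commute)
    define R where "R = \<bar>a\<bar> + \<bar>b\<bar> + H"
    show ?thesis
      unfolding \<Phi>e
    proof (rule integral_dominated_convergence)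
      show "integrable lborel (\<lambda>y. norm (indicator {- R..R} y * f y))"
        by (intro integrable_norm integrable_truncation f2) measurable
      show "AE y in lborel. (\<lambda>n. indicator {a..b} (y - u n) * f y) \<longlonglongrightarrow> indicator {a..b} (y - 0) * f y"
        using AE_lborel_singleton[of a] AE_lborel_singleton[of b]
      proof eventually_elim
        case (elim y)
        have l: "(\<lambda>n. y - u n) \<longlonglongrightarrow> y - 0" by (intro tendsto_intros u)
        have "eventually (\<lambda>n. indicator {a..b} (y - u n) = (indicator {a..b} (y - 0) :: complex)) sequentially"
        proof (cases "y \<in> {a<..<b}")
          case True
          then have "eventually (\<lambda>n. y - u n \<in> {a<..<b}) sequentially" using l by (intro topological_tendstoD) auto
          then show ?thesis by eventually_elim (use True in \<open>auto simp: indicator_def\<close>)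
        next
          case False
          then have "y \<in> - {a..b}" using elim by auto
          then have "eventually (\<lambda>n. y - u n \<in> - {a..b}) sequentially" using l by (intro topological_tendstoD) auto
          then show ?thesis by eventually_elim (use False elim in \<open>auto simp: indicator_def\<close>)
        qed
        then have "(\<lambda>n. indicator {a..b} (y - u n) :: complex) \<longlonglongrightarrow> indicator {a..b} (y - 0)" by (rule tendsto_eventually)
        then show ?case by (intro tendsto_mult_right)
      qed
      show "AE y in lborel. norm (indicator {a..b} (y - u n) * f y) \<le> norm (indicator {- R..R} y * f y)" for n
        using u(2)[of n] by (intro AE_I2) (auto simp: indicator_def R_def)
    qed measurable
  qed
  have Fub: "(LINT x|lborel. indicator {a..b} x * (LINT z|lborel. complex_of_real (\<rho> z) * f (x + e * z))) = (LINT z|lborel. complex_of_real (\<rho> z) * \<Phi> (e * z))" for e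
  proof -
    define J where "J = (\<lambda>z x. complex_of_real (\<rho> z) * (indicator {a..b} x * f (x + e * z)))"
    have Ji: "integrable (lborel \<Otimes>\<^sub>M lborel) (case_prod J)"
    proof (rule lborel_pair.Fubini_integrable)
      show "case_prod J \<in> borel_measurable (lborel \<Otimes>\<^sub>M lborel)" unfolding J_def by measurable
      have eq: "(LINT x|lborel. norm (case (z, x) of (z, x) \<Rightarrow> J z x)) = \<rho> z * (LINT x|lborel. norm (indicator {a..b} x * f (x + e * z)))" for z
        using \<rho>0[of z] by (simp add: J_def norm_mult less_imp_le)
      show "integrable lborel (\<lambda>z. LINT x|lborel. norm (case (z, x) of (z, x) \<Rightarrow> J z x))"
        unfolding eq
      proof (rule Bochner_Integration.integrable_bound)
        show "integrable lborel (\<lambda>z. \<rho> z * B)" using \<rho>i by simp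
        show "AE z in lborel. norm (\<rho> z * (LINT x|lborel. norm (indicator {a..b} x * f (x + e * z)))) \<le> norm (\<rho> z * B)"
        proof (rule AE_I2)
          fix z
          have "0 \<le> (LINT x|lborel. norm (indicator {a..b} x * f (x + e * z)))" by (intro Bochner_Integration.integral_nonneg) simp
          then show "norm (\<rho> z * (LINT x|lborel. norm (indicator {a..b} x * f (x + e * z)))) \<le> norm (\<rho> z * B)"
            using nB[of "e * z"] unfolding real_norm_def abs_mult by (intro mult_left_mono) (linarith, simp)
        qed
      qed measurable
      show "AE z in lborel. integrable lborel (\<lambda>x. case (z, x) of (z, x) \<Rightarrow> J z x)"
        unfolding J_def using ifh by simp
    qed
    have "(LINT x|lborel. indicator {a..b} x * (LINT z|lborel. complex_of_real (\<rho> z) * f (x + e * z))) = (LINT x|lborel. (LINT z|lborel. J z x))"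
    proof (rule Bochner_Integration.integral_cong[OF refl])
      fix x
      have "(LINT z|lborel. J z x) = (LINT z|lborel. indicator {a..b} x * (complex_of_real (\<rho> z) * f (x + e * z)))"
        unfolding J_def by (simp only: mult.left_commute)
      then show "indicator {a..b} x * (LINT z|lborel. complex_of_real (\<rho> z) * f (x + e * z)) = (LINT z|lborel. J z x)"
        by (simp only: integral_mult_right_zero)
    qed
    also have "\<dots> = (LINT z|lborel. (LINT x|lborel. J z x))" by (rule lborel_pair.Fubini_integral[OF Ji])
    also have "\<dots> = (LINT z|lborel. complex_of_real (\<rho> z) * \<Phi> (e * z))"
      unfolding J_def \<Phi>_def by (simp only: integral_mult_right_zero)
    finally show ?thesis .
  qed
  have "(\<lambda>n. LINT z|lborel. complex_of_real (\<rho> z) * \<Phi> (\<epsilon> n * z)) \<longlonglongrightarrow> (LINT z|lborel. complex_of_real (\<rho> z) * \<Phi> 0)"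
  proof (rule integral_dominated_convergence)
    show "integrable lborel (\<lambda>z. \<rho> z * B)" using \<rho>i by simp
    show "AE z in lborel. norm (complex_of_real (\<rho> z) * \<Phi> (\<epsilon> n * z)) \<le> \<rho> z * B" for n
      using \<rho>0 by (intro AE_I2) (auto simp: norm_mult less_imp_le intro!: mult_mono \<Phi>B)
    show "AE z in lborel. (\<lambda>n. complex_of_real (\<rho> z) * \<Phi> (\<epsilon> n * z)) \<longlonglongrightarrow> complex_of_real (\<rho> z) * \<Phi> 0"
    proof (intro AE_I2 tendsto_mult_left)
      fix z :: real
      have "(\<lambda>n. \<epsilon> n * z) \<longlonglongrightarrow> 0 * z" by (intro tendsto_intros \<epsilon>)
      moreover have "\<bar>\<epsilon> n * z\<bar> \<le> \<bar>z\<bar>" for n using \<epsilon>(2)[of n] by (simp add: abs_mult mult_left_le_one_le)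
      ultimately show "(\<lambda>n. \<Phi> (\<epsilon> n * z)) \<longlonglongrightarrow> \<Phi> 0" by (intro \<Phi>lim) auto
    qed
  qed measurable
  also have "(LINT z|lborel. complex_of_real (\<rho> z) * \<Phi> 0) = \<Phi> 0"
    by (simp only: integral_mult_left_zero integral_complex_of_real \<rho>1 of_real_1 mult_1)
  also have "\<Phi> 0 = (LINT x|lborel. indicator {a..b} x * f x)" by (simp add: \<Phi>_def)
  finally show ?thesis by (simp only: Fub[unfolded \<rho>_def] \<rho>_def)
qed

text \<open>Domination by the maximal function allows integrating the pointwise limit
  \<open>l\<close> over any interval, where the Gaussian averages have the integral of
  \<open>f\<close> as limit. Thus \<open>f - l\<close> has integral 0 over every interval, and
  Lebesgue differentiation gives \<open>f = l\<close> almost everywhere.\<close>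

lemma heat_limit_eq:
  assumes F: "fourier_L2 f g"
    and conv: "AE x in lborel. \<exists>l. ((\<lambda>t. disp_int g x 0 t) \<longlongrightarrow> l) (at_right 0)"
    and dom: "\<And>L (q :: nat \<Rightarrow> real). (\<And>i. 0 < q i) \<Longrightarrow>
      (\<integral>\<^sup>+x. indicator {-L..L} x * (SUP i. ennreal ((cmod (disp_int g x 0 (q i)))\<^sup>2)) \<partial>lborel) < \<infinity>"
  shows "AE x in lborel. ((\<lambda>t. complex_of_real (1 / (2 * pi)) * disp_int g x 0 t) \<longlongrightarrow> f x) (at_right 0)"
proof -
  have [measurable]: "f \<in> borel_measurable borel" and f2: "integrable lborel (\<lambda>x. (cmod (f x))\<^sup>2)"
    and [measurable]: "g \<in> borel_measurable borel"
    using F by (auto simp: fourier_L2_def square_integrable_def)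
  \<comment> \<open>Limits along a sequence make \<open>l\<close> measurable; the full limit is
    assumed to exist almost everywhere, so it coincides with \<open>l\<close> there.\<close>
  define q where "q = (\<lambda>n. inverse (real (Suc n)))"
  define h where "h = (\<lambda>n x. complex_of_real (1 / (2 * pi)) * disp_int g x 0 (q n))"
  define l where "l = (\<lambda>x. lim (\<lambda>n. h n x))"
  have q: "q n > 0" "q n \<le> 1" for n by (auto simp: q_def field_simps)
  have q0: "q \<longlonglongrightarrow> 0" unfolding q_def by (rule LIMSEQ_inverse_real_of_nat)
  have qr: "filterlim q (at_right 0) sequentially"
    unfolding filterlim_at using q0 q(1) by (auto intro!: always_eventually simp: less_imp_neq[THEN not_sym])
  have [measurable]: "h n \<in> borel_measurable borel" for n unfolding h_def by measurable
  have [measurable]: "l \<in> borel_measurable borel" unfolding l_def by measurable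
  have hl: "AE x in lborel. ((\<lambda>t. complex_of_real (1 / (2 * pi)) * disp_int g x 0 t) \<longlongrightarrow> l x) (at_right 0) \<and> (\<lambda>n. h n x) \<longlonglongrightarrow> l x"
    using conv
  proof eventually_elim
    case (elim x)
    then obtain k where k: "((\<lambda>t. disp_int g x 0 t) \<longlongrightarrow> k) (at_right 0)" by blast
    have 1: "((\<lambda>t. complex_of_real (1 / (2 * pi)) * disp_int g x 0 t) \<longlongrightarrow> complex_of_real (1 / (2 * pi)) * k) (at_right 0)"
      by (intro tendsto_intros k)
    have 2: "(\<lambda>n. h n x) \<longlonglongrightarrow> complex_of_real (1 / (2 * pi)) * k"
      unfolding h_def by (rule filterlim_compose[OF 1 qr])
    then have "l x = complex_of_real (1 / (2 * pi)) * k" unfolding l_def by (rule limI)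
    then show ?case using 1 2 by simp
  qed
  define S where "S = (\<lambda>x. SUP i. ennreal ((cmod (disp_int g x 0 (q i)))\<^sup>2))"
  have [measurable]: "S \<in> borel_measurable borel" unfolding S_def by measurable
  have main: "integrable lborel (\<lambda>x. indicator {a..b} x * l x) \<and> (LINT x|lborel. indicator {a..b} x * l x) = (LINT x|lborel. indicator {a..b} x * f x)" for a b
  proof -
    \<comment> \<open>The available integrable supremum is that of the squared moduli, whence
      \<open>1 + S\<close> as majorant. Where \<open>S\<close> is infinite \<open>enn2real\<close>
      returns 0, but this happens only on a null subset of the interval.\<close>
    define w where "w = (\<lambda>x. indicator {a..b} x * (1 + enn2real (S x)))"
    define L where "L = \<bar>a\<bar> + \<bar>b\<bar>"
    have LS: "(\<integral>\<^sup>+x. indicator {-L..L} x * S x \<partial>lborel) < \<infinity>" unfolding S_def by (intro dom q)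
    have wi: "integrable lborel w"
    proof (rule integrableI_nonneg)
      show "w \<in> borel_measurable lborel" unfolding w_def by measurable
      have "(\<integral>\<^sup>+x. ennreal (w x) \<partial>lborel) \<le> (\<integral>\<^sup>+x. indicator {a..b} x + indicator {-L..L} x * S x \<partial>lborel)"
      proof (rule nn_integral_mono)
        fix x
        have "ennreal (enn2real (S x)) \<le> S x" by (cases "S x") auto
        then show "ennreal (w x) \<le> indicator {a..b} x + indicator {-L..L} x * S x"
          by (auto simp: w_def L_def indicator_def ennreal_plus intro: add_left_mono)
      qed
      also have "\<dots> = emeasure lborel {a..b} + (\<integral>\<^sup>+x. indicator {-L..L} x * S x \<partial>lborel)"
        by (subst nn_integral_add) auto
      also have "\<dots> < \<infinity>" using LS by (simp add: emeasure_lborel_Icc_eq)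
      finally show "(\<integral>\<^sup>+x. ennreal (w x) \<partial>lborel) < \<infinity>" .
    qed (simp add: w_def)
    have Sfin: "AE x in lborel. indicator {-L..L} x * S x \<noteq> \<infinity>"
      using LS by (intro nn_integral_PInf_AE) auto
    have bnd: "AE x in lborel. norm (indicator {a..b} x * h n x) \<le> w x" for n
      using Sfin
    proof eventually_elim
      case (elim x)
      show ?case
      proof (cases "x \<in> {a..b}")
        case True
        then have "x \<in> {-L..L}" by (auto simp: L_def)
        then have Sx: "S x \<noteq> \<infinity>" using elim by simp
        let ?d = "cmod (disp_int g x 0 (q n))"
        have "ennreal (?d\<^sup>2) \<le> S x" unfolding S_def by (rule SUP_upper) simp
        then have d: "?d\<^sup>2 \<le> enn2real (S x)" using Sx by (cases "S x") auto
        have "0 \<le> (?d - 1)\<^sup>2 + 1 + ?d\<^sup>2" by simp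
        then have d1: "?d \<le> 1 + ?d\<^sup>2" by (simp add: power2_eq_square algebra_simps)
        have "1 \<le> 2 * pi" using pi_gt3 by simp
        then have "1 / (2 * pi) * ?d \<le> 1 * ?d" by (intro mult_right_mono) auto
        moreover have "norm (h n x) = 1 / (2 * pi) * ?d" by (simp add: h_def norm_mult norm_divide)
        ultimately have "norm (h n x) \<le> 1 + enn2real (S x)" using d d1 by linarith
        then show ?thesis using True by (simp add: w_def)
      qed (simp add: w_def)
    qed
    have lim: "AE x in lborel. (\<lambda>n. indicator {a..b} x * h n x) \<longlonglongrightarrow> indicator {a..b} x * l x"
      using hl by eventually_elim (auto intro!: tendsto_intros)
    have 1: "(\<lambda>n. LINT x|lborel. indicator {a..b} x * h n x) \<longlonglongrightarrow> (LINT x|lborel. indicator {a..b} x * l x)"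
      by (rule integral_dominated_convergence[OF _ _ wi lim bnd]) measurable
    have i: "integrable lborel (\<lambda>x. indicator {a..b} x * l x)"
      by (rule integrable_dominated_convergence[OF _ _ wi lim bnd]) measurable
    have "(\<lambda>n. LINT x|lborel. indicator {a..b} x * (LINT z|lborel. complex_of_real (exp (- (1/4) * z\<^sup>2) / (2 * sqrt pi)) * f (x + sqrt (q n) * z)))
     \<longlonglongrightarrow> (LINT x|lborel. indicator {a..b} x * f x)"
    proof (rule gaussian_average_interval_limit[OF _ f2])
      show "(\<lambda>n. sqrt (q n)) \<longlonglongrightarrow> 0" using tendsto_real_sqrt[OF q0] by simp
      show "\<bar>sqrt (q n)\<bar> \<le> 1" for n using q[of n] by simp
    qed measurable
    then have "(\<lambda>n. LINT x|lborel. indicator {a..b} x * h n x) \<longlonglongrightarrow> (LINT x|lborel. indicator {a..b} x * f x)"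
      unfolding h_def heat_average[OF F q(1)] .
    then show ?thesis using LIMSEQ_unique[OF 1] i by blast
  qed
  have zero: "((\<lambda>x. f x - l x) has_integral 0) {a..b}" for a b
  proof -
    have fi: "integrable lborel (\<lambda>x. indicator {a..b} x * f x)"
    proof (rule Bochner_Integration.integrable_bound)
      show "integrable lborel (\<lambda>x. norm (indicator {- (\<bar>a\<bar> + \<bar>b\<bar>)..\<bar>a\<bar> + \<bar>b\<bar>} x * f x))"
        by (intro integrable_norm integrable_truncation f2) measurable
    qed (auto simp: indicator_def)
    have "integrable lborel (\<lambda>x. indicator {a..b} x * f x - indicator {a..b} x * l x)" using main fi by simp
    moreover have "indicator {a..b} x * f x - indicator {a..b} x * l x = indicator {a..b} x *\<^sub>R (f x - l x)" for x
      by (simp add: indicator_def)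
    ultimately have si: "set_integrable lborel {a..b} (\<lambda>x. f x - l x)" by (simp add: set_integrable_def)
    have "(LINT x:{a..b}|lborel. f x - l x) = (LINT x|lborel. indicator {a..b} x * f x - indicator {a..b} x * l x)"
      unfolding set_lebesgue_integral_def by (intro Bochner_Integration.integral_cong) (auto simp: indicator_def)
    also have "\<dots> = 0" using main fi by simp
    finally have "integral {a..b} (\<lambda>x. f x - l x) = 0" using set_borel_integral_eq_integral(2)[OF si] by simp
    then show ?thesis using set_borel_integral_eq_integral(1)[OF si] by (simp only: has_integral_iff)
  qed
  have int: "(\<lambda>x. f x - l x) integrable_on cbox a b" for a b
    unfolding box_real(2) using zero by (rule has_integral_integrable)
  \<comment> \<open>Lebesgue differentiation: off a negligible set the averages of
    \<open>f - l\<close> over short intervals to the right of \<open>x\<close> approach its value at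
    \<open>x\<close>, and those averages are all 0.\<close>
  obtain N where N: "negligible N" "\<And>x e. \<lbrakk>x \<notin> N; 0 < e\<rbrakk> \<Longrightarrow>
     \<exists>d>0. \<forall>h. 0 < h \<and> h < d \<longrightarrow> norm (integral (cbox x (x + h *\<^sub>R One)) (\<lambda>x. f x - l x) /\<^sub>R h ^ DIM(real) - (f x - l x)) < e"
    by (rule integrable_ccontinuous_explicit[OF int], rule that)
  have eq: "f x = l x" if x: "x \<notin> N" for x
  proof (rule ccontr)
    assume "f x \<noteq> l x"
    then have "norm (f x - l x) > 0" by simp
    from N(2)[OF x this] obtain d where d: "d > 0" "\<And>h. 0 < h \<Longrightarrow> h < d \<Longrightarrow>
       norm (integral (cbox x (x + h *\<^sub>R One)) (\<lambda>x. f x - l x) /\<^sub>R h ^ DIM(real) - (f x - l x)) < norm (f x - l x)" by blast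
    have "integral (cbox x (x + (d/2) *\<^sub>R One)) (\<lambda>x. f x - l x) = 0"
      using integral_unique[OF zero] by simp
    then show False using d(2)[of "d/2"] d(1) by (simp add: norm_minus_commute)
  qed
  have "AE x in lebesgue. f x = l x"
    using N(1) eq by (intro AE_I'[of N]) (auto simp: negligible_iff_null_sets)
  then have "AE x in lborel. f x = l x" by (simp add: AE_completion_iff)
  then show ?thesis using hl by eventually_elim simp
qed

text \<open>The kernel bounds need an exponent below 1/2, so \<open>s\<close> is lowered to some
  \<open>s'\<close> between \<open>s_crit\<close> and \<open>min s (1/2)\<close>; the weighted norm
  only decreases.\<close>

lemma convergence_above_s_crit:
  assumes \<gamma>: "\<gamma> > 0" and \<alpha>: "\<alpha> > 0" "\<alpha> \<le> 1/4" and adm: "admissible_curve \<alpha> \<Gamma>"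
    and s: "s_crit \<gamma> \<alpha> < s" and sob: "sobolev s f g"
  shows "converges_ae \<gamma> \<Gamma> f g"
proof -
  have "s_crit \<gamma> \<alpha> \<le> 1/2 - \<alpha>" by (simp add: s_crit_def)
  then have "s_crit \<gamma> \<alpha> < min s (1/2)" using \<alpha> s by simp
  then obtain s' where s': "s_crit \<gamma> \<alpha> < s'" "s' < min s (1/2)" using dense by blast
  have F: "fourier_L2 f g" and N: "integrable lborel (\<lambda>\<xi>. (1 + \<xi>\<^sup>2) powr s * (cmod (g \<xi>))\<^sup>2)"
    using sob by (auto simp: sobolev_def)
  have g[measurable]: "g \<in> borel_measurable borel"
    using F by (auto simp: fourier_L2_def square_integrable_def)
  have N': "integrable lborel (\<lambda>\<xi>. (1 + \<xi>\<^sup>2) powr s' * (cmod (g \<xi>))\<^sup>2)"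
  proof (rule Bochner_Integration.integrable_bound[OF N])
    show "AE \<xi> in lborel. norm ((1 + \<xi>\<^sup>2) powr s' * (cmod (g \<xi>))\<^sup>2) \<le> norm ((1 + \<xi>\<^sup>2) powr s * (cmod (g \<xi>))\<^sup>2)"
      using s' by (intro AE_I2) (auto intro!: mult_right_mono powr_mono)
  qed measurable
  have s'2: "s' < 1/2" using s' by simp
  note A = curve_heat_convergence[OF \<gamma> \<alpha> s'(1) s'2 adm g N']
  have "AE x in lborel. ((\<lambda>t. complex_of_real (1 / (2 * pi)) * disp_int g x 0 t) \<longlongrightarrow> f x) (at_right 0)"
  proof (rule heat_limit_eq[OF F _ A(2)])
    show "AE x in lborel. \<exists>l. ((\<lambda>t. disp_int g x 0 t) \<longlongrightarrow> l) (at_right 0)"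
      using A(1) by eventually_elim blast
  qed auto
  then show ?thesis
    unfolding converges_ae_def Pgamma_eq_disp_int using A(1)
  proof eventually_elim
    case (elim x)
    then obtain l where l: "((\<lambda>t. disp_int g (\<Gamma> x t) t (t powr \<gamma>)) \<longlongrightarrow> l) (at_right 0)"
      "((\<lambda>t. disp_int g x 0 t) \<longlongrightarrow> l) (at_right 0)" by blast
    have "((\<lambda>t. complex_of_real (1 / (2 * pi)) * disp_int g x 0 t) \<longlongrightarrow> complex_of_real (1 / (2 * pi)) * l) (at_right 0)"
      by (intro tendsto_mult_left l)
    then have "f x = complex_of_real (1 / (2 * pi)) * l"
      using elim(1) by (intro tendsto_unique[of "at_right (0::real)"]) auto
    then show ?case using tendsto_mult_left[OF l(1), of "complex_of_real (1 / (2 * pi))"] by (simp only:)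
  qed
qed

section \<open>Fourier transforms of functions that are integrable and square integrable\<close>

text \<open>With a regularising factor \<open>exp (- e * \<xi>\<^sup>2)\<close> the quadratic form
  has a Gaussian kernel of mass \<open>2 * pi\<close>, whatever \<open>e\<close> is, and Schur's
  test gives the constant. Fatou's lemma removes the factor.\<close>

lemma plancherel_le:
  fixes u :: "real \<Rightarrow> complex"
  assumes u1: "integrable lborel u" and u2: "integrable lborel (\<lambda>x. (cmod (u x))\<^sup>2)"
  shows "(\<integral>\<^sup>+\<xi>. ennreal ((cmod (LINT x|lborel. cis (- (x * \<xi>)) * u x))\<^sup>2) \<partial>lborel)
     \<le> ennreal (2 * pi * (LINT x|lborel. (cmod (u x))\<^sup>2))"
proof -
  have [measurable]: "u \<in> borel_measurable borel" using borel_measurable_integrable[OF u1] by simp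
  define v where "v = (\<lambda>\<xi>. LINT x|lborel. cis (- (x * \<xi>)) * u x)"
  have [measurable]: "v \<in> borel_measurable borel" unfolding v_def by measurable
  define S where "S = (LINT x|lborel. (cmod (u x))\<^sup>2)"
  have reg: "(\<integral>\<^sup>+\<xi>. ennreal (exp (- e * \<xi>\<^sup>2) * (cmod (v \<xi>))\<^sup>2) \<partial>lborel) \<le> ennreal (2 * pi * S)" if e: "e > 0" for e :: real
  proof -
    define E where "E = (\<lambda>\<xi>::real. exp (- e * \<xi>\<^sup>2))"
    have [measurable]: "E \<in> borel_measurable borel" unfolding E_def by measurable
    have E0: "E \<xi> > 0" for \<xi> by (simp add: E_def)
    have Ei: "integrable lborel E" unfolding E_def by (rule gaussian_integrable[OF e])
    define k where "k = (\<lambda>r::real. sqrt (pi / e) * exp (- r\<^sup>2 / (4 * e)))"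
    have [measurable]: "k \<in> borel_measurable borel" unfolding k_def by measurable
    have k0: "k r \<ge> 0" for r using e by (simp add: k_def)
    have kint: "(\<integral>\<^sup>+y. ennreal (k (x - y)) \<partial>lborel) = ennreal (2 * pi)" for x
    proof -
      have ki: "integrable lborel k" unfolding k_def using gaussian_integrable[of "1 / (4 * e)"] e by simp
      have "(LINT y|lborel. k y) = sqrt (pi / e) * sqrt (pi / (1 / (4 * e)))"
        unfolding k_def using gaussian_integral[of "1 / (4 * e)"] e by simp
      also have "\<dots> = sqrt ((2 * pi)\<^sup>2)"
        using e by (simp add: real_sqrt_mult[symmetric] power2_eq_square)
      also have "\<dots> = 2 * pi" unfolding real_sqrt_abs by simp
      finally have k2: "(LINT y|lborel. k y) = 2 * pi" .
      have "(\<integral>\<^sup>+y. ennreal (k (x - y)) \<partial>lborel) = (\<integral>\<^sup>+y. ennreal (k y) \<partial>lborel)"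
        by (subst (2) nn_integral_real_affine[where c="-1" and t=x]) auto
      also have "\<dots> = ennreal (LINT y|lborel. k y)" by (rule nn_integral_eq_integral[OF ki]) (simp add: k0)
      finally show ?thesis by (simp add: k2)
    qed
    have km: "(\<lambda>p. k (fst p - snd p)) \<in> borel_measurable (borel \<Otimes>\<^sub>M borel)"
      and em: "(\<lambda>p. cis (- (fst p * snd p))) \<in> borel_measurable (borel \<Otimes>\<^sub>M borel)" by measurable
    have ksym: "k (x - y) = k (y - x)" for x y by (simp add: k_def power2_commute)
    have KK: "norm (LINT \<xi>|lborel. complex_of_real (E \<xi>) * (cis (- (x * \<xi>)) * cnj (cis (- (y * \<xi>))))) \<le> k (x - y)" for x y
    proof -
      have "complex_of_real (E \<xi>) * (cis (- (x * \<xi>)) * cnj (cis (- (y * \<xi>)))) = cis ((y - x) * \<xi>) * complex_of_real (exp (- e * \<xi>\<^sup>2))" for \<xi>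
        by (simp add: E_def cis_cnj cis_mult algebra_simps)
      moreover have "sqrt (pi / e) * exp (- (y - x)\<^sup>2 / (4 * e)) = k (y - x)" by (simp add: k_def)
      ultimately show ?thesis using k0[of "y - x"]
        by (simp only: gaussian_fourier_real[OF e] norm_of_real ksym[of x y])
    qed
    have Em: "E \<in> borel_measurable borel" by measurable
    have E1: "integrable lborel (\<lambda>\<xi>. E \<xi> * 1\<^sup>2)" using Ei by simp
    have veq: "v = (\<lambda>\<xi>. LINT x|lborel. u x * cis (- (x * \<xi>)))" unfolding v_def by (simp only: mult.commute)
    define Q where "Q = (LINT \<xi>|lborel. E \<xi> * (cmod (v \<xi>))\<^sup>2)"
    note Q_bound = schur_quadratic_bound[OF u1 u2 em _ Em less_imp_le[OF E0] E1 km k0 ksym _ eq_refl[OF kint] KK]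
    have Qi: "integrable lborel (\<lambda>\<xi>. E \<xi> * (cmod (v \<xi>))\<^sup>2)" unfolding veq by (rule Q_bound(1)) auto
    have "Q \<le> 2 * pi * S" unfolding Q_def S_def veq by (rule Q_bound(2)) auto
    then have "ennreal Q \<le> ennreal (2 * pi * S)" by (rule ennreal_leI)
    moreover have "(\<integral>\<^sup>+\<xi>. ennreal (E \<xi> * (cmod (v \<xi>))\<^sup>2) \<partial>lborel) = ennreal Q"
      unfolding Q_def by (rule nn_integral_eq_integral[OF Qi]) (simp add: less_imp_le[OF E0])
    ultimately show ?thesis by (simp add: E_def)
  qed
  define e where "e = (\<lambda>n. inverse (real (Suc n)))"
  have e: "e n > 0" for n by (simp add: e_def)
  have e0: "e \<longlonglongrightarrow> 0" unfolding e_def by (rule LIMSEQ_inverse_real_of_nat)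
  have "(\<integral>\<^sup>+\<xi>. ennreal ((cmod (v \<xi>))\<^sup>2) \<partial>lborel) = (\<integral>\<^sup>+\<xi>. liminf (\<lambda>n. ennreal (exp (- e n * \<xi>\<^sup>2) * (cmod (v \<xi>))\<^sup>2)) \<partial>lborel)"
  proof (rule nn_integral_cong)
    fix \<xi> :: real
    have "(\<lambda>n. ennreal (exp (- e n * \<xi>\<^sup>2) * (cmod (v \<xi>))\<^sup>2)) \<longlonglongrightarrow> ennreal (exp (- 0 * \<xi>\<^sup>2) * (cmod (v \<xi>))\<^sup>2)"
      by (intro tendsto_ennrealI tendsto_intros e0)
    then show "ennreal ((cmod (v \<xi>))\<^sup>2) = liminf (\<lambda>n. ennreal (exp (- e n * \<xi>\<^sup>2) * (cmod (v \<xi>))\<^sup>2))"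
      using lim_imp_Liminf[OF sequentially_bot] by fastforce
  qed
  also have "\<dots> \<le> liminf (\<lambda>n. \<integral>\<^sup>+\<xi>. ennreal (exp (- e n * \<xi>\<^sup>2) * (cmod (v \<xi>))\<^sup>2) \<partial>lborel)"
    by (rule nn_integral_liminf) measurable
  also have "\<dots> \<le> liminf (\<lambda>n. ennreal (2 * pi * S))"
    by (intro Liminf_mono always_eventually allI reg e)
  also have "\<dots> = ennreal (2 * pi * S)" by (simp add: Liminf_const)
  finally show ?thesis by (simp add: v_def S_def)
qed

text \<open>The truncation error is the transform of the part of \<open>f\<close> outside
  \<open>[-R, R]\<close>, whose \<open>L\<^sup>2\<close> norm tends to 0;
  \<open>plancherel_le\<close> carries this to the frequency side.\<close>

lemma fourier_L2_of_integrable: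
  fixes f g :: "real \<Rightarrow> complex"
  assumes f1: "integrable lborel f" and f2: "integrable lborel (\<lambda>x. (cmod (f x))\<^sup>2)"
    and g: "\<And>\<xi>. g \<xi> = (LINT x|lborel. cis (- (x * \<xi>)) * f x)"
    and g2: "integrable lborel (\<lambda>\<xi>. (cmod (g \<xi>))\<^sup>2)"
  shows "fourier_L2 f g"
proof -
  have [measurable]: "f \<in> borel_measurable borel" using borel_measurable_integrable[OF f1] by simp
  have g': "g = (\<lambda>\<xi>. LINT x|lborel. cis (- (x * \<xi>)) * f x)" using g by blast
  have [measurable]: "g \<in> borel_measurable borel" unfolding g' by measurable
  define fo where "fo = (\<lambda>R x. indicator (- {-R..R}) x * f x)"
  have [measurable]: "fo R \<in> borel_measurable borel" for R unfolding fo_def by measurable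
  have fo1: "integrable lborel (fo R)" for R
    by (rule Bochner_Integration.integrable_bound[OF f1]) (auto simp: fo_def indicator_def)
  have fo2: "integrable lborel (\<lambda>x. (cmod (fo R x))\<^sup>2)" for R
    by (rule Bochner_Integration.integrable_bound[OF f2]) (auto simp: fo_def indicator_def)
  have eq: "g \<xi> - (LINT x:{-R..R}|lborel. cis (- (x * \<xi>)) * f x) = (LINT x|lborel. cis (- (x * \<xi>)) * fo R x)" for R \<xi>
  proof -
    have i1: "integrable lborel (\<lambda>x. cis (- (x * \<xi>)) * f x)"
      by (rule Bochner_Integration.integrable_bound[OF f1]) (auto simp: norm_mult)
    have i2: "integrable lborel (\<lambda>x. indicator {-R..R} x *\<^sub>R (cis (- (x * \<xi>)) * f x))"
      by (rule integrable_mult_indicator[OF _ i1]) simp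
    have "g \<xi> - (LINT x:{-R..R}|lborel. cis (- (x * \<xi>)) * f x) = (LINT x|lborel. cis (- (x * \<xi>)) * f x - indicator {-R..R} x *\<^sub>R (cis (- (x * \<xi>)) * f x))"
      unfolding g set_lebesgue_integral_def using i1 i2 by simp
    also have "\<dots> = (LINT x|lborel. cis (- (x * \<xi>)) * fo R x)"
      by (intro Bochner_Integration.integral_cong) (auto simp: fo_def indicator_def)
    finally show ?thesis .
  qed
  have "((\<lambda>R. LINT x|lborel. (cmod (fo R x))\<^sup>2) \<longlongrightarrow> (LINT (x::real)|lborel. 0)) at_top"
  proof (rule integral_dominated_convergence_at_top[OF _ _ f2])
    show "\<forall>\<^sub>F R in at_top. AE x in lborel. norm ((cmod (fo R x))\<^sup>2) \<le> (cmod (f x))\<^sup>2"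
      by (intro always_eventually allI AE_I2) (auto simp: fo_def indicator_def)
    show "AE x in lborel. ((\<lambda>R. (cmod (fo R x))\<^sup>2) \<longlongrightarrow> 0) at_top"
    proof (rule AE_I2)
      fix x :: real
      have "eventually (\<lambda>R. (cmod (fo R x))\<^sup>2 = 0) at_top"
        using eventually_ge_at_top[of "\<bar>x\<bar>"] by eventually_elim (auto simp: fo_def indicator_def)
      then show "((\<lambda>R. (cmod (fo R x))\<^sup>2) \<longlongrightarrow> 0) at_top" by (rule tendsto_eventually)
    qed
  qed measurable
  then have "((\<lambda>R. 2 * pi * (LINT x|lborel. (cmod (fo R x))\<^sup>2)) \<longlongrightarrow> 2 * pi * 0) at_top"
    by (intro tendsto_mult_left) simp
  then have lim: "((\<lambda>R. ennreal (2 * pi * (LINT x|lborel. (cmod (fo R x))\<^sup>2))) \<longlongrightarrow> 0) at_top"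
    using tendsto_ennrealI by fastforce
  have "((\<lambda>R. \<integral>\<^sup>+ \<xi>. ennreal ((cmod (g \<xi> - (LINT x:{-R..R}|lborel. cis (- (x * \<xi>)) * f x)))\<^sup>2) \<partial>lborel) \<longlongrightarrow> 0) at_top"
    unfolding eq
    by (rule tendsto_sandwich[OF _ always_eventually[OF allI[OF plancherel_le[OF fo1 fo2]]] tendsto_const lim]) simp
  then show ?thesis using f2 g2 by (simp add: fourier_L2_def square_integrable_def)
qed

section \<open>Grids of Gaussian bumps\<close>

text \<open>Divide by \<open>(a + b) powr \<alpha>\<close>: the fractions \<open>a / (a + b)\<close>
  and \<open>b / (a + b)\<close> lie in \<open>[0, 1]\<close>, where a power with exponent at most 1
  only enlarges.\<close>

lemma powr_add_le:
  fixes a b \<alpha> :: real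
  assumes "0 \<le> a" "0 \<le> b" "0 < \<alpha>" "\<alpha> \<le> 1"
  shows "(a + b) powr \<alpha> \<le> a powr \<alpha> + b powr \<alpha>"
proof (cases "a + b = 0")
  case False
  then have c: "a + b > 0" using assms by simp
  have *: "x / (a + b) \<le> (x / (a + b)) powr \<alpha>" if x: "0 \<le> x" "x \<le> a + b" for x
  proof (cases "x = 0")
    case False
    then have "(x / (a + b)) powr 1 \<le> (x / (a + b)) powr \<alpha>"
      using x c assms by (intro powr_mono') auto
    then show ?thesis using x c by simp
  qed simp
  have "1 = a / (a + b) + b / (a + b)" using c by (simp add: add_divide_distrib[symmetric])
  also have "\<dots> \<le> (a / (a + b)) powr \<alpha> + (b / (a + b)) powr \<alpha>"
    using assms by (intro add_mono *) auto
  also have "\<dots> = (a powr \<alpha> + b powr \<alpha>) / (a + b) powr \<alpha>"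
    using assms by (simp add: powr_divide add_divide_distrib)
  finally show ?thesis using c by (simp add: field_simps)
qed (use assms in simp)

lemma powr_abs_holder:
  fixes t t' \<alpha> :: real
  assumes \<alpha>: "0 < \<alpha>" "\<alpha> \<le> 1"
  shows "\<bar>\<bar>t\<bar> powr \<alpha> - \<bar>t'\<bar> powr \<alpha>\<bar> \<le> \<bar>t - t'\<bar> powr \<alpha>"
proof -
  have *: "\<bar>x\<bar> powr \<alpha> \<le> \<bar>y\<bar> powr \<alpha> + \<bar>x - y\<bar> powr \<alpha>" for x y :: real
  proof -
    have "\<bar>x\<bar> powr \<alpha> \<le> (\<bar>y\<bar> + \<bar>x - y\<bar>) powr \<alpha>" using \<alpha> by (intro powr_mono2) auto
    also have "\<dots> \<le> \<bar>y\<bar> powr \<alpha> + \<bar>x - y\<bar> powr \<alpha>" using \<alpha> by (intro powr_add_le) auto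
    finally show ?thesis .
  qed
  show ?thesis using *[of t t'] *[of t' t] by (simp add: abs_minus_commute abs_le_iff)
qed

lemma power_curve_admissible:
  fixes \<alpha> :: real
  assumes \<alpha>: "0 < \<alpha>" "\<alpha> \<le> 1"
  shows "admissible_curve \<alpha> (\<lambda>x t. x + \<bar>t\<bar> powr \<alpha>)"
proof -
  have "continuous_on (UNIV \<times> {-1..1}) (\<lambda>p. fst p + \<bar>snd p\<bar> powr \<alpha> :: real)"
    using \<alpha> by (intro continuous_intros continuous_on_powr') auto
  then have 1: "continuous_on (UNIV \<times> {-1..1}) (\<lambda>(x, t). x + \<bar>t\<bar> powr \<alpha> :: real)"
    by (simp add: case_prod_beta)
  have 2: "\<bar>x + \<bar>t\<bar> powr \<alpha> - (x + \<bar>t'\<bar> powr \<alpha>)\<bar> \<le> 1 * \<bar>t - t'\<bar> powr \<alpha>" for x t t' :: real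
    using powr_abs_holder[OF \<alpha>, of t t'] by simp
  show ?thesis unfolding admissible_curve_def
    by (intro conjI 1 exI[of _ 1] ballI allI 2) (use \<alpha> in auto)
qed

text \<open>The autocorrelation of \<open>M\<close> equally spaced points, smoothed by a Gaussian of
  width \<open>1 / R\<close>: the bump at \<open>i * \<delta>\<close> has weight
  \<open>1 - \<bar>i\<bar> / M\<close> for \<open>\<bar>i\<bar> < M\<close>. A plain comb of bumps
  would not have a nonnegative transform.\<close>

definition bump_sum :: "nat \<Rightarrow> real \<Rightarrow> real \<Rightarrow> real \<Rightarrow> real" where
  "bump_sum M \<delta> R x = (\<Sum>j<M. \<Sum>k<M. exp (- (R\<^sup>2 / 2) * (x + (real j - real k) * \<delta>)\<^sup>2)) / real M"

text \<open>The Fourier transform of \<open>bump_sum\<close> is a Fejer-type kernel times a Gaussian. Its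
  nonnegativity turns the supremum bounds below into evaluations at \<open>0\<close>.\<close>

definition fejer_comb :: "nat \<Rightarrow> real \<Rightarrow> real \<Rightarrow> real \<Rightarrow> real" where
  "fejer_comb M \<delta> R \<xi> = (cmod (\<Sum>j<M. cis (real j * \<delta> * \<xi>)))\<^sup>2 / real M * (sqrt (2 * pi) / R) * exp (- \<xi>\<^sup>2 / (2 * R\<^sup>2))"

lemma fejer_comb_nonneg: "R > 0 \<Longrightarrow> 0 \<le> fejer_comb M \<delta> R \<xi>"
  by (simp add: fejer_comb_def)

lemma bump_sum_nonneg: "0 \<le> bump_sum M \<delta> R x"
  by (simp add: bump_sum_def sum_nonneg)

lemma borel_measurable_bump_sum [measurable]: "bump_sum M \<delta> R \<in> borel_measurable borel"
  unfolding bump_sum_def by measurable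

lemma borel_measurable_fejer_comb [measurable]: "fejer_comb M \<delta> R \<in> borel_measurable borel"
  unfolding fejer_comb_def by measurable

lemma fejer_square_expand:
  "complex_of_real ((cmod (\<Sum>j<M. cis (real j * \<delta> * \<xi>)))\<^sup>2) = (\<Sum>j<M. \<Sum>k<M. cis ((real j - real k) * \<delta> * \<xi>))"
proof -
  have "complex_of_real ((cmod (\<Sum>j<M. cis (real j * \<delta> * \<xi>)))\<^sup>2) = (\<Sum>j<M. \<Sum>k<M. cis (real j * \<delta> * \<xi>) * cnj (cis (real k * \<delta> * \<xi>)))"
    unfolding complex_norm_square by (simp add: sum_product)
  then show ?thesis by (simp add: cis_cnj cis_mult algebra_simps)
qed

lemma fejer_comb_le:
  assumes "R > 0"
  shows "fejer_comb M \<delta> R \<xi> \<le> real M * sqrt (2 * pi) / R * exp (- \<xi>\<^sup>2 / (2 * R\<^sup>2))"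
proof (cases "M = 0")
  case False
  have "cmod (\<Sum>j<M. cis (real j * \<delta> * \<xi>)) \<le> (\<Sum>j<M. 1)" by (rule sum_norm_le) simp
  then have "(cmod (\<Sum>j<M. cis (real j * \<delta> * \<xi>)))\<^sup>2 \<le> (real M)\<^sup>2" by (intro power_mono) auto
  then have "(cmod (\<Sum>j<M. cis (real j * \<delta> * \<xi>)))\<^sup>2 / real M \<le> real M"
    using False by (simp add: power2_eq_square field_simps)
  then have "(cmod (\<Sum>j<M. cis (real j * \<delta> * \<xi>)))\<^sup>2 / real M * (sqrt (2 * pi) / R * exp (- \<xi>\<^sup>2 / (2 * R\<^sup>2))) \<le> real M * (sqrt (2 * pi) / R * exp (- \<xi>\<^sup>2 / (2 * R\<^sup>2)))"
    using assms by (intro mult_right_mono) auto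
  then show ?thesis by (simp add: fejer_comb_def mult.assoc)
qed (simp add: fejer_comb_def)

text \<open>A Gaussian multiplier widens each bump by the factor
  \<open>sqrt (1 + 2 * u * R\<^sup>2)\<close> and lowers it by the same factor. The case
  \<open>u = 0\<close> is Fourier inversion; \<open>u > 0\<close> measures how much of the transform
  lies at frequencies above \<open>u powr (- 1/2)\<close>.\<close>

lemma fejer_comb_multiplier:
  assumes R: "R > 0" and u: "u \<ge> 0"
  shows "integrable lborel (\<lambda>\<xi>. cis (y * \<xi>) * complex_of_real (exp (- u * \<xi>\<^sup>2) * fejer_comb M \<delta> R \<xi>))"
    and "(LINT \<xi>|lborel. cis (y * \<xi>) * complex_of_real (exp (- u * \<xi>\<^sup>2) * fejer_comb M \<delta> R \<xi>)) =
      complex_of_real (2 * pi * ((\<Sum>j<M. \<Sum>k<M. 1 / sqrt (1 + 2 * u * R\<^sup>2) * exp (- (R\<^sup>2 / (2 * (1 + 2 * u * R\<^sup>2))) * (y + (real j - real k) * \<delta>)\<^sup>2)) / real M))"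
proof -
  define c where "c = 1 / (2 * R\<^sup>2) + u"
  have c: "c > 0" using R u by (simp add: c_def add_pos_nonneg)
  define v where "v = 1 + 2 * u * R\<^sup>2"
  have v: "v > 0" using u by (simp add: v_def add_pos_nonneg)
  have cv: "c = v / (2 * R\<^sup>2)" using R by (simp add: c_def v_def field_simps)
  define B where "B = sqrt (2 * pi) / R / real M"
  define A where "A = (\<lambda>j k::nat. y + (real j - real k) * \<delta>)"
  have eq: "cis (y * \<xi>) * complex_of_real (exp (- u * \<xi>\<^sup>2) * fejer_comb M \<delta> R \<xi>) =
     (\<Sum>j<M. \<Sum>k<M. complex_of_real B * (cis (A j k * \<xi>) * complex_of_real (exp (- c * \<xi>\<^sup>2))))" for \<xi>
  proof -
    have e: "exp (- u * \<xi>\<^sup>2) * exp (- \<xi>\<^sup>2 / (2 * R\<^sup>2)) = exp (- c * \<xi>\<^sup>2)"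
      by (simp add: c_def mult_exp_exp algebra_simps)
    have "cis (y * \<xi>) * complex_of_real (exp (- u * \<xi>\<^sup>2) * fejer_comb M \<delta> R \<xi>) =
      cis (y * \<xi>) * (complex_of_real ((cmod (\<Sum>j<M. cis (real j * \<delta> * \<xi>)))\<^sup>2) * complex_of_real (B * (exp (- u * \<xi>\<^sup>2) * exp (- \<xi>\<^sup>2 / (2 * R\<^sup>2)))))"
      unfolding of_real_mult[symmetric] by (simp add: fejer_comb_def B_def mult_ac)
    also have "\<dots> = (\<Sum>j<M. \<Sum>k<M. cis (y * \<xi>) * (cis ((real j - real k) * \<delta> * \<xi>) * complex_of_real (B * exp (- c * \<xi>\<^sup>2))))"
      unfolding fejer_square_expand e sum_distrib_right sum_distrib_left ..
    also have "\<dots> = (\<Sum>j<M. \<Sum>k<M. complex_of_real B * (cis (A j k * \<xi>) * complex_of_real (exp (- c * \<xi>\<^sup>2))))"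
    proof (intro sum.cong refl)
      fix j k
      have "cis (y * \<xi>) * cis ((real j - real k) * \<delta> * \<xi>) = cis (A j k * \<xi>)" by (simp add: A_def cis_mult algebra_simps)
      moreover have "cis (y * \<xi>) * (cis ((real j - real k) * \<delta> * \<xi>) * complex_of_real (B * exp (- c * \<xi>\<^sup>2))) =
         complex_of_real B * ((cis (y * \<xi>) * cis ((real j - real k) * \<delta> * \<xi>)) * complex_of_real (exp (- c * \<xi>\<^sup>2)))"
        by (simp only: of_real_mult mult_ac)
      ultimately show "cis (y * \<xi>) * (cis ((real j - real k) * \<delta> * \<xi>) * complex_of_real (B * exp (- c * \<xi>\<^sup>2))) =
         complex_of_real B * (cis (A j k * \<xi>) * complex_of_real (exp (- c * \<xi>\<^sup>2)))" by (simp only:)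
    qed
    finally show ?thesis .
  qed
  have i: "integrable lborel (\<lambda>\<xi>. complex_of_real B * (cis (A j k * \<xi>) * complex_of_real (exp (- c * \<xi>\<^sup>2))))" for j k
    by (intro integrable_mult_right gaussian_cis_integrable c)
  show "integrable lborel (\<lambda>\<xi>. cis (y * \<xi>) * complex_of_real (exp (- u * \<xi>\<^sup>2) * fejer_comb M \<delta> R \<xi>))"
    unfolding eq by (intro Bochner_Integration.integrable_sum i)
  have "(LINT \<xi>|lborel. cis (y * \<xi>) * complex_of_real (exp (- u * \<xi>\<^sup>2) * fejer_comb M \<delta> R \<xi>)) =
     (\<Sum>j<M. \<Sum>k<M. (LINT \<xi>|lborel. complex_of_real B * (cis (A j k * \<xi>) * complex_of_real (exp (- c * \<xi>\<^sup>2)))))"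
    unfolding eq by (subst Bochner_Integration.integral_sum, intro Bochner_Integration.integrable_sum i,
      intro sum.cong refl Bochner_Integration.integral_sum i)
  also have "\<dots> = (\<Sum>j<M. \<Sum>k<M. complex_of_real (B * (sqrt (pi / c) * exp (- (A j k)\<^sup>2 / (4 * c)))))"
    by (simp only: integral_mult_right_zero gaussian_fourier_real[OF c] of_real_mult)
  also have "\<dots> = complex_of_real (\<Sum>j<M. \<Sum>k<M. B * (sqrt (pi / c) * exp (- (A j k)\<^sup>2 / (4 * c))))"
    by (simp only: of_real_sum)
  also have "(\<Sum>j<M. \<Sum>k<M. B * (sqrt (pi / c) * exp (- (A j k)\<^sup>2 / (4 * c)))) =
     (\<Sum>j<M. \<Sum>k<M. (2 * pi / real M) * (1 / sqrt v * exp (- (R\<^sup>2 / (2 * v)) * (A j k)\<^sup>2)))"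
  proof (intro sum.cong refl)
    fix j k
    have "sqrt (pi / c) = sqrt (2 * pi) * R / sqrt v"
      using R v by (simp add: cv real_sqrt_divide real_sqrt_mult)
    moreover have "sqrt (2 * pi) * sqrt (2 * pi) = 2 * pi" by simp
    ultimately have "B * sqrt (pi / c) = (2 * pi / real M) * (1 / sqrt v)"
      using R by (simp add: B_def field_simps del: real_sqrt_mult_self)
    moreover have "- (A j k)\<^sup>2 / (4 * c) = - (R\<^sup>2 / (2 * v)) * (A j k)\<^sup>2"
      using R v by (simp add: cv field_simps)
    ultimately show "B * (sqrt (pi / c) * exp (- (A j k)\<^sup>2 / (4 * c))) = (2 * pi / real M) * (1 / sqrt v * exp (- (R\<^sup>2 / (2 * v)) * (A j k)\<^sup>2))"
      by (simp only: mult.assoc[symmetric])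
  qed
  also have "\<dots> = 2 * pi * ((\<Sum>j<M. \<Sum>k<M. 1 / sqrt v * exp (- (R\<^sup>2 / (2 * v)) * (A j k)\<^sup>2)) / real M)"
  proof -
    have "(\<Sum>j<M. \<Sum>k<M. (2 * pi / real M) * T j k) = 2 * pi * ((\<Sum>j<M. \<Sum>k<M. T j k) / real M)" for T :: "nat \<Rightarrow> nat \<Rightarrow> real"
      by (simp only: sum_distrib_left[symmetric]) simp
    then show ?thesis .
  qed
  finally show "(LINT \<xi>|lborel. cis (y * \<xi>) * complex_of_real (exp (- u * \<xi>\<^sup>2) * fejer_comb M \<delta> R \<xi>)) =
      complex_of_real (2 * pi * ((\<Sum>j<M. \<Sum>k<M. 1 / sqrt (1 + 2 * u * R\<^sup>2) * exp (- (R\<^sup>2 / (2 * (1 + 2 * u * R\<^sup>2))) * (y + (real j - real k) * \<delta>)\<^sup>2)) / real M))"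
    unfolding v_def A_def .
qed

lemma fejer_comb_integrable: "R > 0 \<Longrightarrow> integrable lborel (fejer_comb M \<delta> R)"
  using fejer_comb_multiplier(1)[of R 0 0 M \<delta>] by (simp add: complex_of_real_integrable_eq)

lemma fejer_comb_inverse:
  assumes R: "R > 0"
  shows "(LINT \<xi>|lborel. cis (y * \<xi>) * complex_of_real (fejer_comb M \<delta> R \<xi>)) = complex_of_real (2 * pi * bump_sum M \<delta> R y)"
  using fejer_comb_multiplier(2)[OF R order_refl, of y M \<delta>] by (simp add: bump_sum_def)

lemma fejer_comb_integral:
  assumes R: "R > 0"
  shows "(LINT \<xi>|lborel. fejer_comb M \<delta> R \<xi>) = 2 * pi * bump_sum M \<delta> R 0"
proof -
  have "complex_of_real (LINT \<xi>|lborel. fejer_comb M \<delta> R \<xi>) = complex_of_real (2 * pi * bump_sum M \<delta> R 0)"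
    using fejer_comb_inverse[OF R, of 0 M \<delta>] by (simp only: integral_complex_of_real[symmetric] mult_zero_left cis_zero mult_1)
  then show ?thesis by (simp only: of_real_eq_iff)
qed

lemma gaussian_shift_fourier:
  assumes c: "c > 0"
  shows "integrable lborel (\<lambda>x. cis (- (x * \<xi>)) * complex_of_real (exp (- c * (x + a)\<^sup>2)))"
    and "(LINT x|lborel. cis (- (x * \<xi>)) * complex_of_real (exp (- c * (x + a)\<^sup>2))) =
      cis (a * \<xi>) * complex_of_real (sqrt (pi / c) * exp (- \<xi>\<^sup>2 / (4 * c)))"
proof -
  have eq: "cis (- ((- a + 1 * x) * \<xi>)) * complex_of_real (exp (- c * ((- a + 1 * x) + a)\<^sup>2)) = cis (a * \<xi>) * (cis ((- \<xi>) * x) * complex_of_real (exp (- c * x\<^sup>2)))" for x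
    by (simp add: cis_mult algebra_simps flip: mult.assoc)
  have i: "integrable lborel (\<lambda>x. cis (a * \<xi>) * (cis ((- \<xi>) * x) * complex_of_real (exp (- c * x\<^sup>2))))"
    by (intro integrable_mult_right gaussian_cis_integrable c)
  show "integrable lborel (\<lambda>x. cis (- (x * \<xi>)) * complex_of_real (exp (- c * (x + a)\<^sup>2)))"
    using i unfolding eq[symmetric]
    by (rule lborel_integrable_real_affine_iff[where c=1 and t="-a", THEN iffD1, rotated]) simp
  have "(LINT x|lborel. cis (- (x * \<xi>)) * complex_of_real (exp (- c * (x + a)\<^sup>2))) =
     (LINT x|lborel. cis (a * \<xi>) * (cis ((- \<xi>) * x) * complex_of_real (exp (- c * x\<^sup>2))))"
    unfolding eq[symmetric] by (subst lborel_integral_real_affine[where c=1 and t="-a"]) auto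
  also have "\<dots> = cis (a * \<xi>) * complex_of_real (sqrt (pi / c) * exp (- \<xi>\<^sup>2 / (4 * c)))"
    by (simp only: integral_mult_right_zero gaussian_fourier_real[OF c] power2_minus)
  finally show "(LINT x|lborel. cis (- (x * \<xi>)) * complex_of_real (exp (- c * (x + a)\<^sup>2))) =
      cis (a * \<xi>) * complex_of_real (sqrt (pi / c) * exp (- \<xi>\<^sup>2 / (4 * c)))" .
qed

lemma bump_sum_fourier:
  assumes R: "R > 0"
  shows "integrable lborel (bump_sum M \<delta> R)"
    and "(LINT x|lborel. cis (- (x * \<xi>)) * complex_of_real (bump_sum M \<delta> R x)) = complex_of_real (fejer_comb M \<delta> R \<xi>)"
proof -
  define a where "a = (\<lambda>j k::nat. (real j - real k) * \<delta>)"
  have c: "R\<^sup>2 / 2 > 0" using R by simp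
  have eq: "cis (- (x * \<xi>)) * complex_of_real (bump_sum M \<delta> R x) =
     (\<Sum>j<M. \<Sum>k<M. complex_of_real (1 / real M) * (cis (- (x * \<xi>)) * complex_of_real (exp (- (R\<^sup>2 / 2) * (x + a j k)\<^sup>2))))" for x \<xi>
    by (simp add: bump_sum_def a_def sum_distrib_left sum_divide_distrib)
  have i: "integrable lborel (\<lambda>x. complex_of_real (1 / real M) * (cis (- (x * \<xi>)) * complex_of_real (exp (- (R\<^sup>2 / 2) * (x + a j k)\<^sup>2))))" for j k \<xi>
    by (intro integrable_mult_right gaussian_shift_fourier(1)[OF c])
  have i0: "integrable lborel (\<lambda>x. cis (- (x * \<xi>)) * complex_of_real (bump_sum M \<delta> R x))" for \<xi>
    unfolding eq by (intro Bochner_Integration.integrable_sum i)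
  from i0[of 0] show "integrable lborel (bump_sum M \<delta> R)" by (simp add: complex_of_real_integrable_eq)
  have "(LINT x|lborel. cis (- (x * \<xi>)) * complex_of_real (bump_sum M \<delta> R x)) =
     (\<Sum>j<M. \<Sum>k<M. (LINT x|lborel. complex_of_real (1 / real M) * (cis (- (x * \<xi>)) * complex_of_real (exp (- (R\<^sup>2 / 2) * (x + a j k)\<^sup>2)))))"
    unfolding eq by (subst Bochner_Integration.integral_sum, intro Bochner_Integration.integrable_sum i,
      intro sum.cong refl Bochner_Integration.integral_sum i)
  also have "\<dots> = (\<Sum>j<M. \<Sum>k<M. complex_of_real (1 / real M) * (cis (a j k * \<xi>) * complex_of_real (sqrt (pi / (R\<^sup>2 / 2)) * exp (- \<xi>\<^sup>2 / (4 * (R\<^sup>2 / 2))))))"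
    by (simp only: integral_mult_right_zero gaussian_shift_fourier(2)[OF c])
  also have "\<dots> = complex_of_real (1 / real M) * ((\<Sum>j<M. \<Sum>k<M. cis (a j k * \<xi>)) * complex_of_real (sqrt (2 * pi) / R * exp (- \<xi>\<^sup>2 / (2 * R\<^sup>2))))"
  proof -
    have "sqrt (pi / (R\<^sup>2 / 2)) = sqrt (2 * pi) / R" using R by (simp add: real_sqrt_divide real_sqrt_mult)
    moreover have "4 * (R\<^sup>2 / 2) = 2 * R\<^sup>2" by simp
    ultimately show ?thesis by (simp only: sum_distrib_left sum_distrib_right)
  qed
  also have "(\<Sum>j<M. \<Sum>k<M. cis (a j k * \<xi>)) = complex_of_real ((cmod (\<Sum>j<M. cis (real j * \<delta> * \<xi>)))\<^sup>2)"
    unfolding fejer_square_expand a_def ..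
  finally show "(LINT x|lborel. cis (- (x * \<xi>)) * complex_of_real (bump_sum M \<delta> R x)) = complex_of_real (fejer_comb M \<delta> R \<xi>)"
    unfolding of_real_mult[symmetric] by (simp add: fejer_comb_def mult_ac)
qed

lemma bump_sum_integral:
  assumes R: "R > 0"
  shows "(LINT x|lborel. bump_sum M \<delta> R x) = real M * sqrt (2 * pi) / R"
proof -
  have "complex_of_real (LINT x|lborel. bump_sum M \<delta> R x) = complex_of_real (fejer_comb M \<delta> R 0)"
    using bump_sum_fourier(2)[OF R, of 0 M \<delta>] by simp
  then have "(LINT x|lborel. bump_sum M \<delta> R x) = fejer_comb M \<delta> R 0" by (simp only: of_real_eq_iff)
  then show ?thesis by (simp add: fejer_comb_def power2_eq_square)
qed

lemma bump_sum_le_0: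
  assumes R: "R > 0"
  shows "bump_sum M \<delta> R x \<le> bump_sum M \<delta> R 0"
proof -
  have "2 * pi * bump_sum M \<delta> R x = norm (LINT \<xi>|lborel. cis (x * \<xi>) * complex_of_real (fejer_comb M \<delta> R \<xi>))"
    unfolding fejer_comb_inverse[OF R] using bump_sum_nonneg[of M \<delta> R x] by (simp add: norm_mult)
  also have "\<dots> \<le> (LINT \<xi>|lborel. norm (cis (x * \<xi>) * complex_of_real (fejer_comb M \<delta> R \<xi>)))" by (rule integral_norm_bound)
  also have "\<dots> = (LINT \<xi>|lborel. fejer_comb M \<delta> R \<xi>)" using fejer_comb_nonneg[OF R] by (simp add: norm_mult)
  finally show ?thesis unfolding fejer_comb_integral[OF R] by simp
qed

text \<open>The \<open>M\<close> diagonal pairs contribute 1; every other pair is at distance at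
  least \<delta> and is bounded crudely by the same Gaussian tail.\<close>

lemma bump_sum_0_le:
  assumes R: "R > 0" and \<delta>: "\<delta> > 0"
  shows "bump_sum M \<delta> R 0 \<le> 1 + real M * exp (- (R * \<delta>)\<^sup>2 / 2)"
proof (cases "M = 0")
  case False
  let ?e = "exp (- (R * \<delta>)\<^sup>2 / 2)"
  have "exp (- (R\<^sup>2 / 2) * (0 + (real j - real k) * \<delta>)\<^sup>2) \<le> (if k = j then 1 else 0) + ?e" for j k :: nat
  proof (cases "k = j")
    case False
    have "1 \<le> \<bar>int j - int k\<bar>" using False by auto
    then have "real_of_int 1 \<le> real_of_int \<bar>int j - int k\<bar>" by (simp only: of_int_le_iff)
    then have "1 \<le> \<bar>real j - real k\<bar>" by simp
    then have "1\<^sup>2 \<le> \<bar>real j - real k\<bar>\<^sup>2" by (intro power_mono) auto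
    then have "(R * \<delta>)\<^sup>2 / 2 * 1 \<le> (R * \<delta>)\<^sup>2 / 2 * (real j - real k)\<^sup>2" by (intro mult_left_mono) auto
    then have "(R * \<delta>)\<^sup>2 / 2 \<le> (R\<^sup>2 / 2) * (0 + (real j - real k) * \<delta>)\<^sup>2" by (simp add: power_mult_distrib mult_ac)
    then show ?thesis using False by simp
  qed simp
  then have "(\<Sum>j<M. \<Sum>k<M. exp (- (R\<^sup>2 / 2) * (0 + (real j - real k) * \<delta>)\<^sup>2)) \<le> (\<Sum>j<M. \<Sum>k<M. (if k = j then 1 else 0) + ?e)"
    by (intro sum_mono)
  also have "\<dots> = (\<Sum>j<M. 1 + real M * ?e)" by (intro sum.cong) (auto simp: sum.distrib)
  also have "\<dots> = real M * (1 + real M * ?e)" by simp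
  finally show ?thesis using False by (simp add: bump_sum_def field_simps)
qed (simp add: bump_sum_def)

text \<open>Only the pairs with \<open>k = j + m\<close> are kept. They are centred exactly at the
  grid point, and there are \<open>M - m \<ge> M / 2\<close> of them.\<close>

lemma bump_sum_grid_ge:
  assumes M: "M > 0" and m: "2 * m \<le> M"
  shows "1/2 \<le> bump_sum M \<delta> R (real m * \<delta>)"
proof -
  let ?t = "\<lambda>j k. exp (- (R\<^sup>2 / 2) * (real m * \<delta> + (real j - real k) * \<delta>)\<^sup>2)"
  have "real M / 2 \<le> real (M - m)" using m by (simp add: of_nat_diff)
  also have "\<dots> = (\<Sum>j<M - m. ?t j (j + m))" by (simp add: algebra_simps)
  also have "\<dots> \<le> (\<Sum>j<M - m. \<Sum>k<M. ?t j k)"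
    by (intro sum_mono member_le_sum[where f="?t _"]) auto
  also have "\<dots> \<le> (\<Sum>j<M. \<Sum>k<M. ?t j k)" by (intro sum_mono2) (auto intro: sum_nonneg)
  finally show ?thesis using M by (simp add: bump_sum_def field_simps)
qed

section \<open>Size and error of the flow applied to a grid\<close>

text \<open>Uses \<open>1 - exp (- u) \<ge> u / (1 + u)\<close>. It replaces the natural bound
  \<open>min 2 (u * \<xi>\<^sup>2)\<close> on the multiplier error by a Gaussian expression whose
  integral against \<open>fejer_comb\<close> is explicit.\<close>

lemma min_two_le_exp:
  fixes u :: real
  assumes "u \<ge> 0"
  shows "min 2 u \<le> 4 * (1 - exp (- u))"
proof -
  have "1 + u \<le> exp u" by (rule exp_ge_add_one_self)
  then have "exp (- u) \<le> 1 / (1 + u)" using assms by (simp add: exp_minus inverse_eq_divide divide_left_mono)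
  moreover have "min 2 u \<le> 4 * (1 - 1 / (1 + u))"
  proof (cases "u \<le> 1")
    case True
    have "u * (1 + u) \<le> u * 4" using True assms by (intro mult_left_mono) auto
    then have "u \<le> 4 * (1 - 1 / (1 + u))" using assms by (simp add: field_simps)
    then show ?thesis by simp
  next
    case False
    then have "2 \<le> 4 * (1 - 1 / (1 + u))" by (simp add: field_simps)
    then show ?thesis by simp
  qed
  moreover have "4 * (1 - 1 / (1 + u)) \<le> 4 * (1 - exp (- u))" using calculation(1) by simp
  ultimately show ?thesis by (blast intro: order_trans)
qed

lemma norm_damped_cis_minus_1:
  fixes a b :: real
  assumes b: "b \<ge> 0"
  shows "norm (cis a * complex_of_real (exp (- b)) - 1) \<le> min 2 (\<bar>a\<bar> + b)"
proof -
  have "norm (cis a * complex_of_real (exp (- b)) - 1) \<le> norm (cis a * complex_of_real (exp (- b))) + norm (1::complex)"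
    by (rule norm_triangle_ineq4)
  also have "\<dots> \<le> 2" using b by (simp add: norm_mult)
  finally have 1: "norm (cis a * complex_of_real (exp (- b)) - 1) \<le> 2" .
  have c: "norm (cis a - 1) \<le> \<bar>a\<bar>"
    using iexp_approx1[of a 0] by (simp add: cis_conv_exp)
  have "cis a * complex_of_real (exp (- b)) - 1 = (cis a - 1) * complex_of_real (exp (- b)) + complex_of_real (exp (- b) - 1)"
    by (simp add: algebra_simps)
  then have "norm (cis a * complex_of_real (exp (- b)) - 1) \<le> norm ((cis a - 1) * complex_of_real (exp (- b))) + norm (complex_of_real (exp (- b) - 1))"
    using norm_triangle_ineq by metis
  also have "norm ((cis a - 1) * complex_of_real (exp (- b))) \<le> \<bar>a\<bar> * 1"
    unfolding norm_mult using b by (intro mult_mono c) auto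
  also have "norm (complex_of_real (exp (- b) - 1)) = 1 - exp (- b)"
    unfolding norm_of_real using b by simp
  also have "1 - exp (- b) \<le> b" using exp_ge_add_one_self[of "- b"] by simp
  finally show ?thesis using 1 by simp
qed

text \<open>The factor \<open>cis (x * \<xi>)\<close> has modulus 1 and drops out, so the bound does
  not depend on \<open>x\<close>. It is used with \<open>a = 0\<close> at grid points and with the
  displacement of the curve for uniform convergence.\<close>

lemma Pgamma_minus_inverse_le:
  fixes G :: "real \<Rightarrow> real"
  assumes G: "integrable lborel G" and H: "(LINT \<xi>|lborel. cis (x * \<xi>) * complex_of_real (G \<xi>)) = complex_of_real (2 * pi * h)"
  shows "norm (Pgamma \<gamma> (\<lambda>\<xi>. complex_of_real (G \<xi>)) (x + a) t - complex_of_real h) \<le>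
    1 / (2 * pi) * (LINT \<xi>|lborel. \<bar>G \<xi>\<bar> * norm (cis (a * \<xi> + t * \<xi>\<^sup>2) * complex_of_real (exp (- (t powr \<gamma> * \<xi>\<^sup>2))) - 1))"
proof -
  have [measurable]: "G \<in> borel_measurable borel" using borel_measurable_integrable[OF G] by simp
  let ?E = "\<lambda>\<xi>. cis ((x + a) * \<xi> + t * \<xi>\<^sup>2) * complex_of_real (exp (- (t powr \<gamma>) * \<xi>\<^sup>2)) * complex_of_real (G \<xi>)"
  let ?D = "\<lambda>\<xi>. cis (x * \<xi>) * complex_of_real (G \<xi>)"
  have i1: "integrable lborel ?E"
    by (rule Bochner_Integration.integrable_bound[OF G]) (auto simp: norm_mult mult_left_le_one_le)
  have i2: "integrable lborel ?D"
    by (rule Bochner_Integration.integrable_bound[OF G]) (auto simp: norm_mult)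
  have "complex_of_real h = complex_of_real (1 / (2 * pi)) * (LINT \<xi>|lborel. ?D \<xi>)" by (simp add: H)
  then have "Pgamma \<gamma> (\<lambda>\<xi>. complex_of_real (G \<xi>)) (x + a) t - complex_of_real h = complex_of_real (1 / (2 * pi)) * (LINT \<xi>|lborel. ?E \<xi> - ?D \<xi>)"
    using i1 i2 by (simp add: Pgamma_def right_diff_distrib)
  then have "norm (Pgamma \<gamma> (\<lambda>\<xi>. complex_of_real (G \<xi>)) (x + a) t - complex_of_real h) = 1 / (2 * pi) * norm (LINT \<xi>|lborel. ?E \<xi> - ?D \<xi>)"
    by (simp only: norm_mult norm_of_real) simp
  also have "\<dots> \<le> 1 / (2 * pi) * (LINT \<xi>|lborel. norm (?E \<xi> - ?D \<xi>))"
    by (intro mult_left_mono integral_norm_bound) simp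
  also have "(\<lambda>\<xi>. norm (?E \<xi> - ?D \<xi>)) = (\<lambda>\<xi>. \<bar>G \<xi>\<bar> * norm (cis (a * \<xi> + t * \<xi>\<^sup>2) * complex_of_real (exp (- (t powr \<gamma> * \<xi>\<^sup>2))) - 1))"
  proof
    fix \<xi>
    have "cis ((x + a) * \<xi> + t * \<xi>\<^sup>2) = cis (x * \<xi>) * cis (a * \<xi> + t * \<xi>\<^sup>2)" by (simp add: cis_mult algebra_simps)
    then have "?E \<xi> - ?D \<xi> = cis (x * \<xi>) * complex_of_real (G \<xi>) * (cis (a * \<xi> + t * \<xi>\<^sup>2) * complex_of_real (exp (- (t powr \<gamma> * \<xi>\<^sup>2))) - 1)"
      by (simp add: algebra_simps)
    then show "norm (?E \<xi> - ?D \<xi>) = \<bar>G \<xi>\<bar> * norm (cis (a * \<xi> + t * \<xi>\<^sup>2) * complex_of_real (exp (- (t powr \<gamma> * \<xi>\<^sup>2))) - 1)"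
      by (simp only: norm_mult norm_cis norm_of_real mult_1)
  qed
  finally show ?thesis .
qed

text \<open>Dominated convergence for an error integral that is free of \<open>x\<close>. In the
  gliding hump it ensures that a hump has already converged at the times where later humps
  act.\<close>

lemma Pgamma_uniform_convergence:
  fixes G :: "real \<Rightarrow> real"
  assumes \<gamma>: "\<gamma> > 0" and \<alpha>: "\<alpha> > 0" and G: "integrable lborel G"
    and H: "\<And>x. (LINT \<xi>|lborel. cis (x * \<xi>) * complex_of_real (G \<xi>)) = complex_of_real (2 * pi * h x)" and e: "e > 0"
  obtains T where "T > 0"
    "\<And>x t. 0 < t \<Longrightarrow> t \<le> T \<Longrightarrow> norm (Pgamma \<gamma> (\<lambda>\<xi>. complex_of_real (G \<xi>)) (x + \<bar>t\<bar> powr \<alpha>) t - complex_of_real (h x)) \<le> e"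
proof -
  have [measurable]: "G \<in> borel_measurable borel" using borel_measurable_integrable[OF G] by simp
  define E where "E = (\<lambda>t. 1 / (2 * pi) * (LINT \<xi>|lborel. \<bar>G \<xi>\<bar> * norm (cis (\<bar>t\<bar> powr \<alpha> * \<xi> + t * \<xi>\<^sup>2) * complex_of_real (exp (- (t powr \<gamma> * \<xi>\<^sup>2))) - 1)))"
  have "(E \<longlongrightarrow> 1 / (2 * pi) * 0) (at_right 0)"
    unfolding tendsto_at_iff_sequentially comp_def
  proof (intro allI impI)
    fix X :: "nat \<Rightarrow> real" assume X: "\<forall>i. X i \<in> {0<..} - {0}" "X \<longlonglongrightarrow> 0"
    have Xp: "X n > 0" for n using X by auto
    have pw: "(\<lambda>n. X n powr c) \<longlonglongrightarrow> 0" if "c > 0" for c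
      using tendsto_powr2[OF X(2) tendsto_const[of c]] that Xp by (auto simp: less_imp_le)
    have "(\<lambda>n. LINT \<xi>|lborel. \<bar>G \<xi>\<bar> * norm (cis (\<bar>X n\<bar> powr \<alpha> * \<xi> + X n * \<xi>\<^sup>2) * complex_of_real (exp (- (X n powr \<gamma> * \<xi>\<^sup>2))) - 1)) \<longlonglongrightarrow> (LINT (\<xi>::real)|lborel. 0)"
    proof (rule integral_dominated_convergence)
      show "integrable lborel (\<lambda>\<xi>. \<bar>G \<xi>\<bar> * 2)" using G by simp
      show "AE \<xi> in lborel. norm (\<bar>G \<xi>\<bar> * norm (cis (\<bar>X n\<bar> powr \<alpha> * \<xi> + X n * \<xi>\<^sup>2) * complex_of_real (exp (- (X n powr \<gamma> * \<xi>\<^sup>2))) - 1)) \<le> \<bar>G \<xi>\<bar> * 2" for n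
        using norm_damped_cis_minus_1[of "X n powr \<gamma> * _\<^sup>2" "\<bar>X n\<bar> powr \<alpha> * _ + X n * _\<^sup>2"]
        by (intro AE_I2) (auto simp: abs_mult intro!: mult_left_mono)
      show "AE \<xi> in lborel. (\<lambda>n. \<bar>G \<xi>\<bar> * norm (cis (\<bar>X n\<bar> powr \<alpha> * \<xi> + X n * \<xi>\<^sup>2) * complex_of_real (exp (- (X n powr \<gamma> * \<xi>\<^sup>2))) - 1)) \<longlonglongrightarrow> 0"
      proof (rule AE_I2)
        fix \<xi> :: real
        have "(\<lambda>n. \<bar>G \<xi>\<bar> * norm (exp (\<i> * complex_of_real (X n powr \<alpha> * \<xi> + X n * \<xi>\<^sup>2)) * complex_of_real (exp (- (X n powr \<gamma> * \<xi>\<^sup>2))) - 1)) \<longlonglongrightarrow>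
          \<bar>G \<xi>\<bar> * norm (exp (\<i> * complex_of_real (0 * \<xi> + 0 * \<xi>\<^sup>2)) * complex_of_real (exp (- (0 * \<xi>\<^sup>2))) - 1)"
          by (intro tendsto_intros pw X \<alpha> \<gamma>)
        then show "(\<lambda>n. \<bar>G \<xi>\<bar> * norm (cis (\<bar>X n\<bar> powr \<alpha> * \<xi> + X n * \<xi>\<^sup>2) * complex_of_real (exp (- (X n powr \<gamma> * \<xi>\<^sup>2))) - 1)) \<longlonglongrightarrow> 0"
          using Xp by (simp add: cis_conv_exp less_imp_le abs_of_pos)
      qed
    qed measurable
    then show "(\<lambda>n. E (X n)) \<longlonglongrightarrow> 1 / (2 * pi) * 0"
      unfolding E_def by (intro tendsto_mult_left) simp
  qed
  then have "\<forall>\<^sub>F t in at_right 0. E t < e" using e by (intro order_tendstoD) auto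
  then obtain b where b: "b > 0" "\<And>t. 0 < t \<Longrightarrow> t < b \<Longrightarrow> E t < e"
    unfolding eventually_at_right_field by auto
  show ?thesis
  proof (rule that[of "b / 2"])
    fix x t :: real assume t: "0 < t" "t \<le> b / 2"
    show "norm (Pgamma \<gamma> (\<lambda>\<xi>. complex_of_real (G \<xi>)) (x + \<bar>t\<bar> powr \<alpha>) t - complex_of_real (h x)) \<le> e"
      using Pgamma_minus_inverse_le[OF G H, of \<gamma> x "\<bar>t\<bar> powr \<alpha>" t] b(2)[of t] t b(1) unfolding E_def by linarith
  qed (use b in simp)
qed

text \<open>The supremum of \<open>G\<close> times the mass of the damping factor. In the gliding
  hump it makes a later hump negligible at times that are bounded below: its transform is small,
  while the power of \<open>t\<close> stays under control.\<close>

lemma Pgamma_bounded_le: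
  fixes G :: "real \<Rightarrow> real"
  assumes [measurable]: "G \<in> borel_measurable borel" and G: "\<And>\<xi>. \<bar>G \<xi>\<bar> \<le> m" and t: "t > 0"
  shows "integrable lborel (\<lambda>\<xi>. cis (y * \<xi> + t * \<xi>\<^sup>2) * complex_of_real (exp (- (t powr \<gamma>) * \<xi>\<^sup>2)) * complex_of_real (G \<xi>))"
    and "(LINT \<xi>|lborel. norm (cis (y * \<xi> + t * \<xi>\<^sup>2) * complex_of_real (exp (- (t powr \<gamma>) * \<xi>\<^sup>2)) * complex_of_real (G \<xi>))) \<le> m * sqrt (pi / t powr \<gamma>)"
    and "norm (Pgamma \<gamma> (\<lambda>\<xi>. complex_of_real (G \<xi>)) y t) \<le> m * t powr (- \<gamma> / 2)"
proof -
  let ?E = "\<lambda>\<xi>. cis (y * \<xi> + t * \<xi>\<^sup>2) * complex_of_real (exp (- (t powr \<gamma>) * \<xi>\<^sup>2)) * complex_of_real (G \<xi>)"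
  have m0: "m \<ge> 0" using G[of 0] by linarith
  have tg: "t powr \<gamma> > 0" using t by simp
  have gi: "integrable lborel (\<lambda>\<xi>. m * exp (- (t powr \<gamma>) * \<xi>\<^sup>2))" by (intro integrable_mult_right gaussian_integrable tg)
  have b: "norm (?E \<xi>) \<le> m * exp (- (t powr \<gamma>) * \<xi>\<^sup>2)" for \<xi>
    using G[of \<xi>] by (simp add: norm_mult mult.commute mult_right_mono)
  show i: "integrable lborel ?E"
    by (rule Bochner_Integration.integrable_bound[OF gi]) (measurable, use b m0 in \<open>auto intro: order_trans[OF b]\<close>)
  have "(LINT \<xi>|lborel. norm (?E \<xi>)) \<le> (LINT \<xi>|lborel. m * exp (- (t powr \<gamma>) * \<xi>\<^sup>2))"
    by (intro integral_mono integrable_norm i gi b)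
  also have "\<dots> = m * sqrt (pi / t powr \<gamma>)" using gaussian_integral[OF tg] by simp
  finally show n: "(LINT \<xi>|lborel. norm (?E \<xi>)) \<le> m * sqrt (pi / t powr \<gamma>)" .
  have "norm (Pgamma \<gamma> (\<lambda>\<xi>. complex_of_real (G \<xi>)) y t) = 1 / (2 * pi) * norm (LINT \<xi>|lborel. ?E \<xi>)"
    unfolding Pgamma_def norm_mult norm_of_real by simp
  also have "\<dots> \<le> 1 / (2 * pi) * (m * sqrt (pi / t powr \<gamma>))"
    by (intro mult_left_mono order_trans[OF integral_norm_bound n]) simp
  also have "sqrt (pi / t powr \<gamma>) = sqrt pi * t powr (- \<gamma> / 2)"
  proof -
    have "sqrt (t powr \<gamma>) = t powr (\<gamma> / 2)" using t by (simp add: powr_half_sqrt[symmetric] powr_powr)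
    then show ?thesis by (simp add: real_sqrt_divide powr_minus_divide)
  qed
  also have "1 / (2 * pi) * (m * (sqrt pi * t powr (- \<gamma> / 2))) = (sqrt pi / (2 * pi)) * (m * t powr (- \<gamma> / 2))" by simp
  also have "\<dots> \<le> 1 * (m * t powr (- \<gamma> / 2))"
  proof (intro mult_right_mono)
    have "1 \<le> pi" using pi_gt3 by simp
    then have "sqrt pi * 1 \<le> sqrt pi * sqrt pi" by (intro mult_left_mono) auto
    then have "sqrt pi \<le> pi" by simp
    then have "sqrt pi \<le> 2 * pi" using pi_gt_zero by linarith
    then show "sqrt pi / (2 * pi) \<le> 1" by simp
  qed (use m0 in simp)
  finally show "norm (Pgamma \<gamma> (\<lambda>\<xi>. complex_of_real (G \<xi>)) y t) \<le> m * t powr (- \<gamma> / 2)" by simp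
qed

text \<open>Since the transform is nonnegative, the error is at most 4 times the drop of
  \<open>bump_sum\<close> at 0 under the multiplier \<open>exp (- u * \<xi>\<^sup>2)\<close> with
  \<open>u = t + t powr \<gamma>\<close>. Before, the value is at most 1 plus the overlap; after, at
  least \<open>1 - u * R\<^sup>2\<close>; the ones cancel.\<close>

lemma Pgamma_fejer_error:
  assumes R: "R > 0" and \<delta>: "\<delta> > 0" and M: "M > 0" and t: "t > 0"
  shows "norm (Pgamma \<gamma> (\<lambda>\<xi>. complex_of_real (fejer_comb M \<delta> R \<xi>)) y t - complex_of_real (bump_sum M \<delta> R y)) \<le>
    4 * (real M * exp (- (R * \<delta>)\<^sup>2 / 2) + (t + t powr \<gamma>) * R\<^sup>2)"
proof -
  let ?G = "fejer_comb M \<delta> R"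
  define u where "u = t + t powr \<gamma>"
  have u: "u > 0" using t by (simp add: u_def add_pos_pos)
  define D where "D = (LINT \<xi>|lborel. exp (- u * \<xi>\<^sup>2) * ?G \<xi>)"
  note Gi = fejer_comb_integrable[OF R, of M \<delta>]
  have Di: "integrable lborel (\<lambda>\<xi>. exp (- u * \<xi>\<^sup>2) * ?G \<xi>)"
    using fejer_comb_multiplier(1)[OF R less_imp_le[OF u], of 0 M \<delta>] unfolding mult_zero_left cis_zero mult_1 complex_of_real_integrable_eq .
  define w where "w = sqrt (1 + 2 * u * R\<^sup>2)"
  have w1: "w \<ge> 1" using u by (simp add: w_def)
  have "complex_of_real D = complex_of_real (2 * pi * ((\<Sum>j<M. \<Sum>k<M. 1 / w * exp (- (R\<^sup>2 / (2 * (1 + 2 * u * R\<^sup>2))) * (0 + (real j - real k) * \<delta>)\<^sup>2)) / real M))"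
    using fejer_comb_multiplier(2)[OF R less_imp_le[OF u], of 0 M \<delta>]
    unfolding D_def w_def integral_complex_of_real[symmetric] mult_zero_left cis_zero mult_1 .
  then have Deq: "D = 2 * pi * ((\<Sum>j<M. \<Sum>k<M. 1 / w * exp (- (R\<^sup>2 / (2 * (1 + 2 * u * R\<^sup>2))) * (0 + (real j - real k) * \<delta>)\<^sup>2)) / real M)"
    by (simp only: of_real_eq_iff)
  \<comment> \<open>Lower bound by the diagonal terms alone, each equal to \<open>1 / w\<close>
    after the widening.\<close>
  have "(\<Sum>j<M. 1 / w) \<le> (\<Sum>j<M. \<Sum>k<M. 1 / w * exp (- (R\<^sup>2 / (2 * (1 + 2 * u * R\<^sup>2))) * (0 + (real j - real k) * \<delta>)\<^sup>2))"
  proof (intro sum_mono)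
    fix j assume "j \<in> {..<M}"
    then have "1 / w * exp (- (R\<^sup>2 / (2 * (1 + 2 * u * R\<^sup>2))) * (0 + (real j - real j) * \<delta>)\<^sup>2) \<le>
      (\<Sum>k<M. 1 / w * exp (- (R\<^sup>2 / (2 * (1 + 2 * u * R\<^sup>2))) * (0 + (real j - real k) * \<delta>)\<^sup>2))"
      using w1 by (intro member_le_sum[where f="\<lambda>k. 1 / w * exp (- (R\<^sup>2 / (2 * (1 + 2 * u * R\<^sup>2))) * (0 + (real j - real k) * \<delta>)\<^sup>2)"]) auto
    then show "1 / w \<le> (\<Sum>k<M. 1 / w * exp (- (R\<^sup>2 / (2 * (1 + 2 * u * R\<^sup>2))) * (0 + (real j - real k) * \<delta>)\<^sup>2))" by simp
  qed
  then have "1 / w \<le> (\<Sum>j<M. \<Sum>k<M. 1 / w * exp (- (R\<^sup>2 / (2 * (1 + 2 * u * R\<^sup>2))) * (0 + (real j - real k) * \<delta>)\<^sup>2)) / real M"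
    using M by (simp add: field_simps)
  then have D1: "2 * pi * (1 / w) \<le> D" unfolding Deq by (intro mult_left_mono) auto
  have wle: "1 - u * R\<^sup>2 \<le> 1 / w"
  proof -
    have "1 + 2 * u * R\<^sup>2 \<le> (1 + u * R\<^sup>2)\<^sup>2" using zero_le_power2[of "u * R\<^sup>2"] by (simp add: power2_sum)
    then have "w \<le> sqrt ((1 + u * R\<^sup>2)\<^sup>2)" unfolding w_def by (rule real_sqrt_le_mono)
    also have "\<dots> = 1 + u * R\<^sup>2" using u by simp
    finally have "1 / (1 + u * R\<^sup>2) \<le> 1 / w" using w1 by (intro divide_left_mono) auto
    moreover have "1 - u * R\<^sup>2 \<le> 1 / (1 + u * R\<^sup>2)"
    proof -
      have "0 < 1 + u * R\<^sup>2" using u by (simp add: add_pos_nonneg)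
      moreover have "(1 - u * R\<^sup>2) * (1 + u * R\<^sup>2) \<le> 1"
        using zero_le_power2[of "u * R\<^sup>2"] by (simp add: power2_eq_square algebra_simps)
      ultimately show ?thesis by (simp add: pos_le_divide_eq)
    qed
    ultimately show ?thesis by linarith
  qed
  have "norm (Pgamma \<gamma> (\<lambda>\<xi>. complex_of_real (?G \<xi>)) (y + 0) t - complex_of_real (bump_sum M \<delta> R y)) \<le>
    1 / (2 * pi) * (LINT \<xi>|lborel. \<bar>?G \<xi>\<bar> * norm (cis (0 * \<xi> + t * \<xi>\<^sup>2) * complex_of_real (exp (- (t powr \<gamma> * \<xi>\<^sup>2))) - 1))"
    by (rule Pgamma_minus_inverse_le[OF Gi fejer_comb_inverse[OF R]])
  also have "\<dots> \<le> 1 / (2 * pi) * (LINT \<xi>|lborel. 4 * (?G \<xi> - exp (- u * \<xi>\<^sup>2) * ?G \<xi>))"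
  proof (intro mult_left_mono integral_mono)
    show "integrable lborel (\<lambda>\<xi>. 4 * (?G \<xi> - exp (- u * \<xi>\<^sup>2) * ?G \<xi>))" using Gi Di by simp
    show "integrable lborel (\<lambda>\<xi>. \<bar>?G \<xi>\<bar> * norm (cis (0 * \<xi> + t * \<xi>\<^sup>2) * complex_of_real (exp (- (t powr \<gamma> * \<xi>\<^sup>2))) - 1))"
    proof (rule Bochner_Integration.integrable_bound)
      show "integrable lborel (\<lambda>\<xi>. ?G \<xi> * 2)" using Gi by simp
      show "AE \<xi> in lborel. norm (\<bar>?G \<xi>\<bar> * norm (cis (0 * \<xi> + t * \<xi>\<^sup>2) * complex_of_real (exp (- (t powr \<gamma> * \<xi>\<^sup>2))) - 1)) \<le> norm (?G \<xi> * 2)"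
      proof (rule AE_I2)
        fix \<xi> :: real
        have "norm (cis (0 * \<xi> + t * \<xi>\<^sup>2) * complex_of_real (exp (- (t powr \<gamma> * \<xi>\<^sup>2))) - 1) \<le> 2"
          using norm_damped_cis_minus_1[of "t powr \<gamma> * \<xi>\<^sup>2" "0 * \<xi> + t * \<xi>\<^sup>2"] by simp
        then have "\<bar>?G \<xi>\<bar> * norm (cis (0 * \<xi> + t * \<xi>\<^sup>2) * complex_of_real (exp (- (t powr \<gamma> * \<xi>\<^sup>2))) - 1) \<le> \<bar>?G \<xi>\<bar> * 2"
          by (intro mult_left_mono) auto
        then show "norm (\<bar>?G \<xi>\<bar> * norm (cis (0 * \<xi> + t * \<xi>\<^sup>2) * complex_of_real (exp (- (t powr \<gamma> * \<xi>\<^sup>2))) - 1)) \<le> norm (?G \<xi> * 2)"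
          by (simp only: real_norm_def abs_mult abs_idempotent abs_norm_cancel)
      qed
    qed measurable
    fix \<xi> :: real
    have "norm (cis (0 * \<xi> + t * \<xi>\<^sup>2) * complex_of_real (exp (- (t powr \<gamma> * \<xi>\<^sup>2))) - 1) \<le> min 2 (\<bar>0 * \<xi> + t * \<xi>\<^sup>2\<bar> + t powr \<gamma> * \<xi>\<^sup>2)"
      by (rule norm_damped_cis_minus_1) simp
    also have "\<bar>0 * \<xi> + t * \<xi>\<^sup>2\<bar> + t powr \<gamma> * \<xi>\<^sup>2 = u * \<xi>\<^sup>2" using t by (simp add: u_def algebra_simps abs_mult)
    also have "min 2 (u * \<xi>\<^sup>2) \<le> 4 * (1 - exp (- (u * \<xi>\<^sup>2)))" using u by (intro min_two_le_exp) simp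
    finally have "\<bar>?G \<xi>\<bar> * norm (cis (0 * \<xi> + t * \<xi>\<^sup>2) * complex_of_real (exp (- (t powr \<gamma> * \<xi>\<^sup>2))) - 1) \<le> \<bar>?G \<xi>\<bar> * (4 * (1 - exp (- (u * \<xi>\<^sup>2))))"
      by (intro mult_left_mono) auto
    then show "\<bar>?G \<xi>\<bar> * norm (cis (0 * \<xi> + t * \<xi>\<^sup>2) * complex_of_real (exp (- (t powr \<gamma> * \<xi>\<^sup>2))) - 1) \<le> 4 * (?G \<xi> - exp (- u * \<xi>\<^sup>2) * ?G \<xi>)"
      using fejer_comb_nonneg[OF R, of M \<delta> \<xi>] by (simp add: algebra_simps)
  qed simp
  also have "(LINT \<xi>|lborel. 4 * (?G \<xi> - exp (- u * \<xi>\<^sup>2) * ?G \<xi>)) = 4 * (2 * pi * bump_sum M \<delta> R 0 - D)"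
    using Gi Di by (simp add: D_def fejer_comb_integral[OF R])
  also have "1 / (2 * pi) * (4 * (2 * pi * bump_sum M \<delta> R 0 - D)) \<le> 1 / (2 * pi) * (4 * (2 * pi * (1 + real M * exp (- (R * \<delta>)\<^sup>2 / 2)) - 2 * pi * (1 - u * R\<^sup>2)))"
  proof -
    have "2 * pi * bump_sum M \<delta> R 0 \<le> 2 * pi * (1 + real M * exp (- (R * \<delta>)\<^sup>2 / 2))"
      by (intro mult_left_mono bump_sum_0_le R \<delta>) simp
    moreover have "2 * pi * (1 - u * R\<^sup>2) \<le> 2 * pi * (1 / w)" using wle by (intro mult_left_mono) auto
    ultimately show ?thesis using D1 by (intro mult_left_mono) (linarith, simp_all)
  qed
  also have "\<dots> = 4 * (real M * exp (- (R * \<delta>)\<^sup>2 / 2) + (t + t powr \<gamma>) * R\<^sup>2)"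
    unfolding right_diff_distrib[of "2 * pi", symmetric] by (simp add: u_def)
  finally show ?thesis by simp
qed

text \<open>One factor of the square, multiplied by the weight, is bounded by a constant; the other
  is integrated exactly by inversion at 0.\<close>

lemma fejer_comb_sobolev:
  assumes R: "R \<ge> 1" and s: "0 \<le> s" "s \<le> 1/2"
  shows "integrable lborel (\<lambda>\<xi>. (1 + \<xi>\<^sup>2) powr s * (fejer_comb M \<delta> R \<xi>)\<^sup>2)"
    and "(LINT \<xi>|lborel. (1 + \<xi>\<^sup>2) powr s * (fejer_comb M \<delta> R \<xi>)\<^sup>2) \<le> real M * sqrt (2 * pi) / R * R powr (2 * s) * (2 * pi * bump_sum M \<delta> R 0)"
proof -
  have R0: "R > 0" using R by simp
  let ?G = "fejer_comb M \<delta> R"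
  define c where "c = real M * sqrt (2 * pi) / R * R powr (2 * s)"
  note Gi = fejer_comb_integrable[OF R0, of M \<delta>]
  have b: "(1 + \<xi>\<^sup>2) powr s * (?G \<xi>)\<^sup>2 \<le> c * ?G \<xi>" for \<xi>
  proof -
    \<comment> \<open>In this variable the weight is at most
      \<open>R powr (2 * s) * exp (v / 2)\<close>, by \<open>R \<ge> 1\<close> and
      \<open>s \<le> 1/2\<close>, and the Gaussian in \<open>fejer_comb\<close> is exactly
      \<open>exp (- (v / 2))\<close>.\<close>
    define v where "v = \<xi>\<^sup>2 / R\<^sup>2"
    have v: "v \<ge> 0" by (simp add: v_def)
    have "1 + \<xi>\<^sup>2 \<le> R\<^sup>2 * (1 + v)" using R by (simp add: v_def algebra_simps)
    then have "(1 + \<xi>\<^sup>2) powr s \<le> (R\<^sup>2 * (1 + v)) powr s" using s by (intro powr_mono2) (auto simp: add_nonneg_nonneg)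
    also have "\<dots> = (R\<^sup>2) powr s * (1 + v) powr s" using v by (intro powr_mult)
    also have "(R\<^sup>2) powr s = R powr (2 * s)" using R0 powr_powr[of R 2 s] by simp
    also have "R powr (2 * s) * (1 + v) powr s \<le> R powr (2 * s) * exp (v / 2)"
    proof (intro mult_left_mono)
      have "(1 + v) powr s \<le> (1 + v) powr (1/2)" using v s by (intro powr_mono) auto
      also have "\<dots> \<le> exp v powr (1/2)" using v exp_ge_add_one_self[of v] by (intro powr_mono2) auto
      also have "\<dots> = exp (v / 2)" by (simp add: powr_def)
      finally show "(1 + v) powr s \<le> exp (v / 2)" .
    qed simp
    finally have 1: "(1 + \<xi>\<^sup>2) powr s \<le> R powr (2 * s) * exp (v / 2)" .
    have 2: "?G \<xi> \<le> real M * sqrt (2 * pi) / R * exp (- (v / 2))"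
      using fejer_comb_le[OF R0, of M \<delta> \<xi>] by (simp add: v_def mult.commute)
    have "(1 + \<xi>\<^sup>2) powr s * ?G \<xi> \<le> (R powr (2 * s) * exp (v / 2)) * (real M * sqrt (2 * pi) / R * exp (- (v / 2)))"
      by (intro mult_mono 1 2 fejer_comb_nonneg R0) simp
    also have "\<dots> = c * (exp (v / 2) * exp (- (v / 2)))" by (simp add: c_def)
    also have "\<dots> = c" by (simp add: mult_exp_exp)
    finally have "((1 + \<xi>\<^sup>2) powr s * ?G \<xi>) * ?G \<xi> \<le> c * ?G \<xi>"
      by (intro mult_right_mono fejer_comb_nonneg R0)
    then show ?thesis by (simp add: power2_eq_square mult.assoc)
  qed
  have ci: "integrable lborel (\<lambda>\<xi>. c * ?G \<xi>)" using Gi by simp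
  show i: "integrable lborel (\<lambda>\<xi>. (1 + \<xi>\<^sup>2) powr s * (?G \<xi>)\<^sup>2)"
  proof (rule Bochner_Integration.integrable_bound[OF ci])
    show "AE \<xi> in lborel. norm ((1 + \<xi>\<^sup>2) powr s * (?G \<xi>)\<^sup>2) \<le> norm (c * ?G \<xi>)"
      using b by (intro AE_I2) (simp add: order_trans[OF b abs_ge_self])
  qed measurable
  have "(LINT \<xi>|lborel. (1 + \<xi>\<^sup>2) powr s * (?G \<xi>)\<^sup>2) \<le> (LINT \<xi>|lborel. c * ?G \<xi>)"
    by (rule integral_mono[OF i ci b])
  also have "\<dots> = c * (2 * pi * bump_sum M \<delta> R 0)" by (simp add: fejer_comb_integral[OF R0])
  finally show "(LINT \<xi>|lborel. (1 + \<xi>\<^sup>2) powr s * (?G \<xi>)\<^sup>2) \<le> real M * sqrt (2 * pi) / R * R powr (2 * s) * (2 * pi * bump_sum M \<delta> R 0)"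
    by (simp add: c_def)
qed

text \<open>For \<gamma> \<le> 1, \<open>0 \<le> s < s_crit\<close> rules out that the positive part
  in \<open>s_crit\<close> is 0, so it can be removed.\<close>

lemma s_crit_strict_exponent:
  assumes "\<gamma> > 0" "\<alpha> > 0" "0 \<le> s" "s < s_crit \<gamma> \<alpha>"
  shows "s < 1/2 - \<alpha> / min 1 \<gamma>"
proof (cases "\<gamma> \<le> 1")
  case True
  have "s < max (1/2 - \<alpha> / \<gamma>) 0" using assms(4) by (simp add: s_crit_def)
  then have "s < 1/2 - \<alpha> / \<gamma>" using assms(3) by (auto simp: max_def split: if_splits)
  then show ?thesis using True by (simp add: min_def)
next
  case False
  have "s < 1/2 - \<alpha>" using assms(4) by (simp add: s_crit_def)
  then show ?thesis using False by (simp add: min_def)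
qed

text \<open>In order: the overlap of neighbouring bumps, the frequency \<open>R\<close>, the mass
  and the Sobolev norm, and the latest hitting time. The condition \<open>a > 1\<close> says that
  bumps are much narrower than their spacing.\<close>

lemma bump_scale_asymptotics:
  fixes a \<kappa> b c :: real
  assumes "a > 1" "\<kappa> > 0" "b > 0"
  shows "((\<lambda>\<delta>. 7 / \<delta> * exp (- (\<kappa> * \<delta> powr (1 - a))\<^sup>2 / 2)) \<longlongrightarrow> 0) (at_right 0)"
    and "filterlim (\<lambda>\<delta>. \<kappa> * \<delta> powr (- a)) at_top (at_right 0)"
    and "((\<lambda>\<delta>::real. c * \<delta> powr b) \<longlongrightarrow> 0) (at_right 0)"
    and "((\<lambda>\<delta>::real. (2 * \<delta>) powr b) \<longlongrightarrow> 0) (at_right 0)"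
  using assms by real_asymp+

text \<open>With bumps of width \<open>1 / R\<close> at spacing \<open>\<delta>\<close>, every point of \<open>[0, 1]\<close> is carried by the
  curve onto a bump within time \<open>(2 * \<delta>) powr (1 / \<alpha>)\<close>. The choice
  \<open>R \<approx> \<delta> powr (- min 1 \<gamma> / (2 * \<alpha>))\<close> is the largest for which the flow leaves the bumps
  unchanged up to this time.\<close>

lemma building_block:
  assumes \<gamma>: "\<gamma> > 0" and \<alpha>: "\<alpha> > 0" "\<alpha> \<le> 1/4" and s: "0 \<le> s" "s < s_crit \<gamma> \<alpha>" and e: "e > 0" and T: "T > 0"
  obtains M \<delta> R \<tau> where "M > 0" "\<delta> > 0" "R \<ge> 1" "0 < \<tau>" "\<tau> \<le> T"
    "real M * sqrt (2 * pi) / R \<le> e"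
    "(LINT x|lborel. (bump_sum M \<delta> R x)\<^sup>2) \<le> e"
    "(LINT \<xi>|lborel. (1 + \<xi>\<^sup>2) powr s * (fejer_comb M \<delta> R \<xi>)\<^sup>2) \<le> e"
    "\<And>x. x \<in> {0..1} \<Longrightarrow> \<exists>t\<in>{\<tau>..T}. 1/4 \<le> norm (Pgamma \<gamma> (\<lambda>\<xi>. complex_of_real (fejer_comb M \<delta> R \<xi>)) (x + \<bar>t\<bar> powr \<alpha>) t)"
proof -
  define \<sigma> where "\<sigma> = min 1 \<gamma>"
  have \<sigma>: "0 < \<sigma>" "\<sigma> \<le> 1" "\<sigma> \<le> \<gamma>" using \<gamma> by (auto simp: \<sigma>_def)
  have sc: "s < 1/2 - \<alpha> / \<sigma>" unfolding \<sigma>_def by (rule s_crit_strict_exponent[OF \<gamma> \<alpha>(1) s])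
  have s2: "s \<le> 1/2" using sc \<alpha> \<sigma> by (smt (verit) divide_pos_pos)
  \<comment> \<open>The exponent in \<open>R = \<kappa> * \<delta> powr (- a)\<close>: hitting times
    are of order \<delta> powr (1 / \<alpha>), and their power \<sigma> times
    \<open>R\<^sup>2\<close> has to stay bounded.\<close>
  define a where "a = \<sigma> / (2 * \<alpha>)"
  have "\<alpha> / \<sigma> < 1/2" using sc s by simp
  then have a: "a > 1" using \<alpha> \<sigma> by (simp add: a_def field_simps)
  \<comment> \<open>The squared Sobolev norm is at most of order \<delta> powr (a * (1 - 2 * s) -
    1), so positivity of this exponent is the hypothesis on \<open>s\<close> in the form
    needed.\<close>
  have ab: "a * (1 - 2 * s) - 1 > 0"
  proof -
    have "2 * (\<alpha> / \<sigma>) < 1 - 2 * s" using sc by simp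
    then have "a * (2 * (\<alpha> / \<sigma>)) < a * (1 - 2 * s)" using a by (intro mult_strict_left_mono) auto
    moreover have "a * (2 * (\<alpha> / \<sigma>)) = 1" using \<alpha> \<sigma> by (simp add: a_def)
    ultimately show ?thesis by linarith
  qed
  \<comment> \<open>Chosen so that \<open>(t + t powr \<gamma>) * R\<^sup>2 \<le> 2 * 2 powr (2 * a)
    * \<kappa>\<^sup>2 = 1/32\<close>. With the overlap also below 1/32 the error is at most 1/4,
    half the height at a grid point.\<close>
  define \<kappa> where "\<kappa> = sqrt (1 / (64 * 2 powr (2 * a)))"
  have \<kappa>: "\<kappa> > 0" "\<kappa>\<^sup>2 = 1 / (64 * 2 powr (2 * a))" by (auto simp: \<kappa>_def)
  define R where "R = (\<lambda>\<delta>. \<kappa> * \<delta> powr (- a))"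
  \<comment> \<open>The 7 comes from \<open>M \<le> 7 / \<delta>\<close>, and \<open>4 * pi\<close>
    from \<open>2 * pi * bump_sum M \<delta> r 0\<close> with
    \<open>bump_sum M \<delta> r 0 \<le> 2\<close>.\<close>
  define c where "c = 7 * sqrt (2 * pi) * (4 * pi)"
  have c0: "c > 0" by (simp add: c_def)
  have E1: "\<forall>\<^sub>F \<delta> in at_right 0. R \<delta> \<ge> 1"
    unfolding R_def using bump_scale_asymptotics(2)[OF a \<kappa>(1), of 1] by (auto simp: filterlim_at_top)
  have E2: "\<forall>\<^sub>F \<delta> in at_right 0. 7 / \<delta> * exp (- (\<kappa> * \<delta> powr (1 - a))\<^sup>2 / 2) < 1/32"
    using bump_scale_asymptotics(1)[OF a \<kappa>(1), of 1] by (intro order_tendstoD) auto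
  have E3: "\<forall>\<^sub>F \<delta> in at_right 0. c / \<kappa> * \<delta> powr (a - 1) < e"
    using bump_scale_asymptotics(3)[OF a \<kappa>(1), of "a - 1" "c / \<kappa>"] a e by (intro order_tendstoD) auto
  have E4: "\<forall>\<^sub>F \<delta> in at_right 0. c * \<kappa> powr (2 * s - 1) * \<delta> powr (a * (1 - 2 * s) - 1) < e"
    using bump_scale_asymptotics(3)[OF a \<kappa>(1) ab, of "c * \<kappa> powr (2 * s - 1)"] e by (intro order_tendstoD) auto
  have E5: "\<forall>\<^sub>F \<delta> in at_right 0. (2 * \<delta>) powr (1 / \<alpha>) < T"
    using bump_scale_asymptotics(4)[OF a \<kappa>(1), of "1 / \<alpha>"] \<alpha> T by (intro order_tendstoD) auto
  have E6: "\<forall>\<^sub>F \<delta> in at_right (0::real). \<delta> > 0 \<and> \<delta> < 1/2"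
    by (rule eventually_at_rightI[of 0 "1/2"]) auto
  have ev: "\<forall>\<^sub>F \<delta> in at_right 0. R \<delta> \<ge> 1 \<and> 7 / \<delta> * exp (- (\<kappa> * \<delta> powr (1 - a))\<^sup>2 / 2) < 1/32 \<and> c / \<kappa> * \<delta> powr (a - 1) < e
     \<and> c * \<kappa> powr (2 * s - 1) * \<delta> powr (a * (1 - 2 * s) - 1) < e \<and> (2 * \<delta>) powr (1 / \<alpha>) < T \<and> \<delta> > 0 \<and> \<delta> < 1/2"
    using E1 E2 E3 E4 E5 E6 by eventually_elim blast
  obtain \<delta> where R1: "R \<delta> \<ge> 1" and eta: "7 / \<delta> * exp (- (\<kappa> * \<delta> powr (1 - a))\<^sup>2 / 2) < 1/32"
    and e3: "c / \<kappa> * \<delta> powr (a - 1) < e" and e4: "c * \<kappa> powr (2 * s - 1) * \<delta> powr (a * (1 - 2 * s) - 1) < e"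
    and e5: "(2 * \<delta>) powr (1 / \<alpha>) < T" and \<delta>: "\<delta> > 0" "\<delta> < 1/2"
    using eventually_happens'[OF trivial_limit_at_right_real ev] by blast
  define r where "r = R \<delta>"
  have r: "r \<ge> 1" "r > 0" "r = \<kappa> * \<delta> powr (- a)" using R1 by (auto simp: r_def R_def)
  \<comment> \<open>The grid index used below is at most \<open>3 / \<delta>\<close>, and
    \<open>bump_sum_grid_ge\<close> asks for twice that index to be at most
    \<open>M\<close>.\<close>
  define M where "M = nat \<lceil>6 / \<delta>\<rceil>"
  have M6: "6 / \<delta> \<le> real M" unfolding M_def by (rule real_nat_ceiling_ge)
  have M0: "M > 0" using M6 \<delta> by (cases M) (auto simp: field_simps)
  have M7: "real M \<le> 7 / \<delta>"
  proof -
    have "0 \<le> 6 / \<delta>" using \<delta> by simp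
    then have "real M < 6 / \<delta> + 1" unfolding M_def by linarith
    also have "1 \<le> 1 / \<delta>" using \<delta> by simp
    finally show ?thesis by simp
  qed
  have "r * \<delta> = \<kappa> * (\<delta> powr (- a) * \<delta> powr 1)" using r \<delta> by simp
  also have "\<dots> = \<kappa> * \<delta> powr (1 - a)" by (simp only: powr_add[symmetric]) simp
  finally have r\<delta>: "r * \<delta> = \<kappa> * \<delta> powr (1 - a)" .
  have eta': "real M * exp (- (r * \<delta>)\<^sup>2 / 2) < 1/32"
    unfolding r\<delta> by (rule order_le_less_trans[OF mult_right_mono[OF M7] eta]) simp
  have b0: "bump_sum M \<delta> r 0 \<le> 2" using bump_sum_0_le[OF r(2) \<delta>(1), of M] eta' by simp
  have mass: "real M * sqrt (2 * pi) / r * (4 * pi) \<le> c / \<kappa> * \<delta> powr (a - 1)"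
  proof -
    have "real M * sqrt (2 * pi) / r * (4 * pi) \<le> 7 / \<delta> * sqrt (2 * pi) / r * (4 * pi)"
      using r M7 by (intro mult_right_mono divide_right_mono) auto
    also have "\<dots> = c / \<kappa> * (1 / (\<delta> powr 1 * \<delta> powr (- a)))" using \<delta> r(3) by (simp add: c_def)
    also have "1 / (\<delta> powr 1 * \<delta> powr (- a)) = \<delta> powr (a - 1)"
      unfolding powr_add[symmetric] using powr_minus_divide[of \<delta> "1 + - a"] by simp
    finally show ?thesis .
  qed
  have m1: "real M * sqrt (2 * pi) / r \<le> e" "real M * sqrt (2 * pi) / r * 2 \<le> e"
  proof -
    have m0: "0 \<le> real M * sqrt (2 * pi) / r" using r by simp
    have "real M * sqrt (2 * pi) / r * 2 \<le> real M * sqrt (2 * pi) / r * (4 * pi)"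
      using pi_gt3 m0 by (intro mult_left_mono) auto
    then show "real M * sqrt (2 * pi) / r * 2 \<le> e" using mass e3 by linarith
    moreover have "m \<le> e" if "m * 2 \<le> e" "0 \<le> m" for m using that by linarith
    ultimately show "real M * sqrt (2 * pi) / r \<le> e" using m0 by blast
  qed
  note Hi = bump_sum_fourier(1)[OF r(2), of M \<delta>]
  have L2: "(LINT x|lborel. (bump_sum M \<delta> r x)\<^sup>2) \<le> e"
  proof -
    have b: "(bump_sum M \<delta> r x)\<^sup>2 \<le> 2 * bump_sum M \<delta> r x" for x
      using bump_sum_le_0[OF r(2), of M \<delta> x] b0 bump_sum_nonneg[of M \<delta> r x] unfolding power2_eq_square by (intro mult_right_mono) auto
    have i2: "integrable lborel (\<lambda>x. 2 * bump_sum M \<delta> r x)" using Hi by simp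
    have "integrable lborel (\<lambda>x. (bump_sum M \<delta> r x)\<^sup>2)"
    proof (rule Bochner_Integration.integrable_bound[OF i2])
      show "AE x in lborel. norm ((bump_sum M \<delta> r x)\<^sup>2) \<le> norm (2 * bump_sum M \<delta> r x)"
        using b by (intro AE_I2) (simp add: order_trans[OF b abs_ge_self])
    qed measurable
    then have "(LINT x|lborel. (bump_sum M \<delta> r x)\<^sup>2) \<le> (LINT x|lborel. 2 * bump_sum M \<delta> r x)"
      using i2 b by (rule integral_mono)
    also have "\<dots> = real M * sqrt (2 * pi) / r * 2" by (simp add: bump_sum_integral[OF r(2)])
    finally show ?thesis using m1(2) by linarith
  qed
  have Hs: "(LINT \<xi>|lborel. (1 + \<xi>\<^sup>2) powr s * (fejer_comb M \<delta> r \<xi>)\<^sup>2) \<le> e"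
  proof -
    have "(LINT \<xi>|lborel. (1 + \<xi>\<^sup>2) powr s * (fejer_comb M \<delta> r \<xi>)\<^sup>2) \<le> real M * sqrt (2 * pi) / r * r powr (2 * s) * (2 * pi * bump_sum M \<delta> r 0)"
      by (rule fejer_comb_sobolev(2)[OF r(1) s(1) s2])
    also have "\<dots> \<le> (7 / \<delta>) * sqrt (2 * pi) / r * r powr (2 * s) * (2 * pi * 2)"
      using r M7 b0 bump_sum_nonneg[of M \<delta> r 0] \<delta> by (intro mult_mono mult_right_mono divide_right_mono) auto
    also have "\<dots> = c * (r powr (2 * s) / r powr 1) / \<delta>" using r(2) by (simp add: c_def mult_ac)
    also have "r powr (2 * s) / r powr 1 = r powr (2 * s - 1)" by (rule powr_diff[symmetric])
    also have "r powr (2 * s - 1) = \<kappa> powr (2 * s - 1) * (\<delta> powr (- a)) powr (2 * s - 1)"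
      unfolding r(3) by (rule powr_mult)
    also have "(\<delta> powr (- a)) powr (2 * s - 1) = \<delta> powr (a * (1 - 2 * s))"
      unfolding powr_powr by (simp add: algebra_simps)
    also have "c * (\<kappa> powr (2 * s - 1) * \<delta> powr (a * (1 - 2 * s))) / \<delta> = c * \<kappa> powr (2 * s - 1) * \<delta> powr (a * (1 - 2 * s) - 1)"
      using \<delta> by (simp add: powr_diff)
    finally show ?thesis using e4 by linarith
  qed
  define \<tau> where "\<tau> = \<delta> powr (1 / \<alpha>)"
  have \<tau>: "\<tau> > 0" using \<delta> by (simp add: \<tau>_def)
  have \<tau>T: "\<tau> \<le> T"
  proof -
    have "\<tau> \<le> (2 * \<delta>) powr (1 / \<alpha>)" unfolding \<tau>_def using \<delta> \<alpha> by (intro powr_mono2) auto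
    then show ?thesis using e5 by linarith
  qed
  have hit: "\<exists>t\<in>{\<tau>..T}. 1/4 \<le> norm (Pgamma \<gamma> (\<lambda>\<xi>. complex_of_real (fejer_comb M \<delta> r \<xi>)) (x + \<bar>t\<bar> powr \<alpha>) t)"
    if x: "x \<in> {0..1}" for x
  proof -
    \<comment> \<open>Going one grid point beyond the next one puts the distance \<open>d\<close>
      from \<open>x\<close> between \<delta> and \<open>2 * \<delta>\<close>; the hitting time is
      thus bounded below by \<tau> as well as above.\<close>
    define m where "m = nat (\<lceil>x / \<delta>\<rceil> + 1)"
    have x0: "0 \<le> x / \<delta>" using x \<delta> by simp
    then have "0 \<le> \<lceil>x / \<delta>\<rceil>" by linarith
    then have mr: "real m = real_of_int \<lceil>x / \<delta>\<rceil> + 1" by (simp add: m_def)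
    have "x / \<delta> \<le> real_of_int \<lceil>x / \<delta>\<rceil>" "real_of_int \<lceil>x / \<delta>\<rceil> < x / \<delta> + 1" by linarith+
    then have m1: "x / \<delta> + 1 \<le> real m" and m2: "real m \<le> x / \<delta> + 2" using mr by linarith+
    define d where "d = real m * \<delta> - x"
    have d: "\<delta> \<le> d" "d \<le> 2 * \<delta>"
      using mult_right_mono[OF m1, of \<delta>] mult_right_mono[OF m2, of \<delta>] \<delta> by (auto simp: d_def distrib_right)
    define t where "t = d powr (1 / \<alpha>)"
    have d0: "d > 0" using d \<delta> by linarith
    then have t0: "t > 0" by (simp add: t_def)
    have t\<tau>: "\<tau> \<le> t" unfolding \<tau>_def t_def using d \<delta> \<alpha> by (intro powr_mono2) auto
    have t2: "t \<le> (2 * \<delta>) powr (1 / \<alpha>)" unfolding t_def using d d0 \<alpha> by (intro powr_mono2) auto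
    have "t powr \<alpha> = d" using d0 \<alpha> by (simp add: t_def powr_powr)
    then have pos: "x + \<bar>t\<bar> powr \<alpha> = real m * \<delta>" using t0 by (simp add: d_def)
    have "(2 * \<delta>) powr (1 / \<alpha>) \<le> 1" using \<delta> \<alpha> by (intro powr_le1) auto
    then have t1: "t \<le> 1" using t2 by linarith
    have "t + t powr \<gamma> \<le> t powr \<sigma> + t powr \<sigma>"
    proof (intro add_mono)
      show "t powr \<gamma> \<le> t powr \<sigma>" using t0 t1 \<sigma> by (intro powr_mono') auto
      have "t powr 1 \<le> t powr \<sigma>" using t0 t1 \<sigma> by (intro powr_mono') auto
      then show "t \<le> t powr \<sigma>" using t0 by simp
    qed
    also have "\<dots> = 2 * t powr \<sigma>" by simp
    also have "\<dots> \<le> 2 * ((2 * \<delta>) powr (1 / \<alpha>)) powr \<sigma>" using t2 t0 \<sigma> by (intro mult_left_mono powr_mono2) auto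
    also have "((2 * \<delta>) powr (1 / \<alpha>)) powr \<sigma> = (2 * \<delta>) powr (2 * a)"
      unfolding powr_powr using \<alpha> by (simp add: a_def)
    finally have "(t + t powr \<gamma>) * r\<^sup>2 \<le> 2 * (2 * \<delta>) powr (2 * a) * r\<^sup>2" by (intro mult_right_mono) auto
    also have "\<dots> = 2 * (2 powr (2 * a) * \<kappa>\<^sup>2) * (\<delta> powr (2 * a) * (\<delta> powr (- a))\<^sup>2)"
      using \<delta> by (simp add: r(3) powr_mult power_mult_distrib)
    also have "(\<delta> powr (- a))\<^sup>2 = \<delta> powr (- (2 * a))"
      by (simp add: power2_eq_square powr_add[symmetric])
    also have "\<delta> powr (2 * a) * \<delta> powr (- (2 * a)) = 1" using \<delta> by (simp add: powr_add[symmetric])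
    also have "2 powr (2 * a) * \<kappa>\<^sup>2 = 1/64" by (simp add: \<kappa>(2))
    finally have u: "(t + t powr \<gamma>) * r\<^sup>2 \<le> 1/32" by simp
    have "2 * real m \<le> real M"
    proof -
      have "x / \<delta> \<le> 1 / \<delta>" using x \<delta> by (simp add: divide_right_mono)
      moreover have "1 \<le> 1 / \<delta>" using \<delta> by simp
      ultimately have "real m \<le> 3 * (1 / \<delta>)" using m2 by linarith
      moreover have "6 / \<delta> = 6 * (1 / \<delta>)" by simp
      ultimately show ?thesis using M6 by linarith
    qed
    then have "2 * m \<le> M" by linarith
    then have half: "1/2 \<le> bump_sum M \<delta> r (real m * \<delta>)" by (rule bump_sum_grid_ge[OF M0])
    let ?P = "Pgamma \<gamma> (\<lambda>\<xi>. complex_of_real (fejer_comb M \<delta> r \<xi>)) (real m * \<delta>) t"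
    have "norm (?P - complex_of_real (bump_sum M \<delta> r (real m * \<delta>))) \<le> 4 * (real M * exp (- (r * \<delta>)\<^sup>2 / 2) + (t + t powr \<gamma>) * r\<^sup>2)"
      by (rule Pgamma_fejer_error[OF r(2) \<delta>(1) M0 t0])
    also have "\<dots> \<le> 1/4" using eta' u by simp
    finally have "norm (?P - complex_of_real (bump_sum M \<delta> r (real m * \<delta>))) \<le> 1/4" .
    moreover have "norm (complex_of_real (bump_sum M \<delta> r (real m * \<delta>))) = bump_sum M \<delta> r (real m * \<delta>)"
      using bump_sum_nonneg[of M \<delta> r "real m * \<delta>"] by simp
    ultimately have "1/4 \<le> norm ?P"
      using half norm_triangle_ineq2[of "complex_of_real (bump_sum M \<delta> r (real m * \<delta>))" ?P] by (simp add: norm_minus_commute)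
    then show ?thesis unfolding pos[symmetric] using t\<tau> t2 e5 by (intro bexI[of _ t]) auto
  qed
  show ?thesis by (rule that[OF M0 \<delta>(1) r(1) \<tau> \<tau>T m1(1) L2 Hs hit])
qed

section \<open>The gliding hump\<close>

text \<open>Cauchy-Schwarz with weights \<open>2 ^ n\<close> and \<open>(1/2) ^ n\<close>, the
  latter of sum 2. Squares of size \<open>(1/4) ^ n\<close> then still leave the summable
  \<open>(1/2) ^ n\<close>.\<close>

lemma suminf_square_le:
  fixes a :: "nat \<Rightarrow> real"
  assumes a: "\<And>n. 0 \<le> a n"
  shows "(\<Sum>n. ennreal (a n))\<^sup>2 \<le> 2 * (\<Sum>n. ennreal (2 ^ n * (a n)\<^sup>2))"
proof -
  define f where "f = (\<lambda>n. ennreal (sqrt (2 ^ n) * a n))"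
  define g where "g = (\<lambda>n. ennreal (sqrt ((1/2) ^ n)))"
  have "(\<Sum>n. ennreal (a n)) = (\<integral>\<^sup>+n. f n * g n \<partial>count_space UNIV)"
  proof -
    have "ennreal (a n) = f n * g n" for n
    proof -
      have "sqrt (2 ^ n) * sqrt ((1/2) ^ n) = 1"
        unfolding real_sqrt_mult[symmetric] power_mult_distrib[symmetric] by simp
      moreover have "sqrt (2 ^ n) * a n * sqrt ((1/2) ^ n) = (sqrt (2 ^ n) * sqrt ((1/2) ^ n)) * a n" by (simp only: mult_ac)
      ultimately have "sqrt (2 ^ n) * a n * sqrt ((1/2) ^ n) = a n" by (simp only: mult_1)
      then show ?thesis using a[of n] by (simp add: f_def g_def ennreal_mult[symmetric])
    qed
    then show ?thesis by (simp add: nn_integral_count_space_nat)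
  qed
  then have "(\<Sum>n. ennreal (a n))\<^sup>2 = (\<integral>\<^sup>+n. f n * g n \<partial>count_space UNIV)\<^sup>2" by simp
  also have "\<dots> \<le> (\<integral>\<^sup>+n. (f n)\<^sup>2 \<partial>count_space UNIV) * (\<integral>\<^sup>+n. (g n)\<^sup>2 \<partial>count_space UNIV)"
    by (rule Cauchy_Schwarz_nn_integral) auto
  also have "(\<integral>\<^sup>+n. (f n)\<^sup>2 \<partial>count_space UNIV) = (\<Sum>n. ennreal (2 ^ n * (a n)\<^sup>2))"
    using a by (simp add: f_def nn_integral_count_space_nat ennreal_power power_mult_distrib)
  also have "(\<integral>\<^sup>+n. (g n)\<^sup>2 \<partial>count_space UNIV) = (\<Sum>n. ennreal ((1/2) ^ n))"
    by (simp add: g_def nn_integral_count_space_nat ennreal_power)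
  also have "\<dots> = ennreal (\<Sum>n. (1/2) ^ n)" by (intro suminf_ennreal2) (auto intro: summable_geometric)
  also have "(\<Sum>n. (1/2::real) ^ n) = 2" by (subst suminf_geometric) auto
  finally show ?thesis by (simp add: mult.commute)
qed

text \<open>At a hitting time of stage \<open>n\<close> the earlier humps are close to their initial
  values, the later ones are negligible, and the hump \<open>n\<close> itself has size at least 1/4.
  In \<open>f x\<close>, however, the humps from \<open>n\<close> on contribute only the tail of a
  convergent series, so the flow stays away from \<open>f x\<close>.\<close>

lemma gliding_hump:
  fixes h G :: "nat \<Rightarrow> real \<Rightarrow> real" and \<tau> :: "nat \<Rightarrow> real"
  assumes s: "0 \<le> s"
    and h0: "\<And>n x. 0 \<le> h n x" and G0: "\<And>n \<xi>. 0 \<le> G n \<xi>"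
    and hi: "\<And>n. integrable lborel (h n)"
    and hG: "\<And>n \<xi>. (LINT x|lborel. cis (- (x * \<xi>)) * complex_of_real (h n x)) = complex_of_real (G n \<xi>)"
    and Gm: "\<And>n. G n \<in> borel_measurable borel"
    and m1: "\<And>n. (LINT x|lborel. h n x) \<le> (1/2) ^ n"
    and h2i: "\<And>n. integrable lborel (\<lambda>x. (h n x)\<^sup>2)" and h2: "\<And>n. (LINT x|lborel. (h n x)\<^sup>2) \<le> (1/4) ^ n"
    and G2i: "\<And>n. integrable lborel (\<lambda>\<xi>. (1 + \<xi>\<^sup>2) powr s * (G n \<xi>)\<^sup>2)"
    and G2: "\<And>n. (LINT \<xi>|lborel. (1 + \<xi>\<^sup>2) powr s * (G n \<xi>)\<^sup>2) \<le> (1/4) ^ n"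
    and \<tau>0: "\<And>n. 0 < \<tau> n" and \<tau>lim: "\<tau> \<longlonglongrightarrow> 0"
    and hit: "\<And>n x. x \<in> {0..1} \<Longrightarrow> \<exists>t\<in>{0<..\<tau> n}.
        1/4 \<le> norm (Pgamma \<gamma> (\<lambda>\<xi>. complex_of_real (G n \<xi>)) (x + \<bar>t\<bar> powr \<alpha>) t) \<and>
        (\<forall>j<n. norm (Pgamma \<gamma> (\<lambda>\<xi>. complex_of_real (G j \<xi>)) (x + \<bar>t\<bar> powr \<alpha>) t - complex_of_real (h j x)) \<le> (1/2) ^ j / 64) \<and>
        (\<forall>j>n. norm (Pgamma \<gamma> (\<lambda>\<xi>. complex_of_real (G j \<xi>)) (x + \<bar>t\<bar> powr \<alpha>) t) \<le> (1/2) ^ j / 64)"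
  obtains f g where "sobolev s f g" "\<not> converges_ae \<gamma> (\<lambda>x t. x + \<bar>t\<bar> powr \<alpha>) f g"
proof -
  have hm[measurable]: "h n \<in> borel_measurable borel" for n using borel_measurable_integrable[OF hi] by simp
  note Gm[measurable]
  have half: "summable (\<lambda>n. (1/2::real) ^ n)" by (intro summable_geometric) simp
  have half_sum: "(\<Sum>n. (1/2::real) ^ n) = 2" by (subst suminf_geometric) auto
  have half_enn: "(\<Sum>n. ennreal ((1/2) ^ n)) = ennreal 2"
  proof -
    have "(\<Sum>n. ennreal ((1/2) ^ n)) = ennreal (\<Sum>n. (1/2) ^ n)" by (intro suminf_ennreal2 half) simp
    then show ?thesis by (simp only: half_sum)
  qed
  have Gle: "G n \<xi> \<le> (1/2) ^ n" for n \<xi>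
  proof -
    have "G n \<xi> = norm (LINT x|lborel. cis (- (x * \<xi>)) * complex_of_real (h n x))"
      unfolding hG using G0 by simp
    also have "\<dots> \<le> (LINT x|lborel. h n x)"
      by (rule order_trans[OF integral_norm_bound]) (simp add: norm_mult h0)
    finally show ?thesis using m1[of n] by linarith
  qed
  have Gsum: "summable (\<lambda>n. G n \<xi>)" for \<xi>
    by (rule summable_comparison_test'[OF half, of 0]) (use G0 Gle in simp)
  \<comment> \<open>Finite almost everywhere because the masses are summable; where the series
    diverges the value is 0, a change on a null set.\<close>
  define F where "F = (\<lambda>x. enn2real (\<Sum>n. ennreal (h n x)))"
  define Gs where "Gs = (\<lambda>\<xi>. \<Sum>n. G n \<xi>)"
  have [measurable]: "F \<in> borel_measurable borel" unfolding F_def by measurable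
  have [measurable]: "Gs \<in> borel_measurable borel" unfolding Gs_def by measurable
  have F0: "F x \<ge> 0" for x by (simp add: F_def)
  have Gs0: "Gs \<xi> \<ge> 0" for \<xi> unfolding Gs_def by (intro suminf_nonneg Gsum G0)
  have enn: "ennreal (enn2real y) \<le> y" for y by (cases y) auto
  have nnh: "(\<integral>\<^sup>+x. ennreal (h n x) \<partial>lborel) \<le> ennreal ((1/2) ^ n)" for n
    using nn_integral_eq_integral[OF hi[of n]] m1[of n] h0 by (simp add: ennreal_leI)
  have sumh: "(\<integral>\<^sup>+x. (\<Sum>n. ennreal (h n x)) \<partial>lborel) \<le> ennreal 2"
  proof -
    have "(\<integral>\<^sup>+x. (\<Sum>n. ennreal (h n x)) \<partial>lborel) = (\<Sum>n. \<integral>\<^sup>+x. ennreal (h n x) \<partial>lborel)" by (rule nn_integral_suminf) measurable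
    also have "\<dots> \<le> (\<Sum>n. ennreal ((1/2) ^ n))" by (intro suminf_le nnh) auto
    also have "\<dots> = ennreal 2" by (rule half_enn)
    finally show ?thesis .
  qed
  have "AE x in lborel. (\<Sum>n. ennreal (h n x)) \<noteq> \<infinity>"
    using sumh by (intro nn_integral_PInf_AE) (auto simp: top_unique)
  then have AEs: "AE x in lborel. summable (\<lambda>n. h n x) \<and> F x = (\<Sum>n. h n x)"
  proof eventually_elim
    case (elim x)
    then have sm: "summable (\<lambda>n. h n x)" using h0 by (intro summable_suminf_not_top) auto
    then have "(\<Sum>n. ennreal (h n x)) = ennreal (\<Sum>n. h n x)" using h0 by (intro suminf_ennreal2) auto
    then show ?case using sm suminf_nonneg[OF sm h0] by (simp add: F_def)
  qed
  have Fi: "integrable lborel F"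
  proof (rule integrableI_nonneg)
    have "(\<integral>\<^sup>+x. ennreal (F x) \<partial>lborel) \<le> (\<integral>\<^sup>+x. (\<Sum>n. ennreal (h n x)) \<partial>lborel)"
      unfolding F_def by (intro nn_integral_mono enn)
    also note sumh
    also have "ennreal 2 < \<infinity>" by simp
    finally show "(\<integral>\<^sup>+x. ennreal (F x) \<partial>lborel) < \<infinity>" .
  qed (auto simp: F0)
  \<comment> \<open>Used with \<open>W = 1\<close> for the square integrability of \<open>F\<close>
    and with the Sobolev weight for \<open>Gs\<close>.\<close>
  have sq: "(\<integral>\<^sup>+x. ennreal (W x) * (\<Sum>n. ennreal (a n x))\<^sup>2 \<partial>lborel) < \<infinity>"
    if [measurable]: "W \<in> borel_measurable borel" "\<And>n. a n \<in> borel_measurable borel"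
      and W0: "\<And>x. 0 \<le> W x" and a0: "\<And>n x. 0 \<le> a n x"
      and i: "\<And>n. integrable lborel (\<lambda>x. W x * (a n x)\<^sup>2)" and le: "\<And>n. (LINT x|lborel. W x * (a n x)\<^sup>2) \<le> (1/4) ^ n"
    for W :: "real \<Rightarrow> real" and a :: "nat \<Rightarrow> real \<Rightarrow> real"
  proof -
    have "(\<integral>\<^sup>+x. ennreal (W x) * (\<Sum>n. ennreal (a n x))\<^sup>2 \<partial>lborel) \<le> (\<integral>\<^sup>+x. 2 * (\<Sum>n. ennreal (2 ^ n) * ennreal (W x * (a n x)\<^sup>2)) \<partial>lborel)"
    proof (rule nn_integral_mono)
      fix x
      have "ennreal (W x) * (\<Sum>n. ennreal (a n x))\<^sup>2 \<le> ennreal (W x) * (2 * (\<Sum>n. ennreal (2 ^ n * (a n x)\<^sup>2)))"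
        by (intro mult_left_mono suminf_square_le a0) simp
      also have "\<dots> = 2 * (\<Sum>n. ennreal (W x) * ennreal (2 ^ n * (a n x)\<^sup>2))"
        by (simp add: mult.left_commute ennreal_suminf_cmult)
      also have "(\<lambda>n. ennreal (W x) * ennreal (2 ^ n * (a n x)\<^sup>2)) = (\<lambda>n. ennreal (2 ^ n) * ennreal (W x * (a n x)\<^sup>2))"
        using W0 by (intro ext) (simp add: ennreal_mult[symmetric] mult_ac)
      finally show "ennreal (W x) * (\<Sum>n. ennreal (a n x))\<^sup>2 \<le> 2 * (\<Sum>n. ennreal (2 ^ n) * ennreal (W x * (a n x)\<^sup>2))" .
    qed
    also have "\<dots> = 2 * (\<Sum>n. ennreal (2 ^ n) * (\<integral>\<^sup>+x. ennreal (W x * (a n x)\<^sup>2) \<partial>lborel))"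
      by (subst nn_integral_cmult, measurable, subst nn_integral_suminf, measurable, subst nn_integral_cmult, measurable)
    also have "\<dots> \<le> 2 * (\<Sum>n. ennreal ((1/2) ^ n))"
    proof (intro mult_left_mono suminf_le)
      fix n
      have "(\<integral>\<^sup>+x. ennreal (W x * (a n x)\<^sup>2) \<partial>lborel) = ennreal (LINT x|lborel. W x * (a n x)\<^sup>2)"
        using W0 by (intro nn_integral_eq_integral i) auto
      also have "\<dots> \<le> ennreal ((1/4) ^ n)" by (intro ennreal_leI le)
      finally have "ennreal (2 ^ n) * (\<integral>\<^sup>+x. ennreal (W x * (a n x)\<^sup>2) \<partial>lborel) \<le> ennreal (2 ^ n) * ennreal ((1/4) ^ n)"
        by (intro mult_left_mono) auto
      also have "\<dots> = ennreal ((2 * (1/4)) ^ n)" by (simp only: ennreal_mult[symmetric] zero_le_power power_mult_distrib[symmetric])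
      finally show "ennreal (2 ^ n) * (\<integral>\<^sup>+x. ennreal (W x * (a n x)\<^sup>2) \<partial>lborel) \<le> ennreal ((1/2) ^ n)" by simp
    qed auto
    also have "(\<Sum>n. ennreal ((1/2) ^ n)) = ennreal 2" by (rule half_enn)
    finally show ?thesis by (rule order_le_less_trans) (simp add: ennreal_mult_less_top)
  qed
  have F2: "integrable lborel (\<lambda>x. (F x)\<^sup>2)"
  proof (rule integrableI_nonneg)
    have "(\<integral>\<^sup>+x. ennreal ((F x)\<^sup>2) \<partial>lborel) \<le> (\<integral>\<^sup>+x. ennreal 1 * (\<Sum>n. ennreal (h n x))\<^sup>2 \<partial>lborel)"
    proof (rule nn_integral_mono)
      fix x
      have "ennreal ((F x)\<^sup>2) = (ennreal (F x))\<^sup>2" using F0 by (simp add: ennreal_power)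
      also have "\<dots> \<le> (\<Sum>n. ennreal (h n x))\<^sup>2" unfolding F_def by (intro power_mono enn) simp
      finally show "ennreal ((F x)\<^sup>2) \<le> ennreal 1 * (\<Sum>n. ennreal (h n x))\<^sup>2" by simp
    qed
    also have "\<dots> < \<infinity>" by (rule sq) (use h0 h2i h2 in auto)
    finally show "(\<integral>\<^sup>+x. ennreal ((F x)\<^sup>2) \<partial>lborel) < \<infinity>" .
  qed auto
  have Gs2: "integrable lborel (\<lambda>\<xi>. (1 + \<xi>\<^sup>2) powr s * (Gs \<xi>)\<^sup>2)"
  proof (rule integrableI_nonneg)
    have "(\<integral>\<^sup>+\<xi>. ennreal ((1 + \<xi>\<^sup>2) powr s * (Gs \<xi>)\<^sup>2) \<partial>lborel) \<le> (\<integral>\<^sup>+\<xi>. ennreal ((1 + \<xi>\<^sup>2) powr s) * (\<Sum>n. ennreal (G n \<xi>))\<^sup>2 \<partial>lborel)"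
    proof (rule nn_integral_mono)
      fix \<xi>
      have "(\<Sum>n. ennreal (G n \<xi>)) = ennreal (Gs \<xi>)" unfolding Gs_def by (intro suminf_ennreal2 Gsum G0)
      then show "ennreal ((1 + \<xi>\<^sup>2) powr s * (Gs \<xi>)\<^sup>2) \<le> ennreal ((1 + \<xi>\<^sup>2) powr s) * (\<Sum>n. ennreal (G n \<xi>))\<^sup>2"
        using Gs0[of \<xi>] by (simp add: ennreal_power ennreal_mult)
    qed
    also have "\<dots> < \<infinity>" by (rule sq) (use G0 G2i G2 in auto)
    finally show "(\<integral>\<^sup>+\<xi>. ennreal ((1 + \<xi>\<^sup>2) powr s * (Gs \<xi>)\<^sup>2) \<partial>lborel) < \<infinity>" .
  qed auto
  define f where "f = (\<lambda>x. complex_of_real (F x))"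
  define g where "g = (\<lambda>\<xi>. complex_of_real (Gs \<xi>))"
  have gf: "g \<xi> = (LINT x|lborel. cis (- (x * \<xi>)) * f x)" for \<xi>
  proof -
    have ci: "integrable lborel (\<lambda>x. cis (- (x * \<xi>)) * complex_of_real (h n x))" for n
      by (rule Bochner_Integration.integrable_bound[OF hi[of n]]) (auto simp: norm_mult)
    have "(LINT x|lborel. cis (- (x * \<xi>)) * f x) = (LINT x|lborel. (\<Sum>n. cis (- (x * \<xi>)) * complex_of_real (h n x)))"
    proof (rule integral_cong_AE)
      show "AE x in lborel. cis (- (x * \<xi>)) * f x = (\<Sum>n. cis (- (x * \<xi>)) * complex_of_real (h n x))"
        using AEs
      proof eventually_elim
        case (elim x)
        then have "(\<lambda>n. cis (- (x * \<xi>)) * complex_of_real (h n x)) sums (cis (- (x * \<xi>)) * complex_of_real (F x))"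
          by (intro sums_mult sums_of_real) (auto simp: summable_sums)
        then show ?case by (simp add: sums_iff f_def)
      qed
    qed (auto simp: f_def)
    also have "\<dots> = (\<Sum>n. LINT x|lborel. cis (- (x * \<xi>)) * complex_of_real (h n x))"
    proof (rule integral_suminf[OF ci])
      show "AE x in lborel. summable (\<lambda>n. norm (cis (- (x * \<xi>)) * complex_of_real (h n x)))"
        using AEs by eventually_elim (simp add: norm_mult h0)
      show "summable (\<lambda>n. LINT x|lborel. norm (cis (- (x * \<xi>)) * complex_of_real (h n x)))"
        by (rule summable_comparison_test'[OF half, of 0])
           (use m1 h0 in \<open>auto simp: norm_mult abs_of_nonneg Bochner_Integration.integral_nonneg\<close>)
    qed
    also have "\<dots> = (\<Sum>n. complex_of_real (G n \<xi>))" unfolding hG ..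
    also have "\<dots> = g \<xi>" using Gsum[of \<xi>] by (simp add: g_def Gs_def suminf_of_real)
    finally show ?thesis ..
  qed
  have gw: "integrable lborel (\<lambda>\<xi>. (1 + \<xi>\<^sup>2) powr s * (cmod (g \<xi>))\<^sup>2)"
    using Gs2 by (simp add: g_def)
  have gm: "g \<in> borel_measurable borel" unfolding g_def by measurable
  have "fourier_L2 f g"
    by (rule fourier_L2_of_integrable[OF _ _ gf weighted_imp_square_integrable[OF gm s gw]]) (use Fi F2 in \<open>auto simp: f_def\<close>)
  then have sob: "sobolev s f g" using gw by (simp add: sobolev_def)
  have "\<not> converges_ae \<gamma> (\<lambda>x t. x + \<bar>t\<bar> powr \<alpha>) f g"
  proof
    assume "converges_ae \<gamma> (\<lambda>x t. x + \<bar>t\<bar> powr \<alpha>) f g"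
    then have "AE x in lborel. ((\<lambda>t. Pgamma \<gamma> g (x + \<bar>t\<bar> powr \<alpha>) t) \<longlongrightarrow> f x) (at_right 0)"
      by (simp add: converges_ae_def)
    with AEs have "AE x in lborel. ((\<lambda>t. Pgamma \<gamma> g (x + \<bar>t\<bar> powr \<alpha>) t) \<longlongrightarrow> f x) (at_right 0) \<and> summable (\<lambda>n. h n x) \<and> F x = (\<Sum>n. h n x)"
      by eventually_elim simp
    then obtain N where N: "{x \<in> space lborel. \<not> (((\<lambda>t. Pgamma \<gamma> g (x + \<bar>t\<bar> powr \<alpha>) t) \<longlongrightarrow> f x) (at_right 0) \<and> summable (\<lambda>n. h n x) \<and> F x = (\<Sum>n. h n x))} \<subseteq> N"
      "emeasure lborel N = 0" "N \<in> sets lborel" by (rule AE_E)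
    have "\<not> {0..1} \<subseteq> N"
    proof
      assume "{0..1::real} \<subseteq> N"
      then have "emeasure lborel {0..1::real} \<le> emeasure lborel N" using N(3) by (rule emeasure_mono)
      then show False using N(2) by simp
    qed
    then obtain x where x: "x \<in> {0..1}" "x \<notin> N" by blast
    then have cv: "((\<lambda>t. Pgamma \<gamma> g (x + \<bar>t\<bar> powr \<alpha>) t) \<longlongrightarrow> f x) (at_right 0)" and sm: "summable (\<lambda>n. h n x)" and Fx: "F x = (\<Sum>n. h n x)"
      using N(1) by auto
    define Q where "Q = (\<lambda>n t. t \<in> {0<..\<tau> n} \<and>
        1/4 \<le> norm (Pgamma \<gamma> (\<lambda>\<xi>. complex_of_real (G n \<xi>)) (x + \<bar>t\<bar> powr \<alpha>) t) \<and>
        (\<forall>j<n. norm (Pgamma \<gamma> (\<lambda>\<xi>. complex_of_real (G j \<xi>)) (x + \<bar>t\<bar> powr \<alpha>) t - complex_of_real (h j x)) \<le> (1/2) ^ j / 64) \<and>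
        (\<forall>j>n. norm (Pgamma \<gamma> (\<lambda>\<xi>. complex_of_real (G j \<xi>)) (x + \<bar>t\<bar> powr \<alpha>) t) \<le> (1/2) ^ j / 64))"
    have "\<forall>n. \<exists>t. Q n t" using hit[OF x(1)] unfolding Q_def Bex_def by (rule allI)
    then obtain T where "\<forall>n. Q n (T n)" using choice[of Q] by blast
    then have T: "\<And>n. T n \<in> {0<..\<tau> n}"
      "\<And>n. 1/4 \<le> norm (Pgamma \<gamma> (\<lambda>\<xi>. complex_of_real (G n \<xi>)) (x + \<bar>T n\<bar> powr \<alpha>) (T n))"
      "\<And>n j. j < n \<Longrightarrow> norm (Pgamma \<gamma> (\<lambda>\<xi>. complex_of_real (G j \<xi>)) (x + \<bar>T n\<bar> powr \<alpha>) (T n) - complex_of_real (h j x)) \<le> (1/2) ^ j / 64"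
      "\<And>n j. n < j \<Longrightarrow> norm (Pgamma \<gamma> (\<lambda>\<xi>. complex_of_real (G j \<xi>)) (x + \<bar>T n\<bar> powr \<alpha>) (T n)) \<le> (1/2) ^ j / 64"
      unfolding Q_def by blast+
    have Tp: "T n > 0" for n using T(1)[of n] by simp
    have "T \<longlonglongrightarrow> 0"
      by (rule tendsto_sandwich[OF _ _ tendsto_const \<tau>lim]) (use T(1) in \<open>auto intro!: always_eventually simp: less_imp_le\<close>)
    then have Tr: "filterlim T (at_right 0) sequentially"
      unfolding filterlim_at using Tp by (auto intro!: always_eventually simp: less_imp_neq[THEN not_sym])
    have l1: "(\<lambda>n. norm (Pgamma \<gamma> g (x + \<bar>T n\<bar> powr \<alpha>) (T n) - f x)) \<longlonglongrightarrow> 0"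
      using tendsto_norm[OF tendsto_diff[OF filterlim_compose[OF cv Tr] tendsto_const[of "f x"]]] by simp
    have l2: "(\<lambda>n. \<Sum>j. h (j + n) x) \<longlonglongrightarrow> 0" by (rule suminf_exist_split2[OF sm])
    \<comment> \<open>From 1/4 two errors are subtracted: the earlier humps cost at most 1/32, the
      sum of \<open>(1/2) ^ j / 64\<close>, and the later ones at most 1/64, rounded up to
      1/32.\<close>
    have low: "3/16 \<le> norm (Pgamma \<gamma> g (x + \<bar>T n\<bar> powr \<alpha>) (T n) - f x) + (\<Sum>j. h (j + n) x)" for n
    proof -
      define y where "y = x + \<bar>T n\<bar> powr \<alpha>"
      define p where "p = (\<lambda>j. Pgamma \<gamma> (\<lambda>\<xi>. complex_of_real (G j \<xi>)) y (T n))"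
      define E where "E = (\<lambda>\<xi>. cis (y * \<xi> + T n * \<xi>\<^sup>2) * complex_of_real (exp (- (T n powr \<gamma>) * \<xi>\<^sup>2)))"
      have Gabs: "\<bar>G j \<xi>\<bar> \<le> (1/2) ^ j" for j \<xi> using G0[of j \<xi>] Gle[of j \<xi>] by simp
      note PB = Pgamma_bounded_le[OF Gm Gabs Tp[of n], where \<gamma>=\<gamma> and y=y]
      have pn: "norm (p j) \<le> (1/2) ^ j * T n powr (- \<gamma> / 2)" for j unfolding p_def by (rule PB(3))
      have ps: "summable (\<lambda>j. norm (p j))"
        by (rule summable_comparison_test'[OF summable_mult2[OF half, of "T n powr (- \<gamma> / 2)"], of 0]) (use pn in simp)
      have P: "Pgamma \<gamma> g y (T n) = (\<Sum>j. p j)"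
      proof -
        have "(LINT \<xi>|lborel. E \<xi> * g \<xi>) = (LINT \<xi>|lborel. (\<Sum>j. E \<xi> * complex_of_real (G j \<xi>)))"
        proof (rule Bochner_Integration.integral_cong[OF refl])
          fix \<xi>
          have "(\<lambda>j. E \<xi> * complex_of_real (G j \<xi>)) sums (E \<xi> * g \<xi>)"
            unfolding g_def Gs_def by (intro sums_mult sums_of_real summable_sums Gsum)
          then show "E \<xi> * g \<xi> = (\<Sum>j. E \<xi> * complex_of_real (G j \<xi>))" by (simp add: sums_iff)
        qed
        also have "\<dots> = (\<Sum>j. LINT \<xi>|lborel. E \<xi> * complex_of_real (G j \<xi>))"
        proof (rule integral_suminf)
          show "integrable lborel (\<lambda>\<xi>. E \<xi> * complex_of_real (G j \<xi>))" for j unfolding E_def by (rule PB(1))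
          show "AE \<xi> in lborel. summable (\<lambda>j. norm (E \<xi> * complex_of_real (G j \<xi>)))"
            using Gsum G0 by (intro AE_I2) (simp add: norm_mult summable_mult)
          show "summable (\<lambda>j. LINT \<xi>|lborel. norm (E \<xi> * complex_of_real (G j \<xi>)))"
            by (rule summable_comparison_test'[OF summable_mult2[OF half, of "sqrt (pi / T n powr \<gamma>)"], of 0])
               (use PB(2) in \<open>auto simp: E_def Bochner_Integration.integral_nonneg abs_of_nonneg\<close>)
        qed
        finally have "(LINT \<xi>|lborel. E \<xi> * g \<xi>) = (\<Sum>j. LINT \<xi>|lborel. E \<xi> * complex_of_real (G j \<xi>))" .
        \<comment> \<open>Pulling the constant \<open>1 / (2 * pi)\<close> through the infinite sum
          requires convergence; the damping at the positive time \<open>T n\<close> provides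
          it.\<close>
        moreover have "summable (\<lambda>j. LINT \<xi>|lborel. E \<xi> * complex_of_real (G j \<xi>))"
        proof (rule summable_norm_cancel, rule summable_comparison_test'[OF summable_mult2[OF half, of "sqrt (pi / T n powr \<gamma>)"], of 0])
          show "norm (norm (LINT \<xi>|lborel. E \<xi> * complex_of_real (G j \<xi>))) \<le> (1/2) ^ j * sqrt (pi / T n powr \<gamma>)" for j
            unfolding real_norm_def abs_norm_cancel E_def by (rule order_trans[OF integral_norm_bound PB(2)])
        qed
        ultimately show ?thesis
          unfolding p_def Pgamma_def E_def by (simp only: suminf_mult)
      qed
      have hs: "summable (\<lambda>j. complex_of_real (h j x))" using sm by (rule summable_of_real)
      have ps': "summable p" using ps by (rule summable_norm_cancel)
      have fx: "f x = (\<Sum>j. complex_of_real (h j x))" unfolding f_def Fx by (rule suminf_of_real[OF sm])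
      have sp: "(\<Sum>j. p j) = (\<Sum>j. p (j + Suc n)) + p n + (\<Sum>j<n. p j)"
        using suminf_split_initial_segment[OF ps', of "Suc n"] by simp
      have sh: "(\<Sum>j. complex_of_real (h j x)) = (\<Sum>j. complex_of_real (h (j + n) x)) + (\<Sum>j<n. complex_of_real (h j x))"
        by (rule suminf_split_initial_segment[OF hs])
      have t1: "norm (\<Sum>j. p (j + Suc n)) \<le> 1/32"
      proof -
        have b: "norm (p (j + Suc n)) \<le> (1/2) ^ j * (1/128)" for j
        proof -
          have "norm (p (j + Suc n)) \<le> (1/2) ^ (j + Suc n) / 64" unfolding p_def y_def by (rule T(4)) simp
          also have "(1/2::real) ^ (j + Suc n) \<le> (1/2) ^ (j + 1)" by (intro power_decreasing) auto
          finally show ?thesis by simp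
        qed
        have s1: "summable (\<lambda>j. (1/2::real) ^ j * (1/128))" by (intro summable_mult2 half)
        have s2: "summable (\<lambda>j. norm (p (j + Suc n)))" using ps by (rule summable_ignore_initial_segment)
        have "norm (\<Sum>j. p (j + Suc n)) \<le> (\<Sum>j. norm (p (j + Suc n)))" by (rule summable_norm[OF s2])
        also have "\<dots> \<le> (\<Sum>j. (1/2) ^ j * (1/128))" by (intro suminf_le b s1 s2)
        also have "\<dots> = 1/64" using suminf_mult2[OF half, of "1/128"] half_sum by simp
        finally show ?thesis by simp
      qed
      have t2: "norm (\<Sum>j<n. p j - complex_of_real (h j x)) \<le> 1/32"
      proof -
        have "norm (\<Sum>j<n. p j - complex_of_real (h j x)) \<le> (\<Sum>j<n. (1/2) ^ j * (1/64))"
          unfolding p_def y_def using T(3)[of _ n] by (intro sum_norm_le) simp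
        also have "\<dots> \<le> (\<Sum>j. (1/2) ^ j * (1/64))" by (intro sum_le_suminf summable_mult2 half) auto
        also have "\<dots> = 1/32" using suminf_mult2[OF half, of "1/64"] half_sum by simp
        finally show ?thesis .
      qed
      have t3: "norm (\<Sum>j. complex_of_real (h (j + n) x)) = (\<Sum>j. h (j + n) x)"
      proof -
        have sn: "summable (\<lambda>j. h (j + n) x)" using sm by (rule summable_ignore_initial_segment)
        show ?thesis unfolding suminf_of_real[OF sn, symmetric] norm_of_real using suminf_nonneg[OF sn h0] by simp
      qed
      have "p n = (Pgamma \<gamma> g y (T n) - f x) + (\<Sum>j. complex_of_real (h (j + n) x)) - (\<Sum>j. p (j + Suc n)) - (\<Sum>j<n. p j - complex_of_real (h j x))"
        unfolding P fx sp sh sum_subtractf by simp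
      moreover have "norm (A + B - C - D) \<le> norm A + norm B + norm C + norm D" for A B C D :: complex
        using norm_triangle_ineq4[of "A + B - C" D] norm_triangle_ineq4[of "A + B" C] norm_triangle_ineq[of A B] by linarith
      ultimately have "norm (p n) \<le> norm (Pgamma \<gamma> g y (T n) - f x) + norm (\<Sum>j. complex_of_real (h (j + n) x)) + norm (\<Sum>j. p (j + Suc n)) + norm (\<Sum>j<n. p j - complex_of_real (h j x))"
        by (simp only:)
      then show ?thesis using T(2)[of n] t1 t2 unfolding t3 p_def y_def by linarith
    qed
    have "(\<lambda>n. norm (Pgamma \<gamma> g (x + \<bar>T n\<bar> powr \<alpha>) (T n) - f x) + (\<Sum>j. h (j + n) x)) \<longlonglongrightarrow> 0 + 0"
      by (intro tendsto_add l1 l2)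
    then have "3/16 \<le> (0::real) + 0" by (rule LIMSEQ_le_const) (use low in blast)
    then show False by simp
  qed
  then show ?thesis using sob that by blast
qed

lemma bump_sum_square_integrable:
  assumes R: "R > 0"
  shows "integrable lborel (\<lambda>x. (bump_sum M \<delta> R x)\<^sup>2)"
proof (rule Bochner_Integration.integrable_bound)
  show "integrable lborel (\<lambda>x. bump_sum M \<delta> R 0 * bump_sum M \<delta> R x)" using bump_sum_fourier(1)[OF R] by simp
  show "AE x in lborel. norm ((bump_sum M \<delta> R x)\<^sup>2) \<le> norm (bump_sum M \<delta> R 0 * bump_sum M \<delta> R x)"
    using bump_sum_nonneg[of M \<delta> R] bump_sum_le_0[OF R, of M \<delta>]
    by (intro AE_I2) (auto simp: power2_eq_square abs_mult intro!: mult_right_mono)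
qed measurable

text \<open>Stages are chosen recursively as tuples (M, \<delta>, R, \<tau>, U), where [\<tau>, U]
  contains the hitting times. Each new stage acts before time \<tau> of the previous one, early
  enough for that one to have converged, and is too small to be felt from \<tau> on.\<close>

lemma divergence_below_s_crit:
  assumes \<gamma>: "\<gamma> > 0" and \<alpha>: "\<alpha> > 0" "\<alpha> \<le> 1/4" and s: "0 \<le> s" "s < s_crit \<gamma> \<alpha>"
  obtains f g where "sobolev s f g" "\<not> converges_ae \<gamma> (\<lambda>x t. x + \<bar>t\<bar> powr \<alpha>) f g"
proof -
  let ?P = "\<lambda>M \<delta> R. Pgamma \<gamma> (\<lambda>\<xi>. complex_of_real (fejer_comb M \<delta> R \<xi>))"
  define good where "good = (\<lambda>n::nat. \<lambda>(M::nat, \<delta>::real, R::real, \<tau>::real, U::real).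
    \<delta> > 0 \<and> R \<ge> 1 \<and> 0 < \<tau> \<and> \<tau> \<le> U \<and> U \<le> inverse (real (Suc n)) \<and>
    real M * sqrt (2 * pi) / R \<le> (1/2) ^ n \<and> (LINT x|lborel. (bump_sum M \<delta> R x)\<^sup>2) \<le> (1/4) ^ n \<and>
    (LINT \<xi>|lborel. (1 + \<xi>\<^sup>2) powr s * (fejer_comb M \<delta> R \<xi>)\<^sup>2) \<le> (1/4) ^ n \<and>
    (\<forall>x\<in>{0..1}. \<exists>t\<in>{\<tau>..U}. 1/4 \<le> norm (?P M \<delta> R (x + \<bar>t\<bar> powr \<alpha>) t)))"
  define link where "link = (\<lambda>n::nat. \<lambda>(M::nat, \<delta>::real, R::real, \<tau>::real, U::real). \<lambda>(M'::nat, \<delta>'::real, R'::real, \<tau>'::real, U'::real).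
    U' \<le> \<tau> \<and> (\<forall>x t. 0 < t \<longrightarrow> t \<le> U' \<longrightarrow> norm (?P M \<delta> R (x + \<bar>t\<bar> powr \<alpha>) t - complex_of_real (bump_sum M \<delta> R x)) \<le> (1/2) ^ n / 64) \<and>
    real M' * sqrt (2 * pi) / R' * \<tau> powr (- \<gamma> / 2) \<le> (1/2) ^ Suc n / 64)"
  have quarter: "(1/4::real) ^ n \<le> (1/2) ^ n" for n by (intro power_mono) auto
  have "\<exists>S. good 0 S"
  proof -
    obtain M \<delta> R \<tau> where b: "M > 0" "\<delta> > 0" "R \<ge> 1" "0 < \<tau>" "\<tau> \<le> 1"
      "real M * sqrt (2 * pi) / R \<le> 1" "(LINT x|lborel. (bump_sum M \<delta> R x)\<^sup>2) \<le> 1"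
      "(LINT \<xi>|lborel. (1 + \<xi>\<^sup>2) powr s * (fejer_comb M \<delta> R \<xi>)\<^sup>2) \<le> 1"
      "\<And>x. x \<in> {0..1} \<Longrightarrow> \<exists>t\<in>{\<tau>..1}. 1/4 \<le> norm (?P M \<delta> R (x + \<bar>t\<bar> powr \<alpha>) t)"
      using building_block[OF \<gamma> \<alpha> s zero_less_one zero_less_one] by blast
    then have "good 0 (M, \<delta>, R, \<tau>, 1)" unfolding good_def by simp
    then show ?thesis ..
  qed
  moreover have "\<exists>S'. good (Suc n) S' \<and> link n S S'" if "good n S" for S n
  proof -
    obtain M \<delta> R \<tau> U where S: "S = (M, \<delta>, R, \<tau>, U)" by (cases S)
    have \<tau>: "\<tau> > 0" and R: "R > 0" using that by (auto simp: S good_def)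
    have "(1/2::real) ^ n / 64 > 0" by simp
    from Pgamma_uniform_convergence[OF \<gamma> \<alpha>(1) fejer_comb_integrable[OF R, of M \<delta>] fejer_comb_inverse[OF R, of _ M \<delta>] this]
    obtain T where T: "T > 0" "\<And>x t. 0 < t \<Longrightarrow> t \<le> T \<Longrightarrow> norm (?P M \<delta> R (x + \<bar>t\<bar> powr \<alpha>) t - complex_of_real (bump_sum M \<delta> R x)) \<le> (1/2) ^ n / 64"
      by blast
    define U' where "U' = min \<tau> (min T (inverse (real (Suc (Suc n)))))"
    have U': "U' > 0" "U' \<le> \<tau>" "U' \<le> T" "U' \<le> inverse (real (Suc (Suc n)))" using \<tau> T by (auto simp: U'_def)
    \<comment> \<open>The first entry makes the norms summable; the second compensates the growth
      \<tau> powr (- \<gamma> / 2) of the bound on the new hump at times after \<tau>.\<close>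
    define e where "e = min ((1/4) ^ Suc n) ((1/2) ^ Suc n / 64 * \<tau> powr (\<gamma> / 2))"
    have e: "e > 0" "e \<le> (1/4) ^ Suc n" "e \<le> (1/2) ^ Suc n / 64 * \<tau> powr (\<gamma> / 2)" using \<tau> by (auto simp: e_def)
    obtain M' \<delta>' R' \<tau>' where b: "M' > 0" "\<delta>' > 0" "R' \<ge> 1" "0 < \<tau>'" "\<tau>' \<le> U'"
      "real M' * sqrt (2 * pi) / R' \<le> e" "(LINT x|lborel. (bump_sum M' \<delta>' R' x)\<^sup>2) \<le> e"
      "(LINT \<xi>|lborel. (1 + \<xi>\<^sup>2) powr s * (fejer_comb M' \<delta>' R' \<xi>)\<^sup>2) \<le> e"
      "\<And>x. x \<in> {0..1} \<Longrightarrow> \<exists>t\<in>{\<tau>'..U'}. 1/4 \<le> norm (?P M' \<delta>' R' (x + \<bar>t\<bar> powr \<alpha>) t)"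
      using building_block[OF \<gamma> \<alpha> s e(1) U'(1)] by blast
    have "good (Suc n) (M', \<delta>', R', \<tau>', U')"
      unfolding good_def prod.case
      using b(2-5,9) U'(4) order_trans[OF b(6) e(2)] order_trans[OF b(7) e(2)] order_trans[OF b(8) e(2)] quarter[of "Suc n"]
      by (intro conjI ballI) (assumption | linarith)+
    moreover have "link n S (M', \<delta>', R', \<tau>', U')"
      unfolding link_def S prod.case
    proof (intro conjI allI impI)
      show "norm (?P M \<delta> R (x + \<bar>t\<bar> powr \<alpha>) t - complex_of_real (bump_sum M \<delta> R x)) \<le> (1/2) ^ n / 64" if "0 < t" "t \<le> U'" for x t
        using T(2) that U'(3) by simp
      have "real M' * sqrt (2 * pi) / R' * \<tau> powr (- \<gamma> / 2) \<le> ((1/2) ^ Suc n / 64 * \<tau> powr (\<gamma> / 2)) * \<tau> powr (- \<gamma> / 2)"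
        by (intro mult_right_mono order_trans[OF b(6) e(3)]) simp
      also have "\<dots> = (1/2) ^ Suc n / 64 * (\<tau> powr (\<gamma> / 2) * \<tau> powr (- \<gamma> / 2))" by (simp only: mult.assoc)
      also have "\<tau> powr (\<gamma> / 2) * \<tau> powr (- \<gamma> / 2) = 1" using \<tau> by (simp add: powr_add[symmetric])
      finally show "real M' * sqrt (2 * pi) / R' * \<tau> powr (- \<gamma> / 2) \<le> (1/2) ^ Suc n / 64" by simp
    qed (rule U'(2))
    ultimately show ?thesis by blast
  qed
  ultimately obtain S where S: "\<And>n. good n (S n)" "\<And>n. link n (S n) (S (Suc n))"
    using dependent_nat_choice[of good link] by blast
  define M where "M = (\<lambda>n. fst (S n))"
  define \<delta> where "\<delta> = (\<lambda>n. fst (snd (S n)))"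
  define R where "R = (\<lambda>n. fst (snd (snd (S n))))"
  define \<tau> where "\<tau> = (\<lambda>n. fst (snd (snd (snd (S n)))))"
  define U where "U = (\<lambda>n. snd (snd (snd (snd (S n)))))"
  have Seq: "S n = (M n, \<delta> n, R n, \<tau> n, U n)" for n by (simp add: M_def \<delta>_def R_def \<tau>_def U_def)
  note good = S(1)[unfolded Seq good_def prod.case]
  note link = S(2)[unfolded Seq link_def prod.case]
  have R0: "R n > 0" "R n \<ge> 1" for n using good[of n] by auto
  have \<tau>0: "0 < \<tau> n" "\<tau> n \<le> U n" for n using good[of n] by auto
  have U0: "U n > 0" for n using \<tau>0[of n] by linarith
  have Ud: "U (Suc n) \<le> \<tau> n" for n using link[of n] by blast
  \<comment> \<open>Monotonicity of \<open>U\<close> and \<tau> extends the relations between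
    consecutive stages to all pairs of stages.\<close>
  have decU: "decseq U" using order_trans[OF Ud \<tau>0(2)] by (intro decseq_SucI)
  have dec\<tau>: "decseq \<tau>" using order_trans[OF \<tau>0(2) Ud] by (intro decseq_SucI)
  have s2: "s \<le> 1/2" using s(2) \<alpha> by (simp add: s_crit_def)
  have Gle: "\<bar>fejer_comb (M n) (\<delta> n) (R n) \<xi>\<bar> \<le> real (M n) * sqrt (2 * pi) / R n" for n \<xi>
  proof -
    have "real (M n) * sqrt (2 * pi) / R n * exp (- \<xi>\<^sup>2 / (2 * (R n)\<^sup>2)) \<le> real (M n) * sqrt (2 * pi) / R n * 1"
      using R0[of n] by (intro mult_left_mono) auto
    then show ?thesis
      using fejer_comb_le[OF R0(1)[of n], of "M n" "\<delta> n" \<xi>] fejer_comb_nonneg[OF R0(1)[of n], of "M n" "\<delta> n" \<xi>] by linarith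
  qed
  show ?thesis
  proof (rule gliding_hump[where h="\<lambda>n. bump_sum (M n) (\<delta> n) (R n)" and G="\<lambda>n. fejer_comb (M n) (\<delta> n) (R n)" and \<tau>=U and \<gamma>=\<gamma> and \<alpha>=\<alpha>, OF s(1)])
    show "U \<longlonglongrightarrow> 0"
    proof (rule tendsto_sandwich[OF _ _ tendsto_const LIMSEQ_inverse_real_of_nat])
      show "\<forall>\<^sub>F n in sequentially. U n \<le> inverse (real (Suc n))" using good by (intro always_eventually allI) blast
    qed (use U0 in \<open>auto intro!: always_eventually simp: less_imp_le\<close>)
    show "(LINT x|lborel. bump_sum (M n) (\<delta> n) (R n) x) \<le> (1/2) ^ n" for n
      unfolding bump_sum_integral[OF R0(1)] using good[of n] by blast
    show "(LINT x|lborel. (bump_sum (M n) (\<delta> n) (R n) x)\<^sup>2) \<le> (1/4) ^ n" for n using good[of n] by blast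
    show "(LINT \<xi>|lborel. (1 + \<xi>\<^sup>2) powr s * (fejer_comb (M n) (\<delta> n) (R n) \<xi>)\<^sup>2) \<le> (1/4) ^ n" for n using good[of n] by blast
    fix n and x :: real assume x: "x \<in> {0..1}"
    then obtain t where t: "t \<in> {\<tau> n..U n}" "1/4 \<le> norm (?P (M n) (\<delta> n) (R n) (x + \<bar>t\<bar> powr \<alpha>) t)"
      using good[of n] by blast
    have t0: "t > 0" using t(1) \<tau>0[of n] by simp
    show "\<exists>t\<in>{0<..U n}. 1/4 \<le> norm (?P (M n) (\<delta> n) (R n) (x + \<bar>t\<bar> powr \<alpha>) t) \<and>
        (\<forall>j<n. norm (?P (M j) (\<delta> j) (R j) (x + \<bar>t\<bar> powr \<alpha>) t - complex_of_real (bump_sum (M j) (\<delta> j) (R j) x)) \<le> (1/2) ^ j / 64) \<and>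
        (\<forall>j>n. norm (?P (M j) (\<delta> j) (R j) (x + \<bar>t\<bar> powr \<alpha>) t) \<le> (1/2) ^ j / 64)"
    proof (intro bexI[of _ t] conjI allI impI t(2))
      show "t \<in> {0<..U n}" using t0 t(1) by simp
      fix j assume j: "j < n"
      have "U n \<le> U (Suc j)" using j by (intro decseqD[OF decU]) simp
      then have "t \<le> U (Suc j)" using t(1) by simp
      then show "norm (?P (M j) (\<delta> j) (R j) (x + \<bar>t\<bar> powr \<alpha>) t - complex_of_real (bump_sum (M j) (\<delta> j) (R j) x)) \<le> (1/2) ^ j / 64"
        using link[of j] t0 by blast
    next
      fix j assume "j > n"
      then obtain i where i: "j = Suc i" "n \<le> i" by (cases j) auto
      have "\<tau> i \<le> t" using decseqD[OF dec\<tau> i(2)] t(1) by simp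
      then have p: "t powr (- \<gamma> / 2) \<le> \<tau> i powr (- \<gamma> / 2)" using \<tau>0[of i] \<gamma> by (intro powr_mono2') auto
      have "norm (?P (M j) (\<delta> j) (R j) (x + \<bar>t\<bar> powr \<alpha>) t) \<le> real (M j) * sqrt (2 * pi) / R j * t powr (- \<gamma> / 2)"
        by (rule Pgamma_bounded_le(3)[OF borel_measurable_fejer_comb Gle t0])
      also have "\<dots> \<le> real (M j) * sqrt (2 * pi) / R j * \<tau> i powr (- \<gamma> / 2)"
        using p R0[of j] by (intro mult_left_mono) auto
      also have "\<dots> \<le> (1/2) ^ j / 64" using link[of i] i by blast
      finally show "norm (?P (M j) (\<delta> j) (R j) (x + \<bar>t\<bar> powr \<alpha>) t) \<le> (1/2) ^ j / 64" .
    qed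
  next
    fix f g assume "sobolev s f g" "\<not> converges_ae \<gamma> (\<lambda>x t. x + \<bar>t\<bar> powr \<alpha>) f g"
    then show ?thesis by (rule that)
  qed (use bump_sum_nonneg fejer_comb_nonneg[OF R0(1)] bump_sum_fourier[OF R0(1)] bump_sum_square_integrable[OF R0(1)]
      fejer_comb_sobolev(1)[OF R0(2) s(1) s2] U0 in auto)
qed

theorem theorem2:
  fixes \<gamma> \<alpha> :: real
  assumes "\<gamma> > 0" and "\<alpha> > 0" and "\<alpha> \<le> 1/4"
  shows "(\<forall>\<Gamma>. admissible_curve \<alpha> \<Gamma> \<longrightarrow>
            (\<forall>s > s_crit \<gamma> \<alpha>. \<forall>f g. sobolev s f g \<longrightarrow> converges_ae \<gamma> \<Gamma> f g))
       \<and> (\<exists>\<Gamma>. admissible_curve \<alpha> \<Gamma> \<and>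
            (\<forall>s. 0 \<le> s \<and> s < s_crit \<gamma> \<alpha> \<longrightarrow>
               (\<exists>f g. sobolev s f g \<and> \<not> converges_ae \<gamma> \<Gamma> f g)))"
proof (intro conjI allI impI)
  fix \<Gamma> s f g
  assume "admissible_curve \<alpha> \<Gamma>" "s_crit \<gamma> \<alpha> < s" "sobolev s f g"
  then show "converges_ae \<gamma> \<Gamma> f g" by (rule convergence_above_s_crit[OF assms])
next
  have "\<alpha> \<le> 1" using assms by simp
  moreover have "\<exists>f g. sobolev s f g \<and> \<not> converges_ae \<gamma> (\<lambda>x t. x + \<bar>t\<bar> powr \<alpha>) f g" if "0 \<le> s \<and> s < s_crit \<gamma> \<alpha>" for s
    using divergence_below_s_crit[OF assms, of s] that by blast
  ultimately show "\<exists>\<Gamma>. admissible_curve \<alpha> \<Gamma> \<and> (\<forall>s. 0 \<le> s \<and> s < s_crit \<gamma> \<alpha> \<longrightarrow> (\<exists>f g. sobolev s f g \<and> \<not> converges_ae \<gamma> \<Gamma> f g))"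
    using power_curve_admissible[OF assms(2)] by blast
qed

end
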